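(* Let $d\ge2$, $0\le r_0<r_1\le\infty$, and let $f:A(r_0,r_1)\to\mathbb{C}$ be polyharmonic of infinite order and type $\tau\ge0$; let $\widetilde f_{k,l}(v)=f_{k,l}(e^v)$, $v\in(\log r_0,\log r_1)$. Fix $k\in\mathbb{N}_0$, $l\in\{1,\dots,a_k\}$ and $v_0\in(\log r_0,\log r_1)$. Then the series $$\sum_{n=0}^\infty D^{(n)}\widetilde f_{k,l}(v_0)\,\Phi_n(v-v_0)$$ converges absolutely and uniformly on compact subsets of the disc in $\mathbb{C}$ with center $v_0$ and radius $\ln\!\left(1+\frac{1}{e^{v_0}\tau}\right)$ (radius $\infty$ if $\tau=0$), and its sum is an analytic extension of $\widetilde f_{k,l}$ (it coincides with $\widetilde f_{k,l}$ on $[v_0,v_0+\delta]$ for some $\delta>0$). If $\tau=0$, then $\widetilde f_{k,l}$ extends to an entire function and $f_{k,l}$ possesses an analytic extension to $\mathbb{C}\setminus(-\infty,0]$.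
   Context: $A(r_0,r_1)=\{x\in\mathbb{R}^d: r_0<|x|<r_1\}$. A function $f:G\to\mathbb{C}$ on a domain $G\subset\mathbb{R}^d$ is polyharmonic of infinite order and type $\tau\ge0$ if $f\in C^\infty(G)$ and for every compact $K\subset G$ and every $\varepsilon>0$ there is $C_{K,\varepsilon}>0$ with $\max_{x\in K}|\Delta^p f(x)|\le C_{K,\varepsilon}(2p)!(\tau+\varepsilon)^{2p}$ for all $p\in\mathbb{N}_0$. $Y_{k,l}$, $l=1,\dots,a_k$, is an orthonormal basis (in $L^2(\mathbb{S}^{d-1},d\theta)$) of the harmonic homogeneous polynomials of degree $k$, and $f_{k,l}(r)=\int_{\mathbb{S}^{d-1}}f(r\theta)\overline{Y_{k,l}(\theta)}d\theta$. Exponents: $\lambda_{2j}=k+2j$, $\lambda_{2j+1}=-k-d+2+2j$ ($j\in\mathbb{N}_0$). $D^{(n)}g=(\frac{d}{dv}-\lambda_0)\cdots(\frac{d}{dv}-\lambda_{n-1})g$, $D^{(0)}g=g$. $\Phi_n(z)=\frac{1}{2\pi i}\int_{|w|=R}\frac{e^{zw}}{(w-\lambda_0)\cdots(w-\lambda_n)}dw$ with $R>\max_{j\le n}|\lambda_j|$ (the fundamental function for $\lambda_0,\dots,\lambda_n$). *)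

theory Defs
  imports "HOL-Analysis.Analysis"
begin

definition annulus :: "real \<Rightarrow> ereal \<Rightarrow> 'a::euclidean_space set" where
  "annulus r0 r1 = {x. r0 < norm x \<and> ereal (norm x) < r1}"

definition pdiff :: "'a::euclidean_space \<Rightarrow> ('a \<Rightarrow> complex) \<Rightarrow> 'a \<Rightarrow> complex" where
  "pdiff i g x = vector_derivative (\<lambda>t::real. g (x + t *\<^sub>R i)) (at 0)"

definition pdiff_exists :: "'a::euclidean_space \<Rightarrow> ('a \<Rightarrow> complex) \<Rightarrow> 'a \<Rightarrow> bool" where
  "pdiff_exists i g x \<longleftrightarrow> (\<lambda>t::real. g (x + t *\<^sub>R i)) differentiable (at 0)"

fun iter_pdiff :: "'a::euclidean_space list \<Rightarrow> ('a \<Rightarrow> complex) \<Rightarrow> 'a \<Rightarrow> complex" where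
  "iter_pdiff [] g = g"
| "iter_pdiff (i # is) g = pdiff i (iter_pdiff is g)"

definition smooth_on :: "'a::euclidean_space set \<Rightarrow> ('a \<Rightarrow> complex) \<Rightarrow> bool" where
  "smooth_on G g \<longleftrightarrow>
     (\<forall>is. set is \<subseteq> Basis \<longrightarrow>
        continuous_on G (iter_pdiff is g) \<and>
        (\<forall>i\<in>Basis. \<forall>x\<in>G. pdiff_exists i (iter_pdiff is g) x))"

definition laplacian :: "('a::euclidean_space \<Rightarrow> complex) \<Rightarrow> 'a \<Rightarrow> complex" where
  "laplacian g x = (\<Sum>i\<in>Basis. pdiff i (pdiff i g) x)"

definition polyharmonic_inf_order_type ::
  "'a::euclidean_space set \<Rightarrow> real \<Rightarrow> ('a \<Rightarrow> complex) \<Rightarrow> bool" where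
  "polyharmonic_inf_order_type G \<tau> f \<longleftrightarrow>
     smooth_on G f \<and>
     (\<forall>K. compact K \<and> K \<subseteq> G \<longrightarrow> (\<forall>\<epsilon>>0. \<exists>C>0. \<forall>p::nat. \<forall>x\<in>K.
        norm ((laplacian ^^ p) f x) \<le> C * fact (2*p) * (\<tau> + \<epsilon>) ^ (2*p)))"

definition multi_indices :: "nat \<Rightarrow> ('a::euclidean_space \<Rightarrow> nat) set" where
  "multi_indices k = {\<alpha>. (\<forall>i. i \<notin> Basis \<longrightarrow> \<alpha> i = 0) \<and> (\<Sum>i\<in>Basis. \<alpha> i) = k}"

definition hom_poly :: "nat \<Rightarrow> ('a::euclidean_space \<Rightarrow> complex) \<Rightarrow> bool" where
  "hom_poly k P \<longleftrightarrow> (\<exists>c::('a \<Rightarrow> nat) \<Rightarrow> complex.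
      P = (\<lambda>x. \<Sum>\<alpha>\<in>multi_indices k. c \<alpha> * (\<Prod>i\<in>Basis. complex_of_real (x \<bullet> i) ^ \<alpha> i)))"

definition harmonic_hom_poly :: "nat \<Rightarrow> ('a::euclidean_space \<Rightarrow> complex) \<Rightarrow> bool" where
  "harmonic_hom_poly k P \<longleftrightarrow> hom_poly k P \<and> (\<forall>x. laplacian P x = 0)"

text \<open>Cone-measure definition: sigma(A) = d * Lebesgue measure of {t theta : 0 < t <= 1, theta in A}.\<close>
definition sphere_measure :: "'a::euclidean_space measure" where
  "sphere_measure =
     density (distr (restrict_space lborel (ball 0 1 - {0}))
                    (restrict_space borel (sphere 0 1)) (\<lambda>x. x /\<^sub>R norm x))
             (\<lambda>_. ennreal (real DIM('a)))"

definition sphere_inner :: "('a::euclidean_space \<Rightarrow> complex) \<Rightarrow> ('a \<Rightarrow> complex) \<Rightarrow> complex" where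
  "sphere_inner g h = (LINT \<theta>|sphere_measure. g \<theta> * cnj (h \<theta>))"

definition sph_harm_onb :: "nat \<Rightarrow> nat \<Rightarrow> (nat \<Rightarrow> 'a::euclidean_space \<Rightarrow> complex) \<Rightarrow> bool" where
  "sph_harm_onb k a Y \<longleftrightarrow>
     (\<forall>l\<in>{1..a}. harmonic_hom_poly k (Y l)) \<and>
     (\<forall>l\<in>{1..a}. \<forall>m\<in>{1..a}. sphere_inner (Y l) (Y m) = (if l = m then 1 else 0)) \<and>
     (\<forall>P. harmonic_hom_poly k P \<longrightarrow>
        (\<exists>c. \<forall>\<theta>\<in>sphere 0 1. P \<theta> = (\<Sum>l=1..a. c l * Y l \<theta>)))"

definition radial_coeff :: "('a::euclidean_space \<Rightarrow> complex) \<Rightarrow> ('a \<Rightarrow> complex) \<Rightarrow> real \<Rightarrow> complex" where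
  "radial_coeff f Y r = (LINT \<theta>|sphere_measure. f (r *\<^sub>R \<theta>) * cnj (Y \<theta>))"

definition lam :: "nat \<Rightarrow> nat \<Rightarrow> nat \<Rightarrow> int" where
  "lam d k j = (if even j then int k + int j
                else - int k - int d + 2 + 2 * int (j div 2))"

definition dop :: "complex \<Rightarrow> (real \<Rightarrow> complex) \<Rightarrow> real \<Rightarrow> complex" where
  "dop c g v = vector_derivative g (at v) - c * g v"

fun Dfrom :: "nat \<Rightarrow> nat \<Rightarrow> nat \<Rightarrow> nat \<Rightarrow> (real \<Rightarrow> complex) \<Rightarrow> real \<Rightarrow> complex" where
  "Dfrom d k m 0 g = g"
| "Dfrom d k m (Suc n) g = dop (of_int (lam d k m)) (Dfrom d k (Suc m) n g)"

definition Dn :: "nat \<Rightarrow> nat \<Rightarrow> nat \<Rightarrow> (real \<Rightarrow> complex) \<Rightarrow> real \<Rightarrow> complex" where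
  "Dn d k n g = Dfrom d k 0 n g"

text \<open>Fundamental function Phi_n(z) = 1/(2 pi i) * contour integral over |w| = R of
  e^(zw) / ((w - lam_0) ... (w - lam_n)), written out with the parametrisation
  w = R e^(it), t in [0, 2 pi]; here R = 1 + sum of |lam_j| (j <= n) > max |lam_j|.\<close>
definition Phi_radius :: "nat \<Rightarrow> nat \<Rightarrow> nat \<Rightarrow> real" where
  "Phi_radius d k n = 1 + (\<Sum>j\<le>n. real_of_int \<bar>lam d k j\<bar>)"

definition Phi :: "nat \<Rightarrow> nat \<Rightarrow> nat \<Rightarrow> complex \<Rightarrow> complex" where
  "Phi d k n z =
     (let R = Phi_radius d k n in
      (1 / (2 * pi * \<i>)) *
        integral {0..2*pi} (\<lambda>t. exp (z * (R * exp (\<i> * t))) /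
            (\<Prod>j\<le>n. (R * exp (\<i> * t) - of_int (lam d k j))) * (\<i> * R * exp (\<i> * t))))"

end

theory Submission
  imports Defs "HOL-Complex_Analysis.Complex_Analysis" "HOL-Real_Asymp.Real_Asymp"
begin

text \<open>
  Writing \<open>F\<^sub>p(v)\<close> for the spherical coefficient of \<open>\<Delta>\<^sup>p f\<close> at radius \<open>e\<^sup>v\<close>, the rotation fields
  \<open>x\<^sub>i \<partial>\<^sub>j - x\<^sub>j \<partial>\<^sub>i\<close> have vanishing integral over spheres, so the spherical part of the
  Laplacian is symmetric and \<open>(D - k)(D + k + d - 2) F\<^sub>p = e\<^sup>2\<^sup>v F\<^sub>p\<^sub>+\<^sub>1\<close>.  Hence \<open>D\<^sup>(\<^sup>2\<^sup>p\<^sup>)\<close> of the coefficient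
  is \<open>e\<^sup>2\<^sup>p\<^sup>v F\<^sub>p\<close>, and the growth condition on \<open>\<Delta>\<^sup>p f\<close> bounds it; odd orders follow from a
  Landau-type inequality.  On the other side \<open>\<Phi>\<^sub>n' = \<lambda>\<^sub>n \<Phi>\<^sub>n + \<Phi>\<^sub>n\<^sub>-\<^sub>1\<close> gives
  \<open>\<bar>\<Phi>\<^sub>n(z)\<bar> \<le> e\<^bsup>(k+d)\<bar>z\<bar>\<^esup> (e\<^bsup>\<bar>z\<bar>\<^esup> - 1)\<^sup>n / n!\<close>, which yields the radius \<open>ln (1 + 1 / (e\<^sup>v\<^sup>0 \<tau>))\<close>.
\<close>

section \<open>The fundamental functions\<close>

text \<open>Convergence and identification of the sum use different estimates. Convergence involves
  only the coefficients at \<open>v0\<close>, at most a constant times (n+1)! (e^v0 (tau + eps))^n.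
  Against the bound for Phi_n this leaves (n+1) t^n with t = e^v0 (tau + eps) (e^rho - 1), and some
  eps > 0 gives t < 1 exactly when rho is below the stated radius. Identification needs a remainder
  bound uniform over the segment between \<open>v0\<close> and \<open>v\<close>, where e^v0 becomes
  e^b for the right end b; for tau > 0 equality is therefore proved on a short interval, while for
  tau = 0 the condition can be met on every compact segment. The factorial is (n+1)! because an odd
  order is estimated from both neighbouring even ones. Two encodings shape the rest. The sphere
  carries a cone measure, so integration by parts on it is reduced to translation invariance of
  Lebesgue measure. Smoothness is given through iterated partial derivatives, so total
  differentiability has to be derived.\<close>

definition Phi_kernel :: "nat \<Rightarrow> nat \<Rightarrow> nat \<Rightarrow> complex \<Rightarrow> complex \<Rightarrow> complex" where
  "Phi_kernel d k n z w = exp (z * w) / (\<Prod>j\<le>n. w - of_int (lam d k j))"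

text \<open>The admissible contour radii. \<open>Phi\<close> fixes one radius for each
  \<open>n\<close>, but its recursion needs \<open>n\<close> and \<open>n - 1\<close> on a common
  circle, and its value at 0 needs circles growing to infinity.\<close>

definition lam_bounded_by :: "nat \<Rightarrow> nat \<Rightarrow> nat \<Rightarrow> real \<Rightarrow> bool" where
  "lam_bounded_by d k n R \<longleftrightarrow> 0 < R \<and> (\<forall>j\<le>n. \<bar>real_of_int (lam d k j)\<bar> < R)"

lemma lam_bounded_by_Phi_radius:
  assumes "m \<le> n"
  shows "lam_bounded_by d k m (Phi_radius d k n)"
proof -
  have "\<bar>real_of_int (lam d k j)\<bar> \<le> (\<Sum>j\<le>n. real_of_int \<bar>lam d k j\<bar>)" if "j \<le> n" for j
    using member_le_sum[of j "{..n}" "\<lambda>j. real_of_int \<bar>lam d k j\<bar>"] that by auto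
  moreover have "0 \<le> (\<Sum>j\<le>n. real_of_int \<bar>lam d k j\<bar>)"
    by (rule sum_nonneg) auto
  ultimately have "\<forall>j\<le>n. \<bar>real_of_int (lam d k j)\<bar> < Phi_radius d k n" "0 < Phi_radius d k n"
    unfolding Phi_radius_def by force+
  then show ?thesis
    using assms unfolding lam_bounded_by_def by auto
qed

lemma lam_bounded_by_nonzero:
  fixes w :: complex
  assumes "lam_bounded_by d k n R" "R \<le> norm w" "j \<le> n"
  shows "w - of_int (lam d k j) \<noteq> 0"
proof
  assume "w - of_int (lam d k j) = 0"
  then have "w = of_int (lam d k j)" by simp
  then have "norm w = \<bar>real_of_int (lam d k j)\<bar>"
    by (simp only: norm_of_int)
  moreover have "\<bar>real_of_int (lam d k j)\<bar> < R"
    using assms(1,3) unfolding lam_bounded_by_def by simp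
  ultimately show False
    using assms(2) by linarith
qed

lemma lam_bounded_by_prod_nonzero:
  fixes w :: complex
  assumes "lam_bounded_by d k n R" "R \<le> norm w"
  shows "(\<Prod>j\<le>n. w - of_int (lam d k j)) \<noteq> 0"
proof
  assume "(\<Prod>j\<le>n. w - of_int (lam d k j)) = 0"
  then obtain j where "j \<le> n" "w - of_int (lam d k j) = 0"
    unfolding prod_zero_iff[OF finite_atMost] by blast
  then show False
    using lam_bounded_by_nonzero[OF assms] by blast
qed

text \<open>The straight homotopy between the two circles moves each point along a ray, through
  moduli between \<open>R\<close> and \<open>R'\<close>, so it never meets a pole and Cauchy's
  theorem for homotopic loops applies.\<close>

lemma contour_integral_Phi_kernel_radius:
  assumes "lam_bounded_by d k n R" "lam_bounded_by d k n R'"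
  shows "contour_integral (circlepath 0 R) (Phi_kernel d k n z)
       = contour_integral (circlepath 0 R') (Phi_kernel d k n z)"
proof -
  define S where "S = - ((\<lambda>j. of_int (lam d k j)) ` {..n} :: complex set)"
  have "open S"
    unfolding S_def by (intro open_Compl finite_imp_closed) auto
  have hol: "Phi_kernel d k n z holomorphic_on S"
    unfolding Phi_kernel_def S_def
    by (intro holomorphic_intros holomorphic_on_prod) auto
  have seg: "closed_segment (circlepath 0 R t) (circlepath 0 R' t) \<subseteq> S" for t
  proof
    fix w assume "w \<in> closed_segment (circlepath 0 R t) (circlepath 0 R' t)"
    then obtain u where u: "0 \<le> u" "u \<le> 1"
      and w: "w = of_real ((1 - u) * R + u * R') * exp (2 * of_real pi * \<i> * of_real t)"
      by (auto simp: closed_segment_def circlepath scaleR_conv_of_real algebra_simps)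
    have "norm w = \<bar>(1 - u) * R + u * R'\<bar>"
      unfolding w norm_mult by (simp only: norm_of_real) (simp add: norm_exp_eq_Re)
    also have "\<dots> = (1 - u) * R + u * R'"
      using u assms unfolding lam_bounded_by_def by (intro abs_of_nonneg add_nonneg_nonneg mult_nonneg_nonneg) auto
    finally have nw: "norm w = (1 - u) * R + u * R'" .
    have "\<bar>real_of_int (lam d k j)\<bar> < norm w" if "j \<le> n" for j
    proof -
      define L where "L = \<bar>real_of_int (lam d k j)\<bar>"
      have L: "L < R" "L < R'"
        using assms that unfolding lam_bounded_by_def L_def by auto
      have "L < (1 - u) * R + u * R'"
      proof (cases "u = 0")
        case False
        then have "u * L < u * R'" "(1 - u) * L \<le> (1 - u) * R"
          using L u by (auto intro!: mult_left_mono)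
        then show ?thesis by (simp add: algebra_simps)
      qed (use L in auto)
      then show ?thesis unfolding nw L_def .
    qed
    moreover have "norm (of_int (lam d k j) :: complex) = \<bar>real_of_int (lam d k j)\<bar>" for j
      by (rule norm_of_int)
    ultimately have "w \<noteq> of_int (lam d k j)" if "j \<le> n" for j
      using that by force
    then show "w \<in> S" unfolding S_def by blast
  qed
  have "homotopic_loops S (circlepath 0 R) (circlepath 0 R')"
    by (rule homotopic_loops_linear) (use seg in auto)
  then show ?thesis
    using Cauchy_theorem_homotopic_loops[OF _ \<open>open S\<close> hol] by auto
qed

lemma Phi_eq_contour_integral:
  assumes "lam_bounded_by d k n R"
  shows "Phi d k n z = contour_integral (circlepath 0 R) (Phi_kernel d k n z) / (2 * pi * \<i>)"
proof -
  have "contour_integral (circlepath 0 r) (Phi_kernel d k n z) =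
     integral {0..2*pi} (\<lambda>t. exp (z * (r * exp (\<i> * t))) /
            (\<Prod>j\<le>n. (r * exp (\<i> * t) - of_int (lam d k j))) * (\<i> * r * exp (\<i> * t)))" for r
    unfolding circlepath_def
    by (subst contour_integral_part_circlepath_eq) (simp_all add: cis_conv_exp Phi_kernel_def mult_ac)
  then have "Phi d k n z = contour_integral (circlepath 0 (Phi_radius d k n)) (Phi_kernel d k n z) / (2 * pi * \<i>)"
    unfolding Phi_def Let_def by simp
  with contour_integral_Phi_kernel_radius[OF assms lam_bounded_by_Phi_radius[OF order_refl]]
  show ?thesis by simp
qed

lemma Phi_0: "Phi d k 0 z = exp (of_int (lam d k 0) * z)"
proof -
  have "((\<lambda>w. exp (z * w) / (w - of_int (lam d k 0))) has_contour_integral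
     2 * of_real pi * \<i> * exp (z * of_int (lam d k 0))) (circlepath 0 (Phi_radius d k 0))"
    using lam_bounded_by_Phi_radius[of 0 0 d k] unfolding lam_bounded_by_def
    by (intro Cauchy_integral_circlepath holomorphic_intros continuous_intros) auto
  then have "contour_integral (circlepath 0 (Phi_radius d k 0)) (Phi_kernel d k 0 z) = 2 * of_real pi * \<i> * exp (z * of_int (lam d k 0))"
    unfolding Phi_kernel_def by (simp add: contour_integral_unique)
  then show ?thesis
    using Phi_eq_contour_integral[OF lam_bounded_by_Phi_radius[OF order_refl], of d k 0 z]
    by (simp add: mult.commute)
qed

lemma continuous_on_Phi_kernel:
  assumes "lam_bounded_by d k n R"
  shows "continuous_on (sphere 0 R) (Phi_kernel d k n z)"
  unfolding Phi_kernel_def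
  by (rule continuous_on_divide) (use lam_bounded_by_prod_nonzero[OF assms] in \<open>auto intro!: continuous_on_exp continuous_on_mult continuous_on_prod continuous_on_diff continuous_on_const continuous_on_id simp del: prod_zero_iff\<close>)

text \<open>At \<open>z = 0\<close> the exponential is 1 and the kernel has size R^(-n-1) on a
  circle of length 2 pi R. The value does not depend on R, so letting R grow gives 0 as soon as n is
  positive.\<close>

lemma Phi_at_0:
  assumes "n \<ge> 1"
  shows "Phi d k n 0 = 0"
proof -
  define M where "M = Phi_radius d k n"
  have M: "M > 0" "\<And>j. j \<le> n \<Longrightarrow> \<bar>real_of_int (lam d k j)\<bar> < M"
    using lam_bounded_by_Phi_radius[of n n d k] unfolding lam_bounded_by_def M_def by auto
  have bound: "norm (Phi d k n 0) \<le> R / (R - M) ^ Suc n" if "R > M" for R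
  proof -
    have b: "lam_bounded_by d k n R"
      using M that unfolding lam_bounded_by_def by force
    have le: "norm (Phi_kernel d k n 0 w) \<le> 1 / (R - M) ^ Suc n" if "norm w = R" for w
    proof -
      have "(\<Prod>j\<le>n. R - M) \<le> (\<Prod>j\<le>n. norm (w - of_int (lam d k j)))"
      proof (rule prod_mono, intro conjI)
        fix j assume "j \<in> {..n}"
        then have "\<bar>real_of_int (lam d k j)\<bar> < M" using M by auto
        moreover have "norm w - norm (of_int (lam d k j) :: complex) \<le> norm (w - of_int (lam d k j))"
          by (rule norm_triangle_ineq2)
        ultimately show "R - M \<le> norm (w - of_int (lam d k j))"
          using \<open>norm w = R\<close> by (simp add: )
      qed (use \<open>R > M\<close> in auto)
      then have "(R - M) ^ Suc n \<le> norm (\<Prod>j\<le>n. w - of_int (lam d k j))"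
        by (simp add: prod_norm)
      then show ?thesis
        unfolding Phi_kernel_def using \<open>R > M\<close>
        by (simp add: norm_divide frac_le del: power_Suc)
    qed
    have int: "Phi_kernel d k n 0 contour_integrable_on (circlepath 0 R)"
      using b by (intro contour_integrable_continuous_circlepath)
        (auto simp: lam_bounded_by_def intro!: continuous_on_Phi_kernel)
    have "norm (contour_integral (circlepath 0 R) (Phi_kernel d k n 0)) \<le> 1 / (R - M) ^ Suc n * (2 * pi * R)"
      using has_contour_integral_bound_circlepath[OF has_contour_integral_integral[OF int], of "1 / (R - M) ^ Suc n"]
        le that M by (auto simp: )
    then show ?thesis
      unfolding Phi_eq_contour_integral[OF b] by (simp add: norm_divide norm_mult field_simps)
  qed
  have ev: "\<forall>\<^sub>F R in at_top. norm (Phi d k n 0) \<le> R / (R - M) ^ 2"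
    using eventually_ge_at_top[of "M + 1"]
  proof eventually_elim
    case (elim R)
    have "norm (Phi d k n 0) \<le> R / (R - M) ^ Suc n" using bound elim by auto
    \<comment> \<open>Here \<open>R - M\<close> is at least 1 and \<open>Suc n\<close> at least 2;
      the fixed exponent 2 is enough for the limit.\<close>
    also have "\<dots> \<le> R / (R - M) ^ 2"
      using elim M assms by (intro divide_left_mono power_increasing mult_pos_pos zero_less_power) auto
    finally show ?case .
  qed
  have "((\<lambda>R. R / (R - M) ^ 2) \<longlongrightarrow> 0) at_top"
    by real_asymp
  from tendsto_lowerbound[OF this ev] show ?thesis by simp
qed

lemma contour_integral_circlepath_eq_integral:
  "contour_integral (circlepath 0 r) h = integral {0..2*pi} (\<lambda>t. h (r * exp (\<i> * t)) * (\<i> * r * exp (\<i> * t)))"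
  unfolding circlepath_def
  by (subst contour_integral_part_circlepath_eq) (simp_all add: cis_conv_exp algebra_simps)

text \<open>Differentiation under the integral brings down a factor w. In the splitting w = lam_n +
  (w - lam_n) the second summand cancels the last factor of the denominator and leaves the kernel of
  index \<open>n - 1\<close> on the same circle.\<close>

lemma has_field_derivative_Phi:
  "(Phi d k n has_field_derivative
      of_int (lam d k n) * Phi d k n z + (if n = 0 then 0 else Phi d k (n - 1) z)) (at z)"
proof (cases n)
  case 0
  have "Phi d k 0 = (\<lambda>z. exp (of_int (lam d k 0) * z))"
    by (rule ext) (rule Phi_0)
  then show ?thesis
    unfolding 0 by (auto intro!: derivative_eq_intros)
next
  case (Suc m)
  define R where "R = Phi_radius d k n"
  define c :: "real \<Rightarrow> complex" where "c = (\<lambda>t. R * exp (\<i> * t))"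
  have b: "lam_bounded_by d k n R" and bm: "lam_bounded_by d k m R"
    unfolding R_def using Suc by (auto intro: lam_bounded_by_Phi_radius)
  have R: "R > 0" using b unfolding lam_bounded_by_def by auto
  have nc: "norm (c t) = R" for t
    using R unfolding c_def by (simp add: norm_mult)
  have nz: "(\<Prod>j\<le>n. c t - of_int (lam d k j)) \<noteq> 0" for t
    using lam_bounded_by_prod_nonzero[OF b, of "c t"] nc by simp
  have nzm: "(\<Prod>j\<le>m. c t - of_int (lam d k j)) \<noteq> 0" for t
    using lam_bounded_by_prod_nonzero[OF bm, of "c t"] nc by simp
  have nzn: "c t - of_int (lam d k n) \<noteq> 0" for t
    by (rule lam_bounded_by_nonzero[OF b]) (auto simp: nc)
  have contc: "continuous_on A (\<lambda>x. c (h x))"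
    if "continuous_on A h" for A :: "'b::topological_space set" and h
    unfolding c_def by (intro continuous_intros that)
  define f where "f = (\<lambda>z t. Phi_kernel d k n z (c t) * (\<i> * c t))"
  have cont: "continuous_on A (\<lambda>x. Phi_kernel d k n (g x) (c (h x)) * (\<i> * c (h x)))"
    if "continuous_on A g" "continuous_on A h" for A :: "'b::topological_space set" and g h
    unfolding Phi_kernel_def by (intro continuous_intros contc that ballI nz)
  have "((\<lambda>z. integral (cbox 0 (2*pi)) (f z)) has_field_derivative
       integral (cbox 0 (2*pi)) (\<lambda>t. c t * f z t)) (at z within UNIV)"
  proof (rule leibniz_rule_field_derivative)
    show "((\<lambda>z. f z t) has_field_derivative c t * f z t) (at z within UNIV)" for z t
    proof -
      have "((\<lambda>z. exp (z * c t) / P * (\<i> * c t)) has_field_derivative c t * (exp (z * c t) / P * (\<i> * c t))) (at z within UNIV)" if "P \<noteq> 0" for P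
        by (rule derivative_eq_intros refl that | simp)+
      then show ?thesis unfolding f_def Phi_kernel_def using nz by blast
    qed
    show "f z integrable_on cbox 0 (2*pi)" for z
      unfolding f_def by (intro integrable_continuous cont continuous_intros)
    have "continuous_on (UNIV \<times> cbox 0 (2*pi)) (\<lambda>x. c (snd x) * (Phi_kernel d k n (fst x) (c (snd x)) * (\<i> * c (snd x))))"
      by (intro continuous_intros cont contc)
    then show "continuous_on (UNIV \<times> cbox 0 (2*pi)) (\<lambda>(x, t). c t * f x t)"
      unfolding f_def by (simp add: case_prod_unfold)
  qed auto
  moreover have fI: "integral (cbox 0 (2*pi)) (f z) = 2 * pi * \<i> * Phi d k n z" for z
    unfolding Phi_eq_contour_integral[OF b] contour_integral_circlepath_eq_integral f_def c_def
    by (simp add: mult_ac)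
  moreover have "integral (cbox 0 (2*pi)) (\<lambda>t. c t * f z t)
       = of_int (lam d k n) * (2 * pi * \<i> * Phi d k n z) + 2 * pi * \<i> * Phi d k m z"
  proof -
    have split: "c t * f z t = of_int (lam d k n) * f z t + Phi_kernel d k m z (c t) * (\<i> * c t)" for t
    proof -
      have "(c t - of_int (lam d k n)) * Phi_kernel d k n z (c t) = Phi_kernel d k m z (c t)"
        unfolding Phi_kernel_def using nzn[of t] by (simp add: Suc)
      moreover have "c t * f z t = of_int (lam d k n) * f z t + ((c t - of_int (lam d k n)) * Phi_kernel d k n z (c t)) * (\<i> * c t)"
        unfolding f_def by (simp add: algebra_simps)
      ultimately show ?thesis by (simp only:)
    qed
    have i1: "f z integrable_on cbox 0 (2*pi)"
      unfolding f_def by (intro integrable_continuous cont continuous_intros)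
    have cm: "continuous_on A (\<lambda>t. Phi_kernel d k m z (c t) * (\<i> * c t))" for A
      unfolding Phi_kernel_def by (intro continuous_intros contc ballI nzm)
    have "integral (cbox 0 (2*pi)) (\<lambda>t. c t * f z t) = of_int (lam d k n) * integral (cbox 0 (2*pi)) (f z)
        + integral (cbox 0 (2*pi)) (\<lambda>t. Phi_kernel d k m z (c t) * (\<i> * c t))"
      unfolding split
      by (subst integral_add)
        (intro integrable_on_mult_right i1 integrable_continuous cm, intro integrable_continuous cm, simp)
    also have "integral (cbox 0 (2*pi)) (\<lambda>t. Phi_kernel d k m z (c t) * (\<i> * c t)) = 2 * pi * \<i> * Phi d k m z"
      unfolding Phi_eq_contour_integral[OF bm] contour_integral_circlepath_eq_integral c_def
      by (simp add: mult_ac)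
    finally show ?thesis unfolding fI .
  qed
  ultimately have "((\<lambda>z. (2 * pi * \<i>) * Phi d k n z) has_field_derivative
      (2 * pi * \<i>) * (of_int (lam d k n) * Phi d k n z + Phi d k m z)) (at z)"
    by (simp add: algebra_simps)
  then have "((\<lambda>z. (1 / (2 * pi * \<i>)) * ((2 * pi * \<i>) * Phi d k n z)) has_field_derivative
      (1 / (2 * pi * \<i>)) * ((2 * pi * \<i>) * (of_int (lam d k n) * Phi d k n z + Phi d k m z))) (at z)"
    by (rule DERIV_cmult)
  then show ?thesis using Suc by simp
qed

text \<open>The slope 1 in \<open>n\<close> is what counts: differentiating (e^x - 1)^n in the
  majorant of \<open>norm_Phi_le\<close> produces just the factor \<open>n\<close> that absorbs
  it.\<close>

lemma abs_lam_le:
  assumes "d \<ge> 1"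
  shows "\<bar>real_of_int (lam d k n)\<bar> \<le> real (k + d + n)"
proof -
  have "\<bar>lam d k n\<bar> \<le> int (k + d + n)"
    using assms unfolding lam_def by (auto elim!: oddE)
  then show ?thesis by linarith
qed

text \<open>This is b_m' = (M + m) b_m + b_(m-1) for b_m(y) = e^(M y) (e^y - 1)^m / m!, with the
  chain factor \<open>x\<close> from y = s x; it rests on e^y = (e^y - 1) + 1. The letters stand for
  \<open>A\<close> = e^(M y), \<open>E\<close> = e^y, \<open>p\<close> = (E - 1)^(m-1) and
  \<open>F\<close> = (m-1)!.\<close>

lemma deriv_Phi_majorant_aux:
  fixes A E M x p F m :: real
  assumes "F \<noteq> 0" "m \<noteq> 0"
  shows "(A * (M * x) * ((E - 1) * p) + A * (m * p * (E * x))) / (m * F)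
       = x * ((M + m) * (A * ((E - 1) * p) / (m * F)) + A * p / F)"
proof -
  define Y where "Y = A * ((E - 1) * p) / (m * F)"
  have "m * Y = A * ((E - 1) * p) / F"
    using assms unfolding Y_def by simp
  then have "x * ((M + m) * Y + A * p / F) = x * M * Y + x * (A * ((E - 1) * p) / F + A * p / F)"
    by (simp add: distrib_left distrib_right)
  also have "A * ((E - 1) * p) / F + A * p / F = A * p * E / F"
    by (simp add: algebra_simps flip: add_divide_distrib)
  also have "x * M * Y = A * (M * x) * ((E - 1) * p) / (m * F)"
    unfolding Y_def by simp
  also have "x * (A * p * E / F) = A * (m * p * (E * x)) / (m * F)"
    using assms by simp
  finally show ?thesis
    unfolding Y_def by (simp only: add_divide_distrib)
qed

text \<open>Comparison along the segment from 0 to \<open>z\<close>: the majorant solves the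
  recursion of Phi with lam_n replaced by its upper bound k + d + n. Integrating factors
  (\<open>g\<close> and \<open>\<phi>\<close>) remove these terms, the induction hypothesis compares
  the derivatives, and both sides vanish at 0 for positive index.\<close>

lemma norm_Phi_le:
  assumes "d \<ge> 1"
  shows "norm (Phi d k n z) \<le> exp (real (k + d) * norm z) * (exp (norm z) - 1) ^ n / fact n"
proof (induction n arbitrary: z)
  case 0
  have "Re (of_int (lam d k 0) * z) \<le> norm (of_int (lam d k 0) * z)"
    by (rule complex_Re_le_cmod)
  also have "\<dots> = \<bar>real_of_int (lam d k 0)\<bar> * norm z"
    by (simp add: norm_mult)
  also have "\<dots> \<le> real (k + d) * norm z"
    using abs_lam_le[OF assms, of k 0] by (intro mult_right_mono) auto
  finally show ?case
    unfolding Phi_0 by simp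
next
  case (Suc n)
  define L where "L = (of_int (lam d k (Suc n)) :: complex)"
  define M x where "M = real (k + d)" and "x = norm z"
  define N where "N = M + real (Suc n)"
  define g where "g = (\<lambda>w. exp (L * z * (1 - w)) * Phi d k (Suc n) (w * z))"
  define b where "b = (\<lambda>n x. exp (M * x) * (exp x - 1) ^ n / fact n)"
  define \<phi> where "\<phi> = (\<lambda>s. exp (N * x * (1 - s)) * b (Suc n) (s * x))"
  have L: "norm L \<le> N"
    unfolding L_def N_def M_def using abs_lam_le[OF assms, of k "Suc n"] by simp
  have dg: "((\<lambda>s. g (of_real s)) has_vector_derivative
      exp (L * z * (1 - of_real s)) * (z * Phi d k n (of_real s * z))) (at s)" for s
  proof -
    have "(g has_field_derivative exp (L * z * (1 - w)) * (z * Phi d k n (w * z))) (at w)" for w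
      unfolding g_def
      by (rule derivative_eq_intros DERIV_chain2[OF has_field_derivative_Phi] refl)+
         (simp add: L_def algebra_simps)
    then show ?thesis by (rule has_vector_derivative_real_field)
  qed
  have d\<phi>: "(\<phi> has_real_derivative exp (N * x * (1 - s)) * (x * b n (s * x))) (at s)" for s
  proof -
    have "((\<lambda>s. exp (M * (s * x)) * (exp (s * x) - 1) ^ Suc n / fact (Suc n)) has_real_derivative
       (exp (M * (s * x)) * (M * x) * (exp (s * x) - 1) ^ Suc n +
        exp (M * (s * x)) * (real (Suc n) * (exp (s * x) - 1) ^ n * (exp (s * x) * x))) / fact (Suc n)) (at s)"
      by (rule derivative_eq_intros refl | simp)+
    also have "(exp (M * (s * x)) * (M * x) * (exp (s * x) - 1) ^ Suc n +
        exp (M * (s * x)) * (real (Suc n) * (exp (s * x) - 1) ^ n * (exp (s * x) * x))) / fact (Suc n)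
        = x * (N * b (Suc n) (s * x) + b n (s * x))"
      unfolding b_def N_def power_Suc fact_Suc
      by (rule deriv_Phi_majorant_aux) auto
    finally have db: "((\<lambda>s. b (Suc n) (s * x)) has_real_derivative x * (N * b (Suc n) (s * x) + b n (s * x))) (at s)"
      unfolding b_def .
    have ring: "e * (0 * (1 - s) + (0 - 1) * (N * x)) * B + x * (N * B + c) * e = e * (x * c)" for e B c :: real
      by (simp add: algebra_simps)
    show ?thesis
      unfolding \<phi>_def
      by (rule derivative_eq_intros db refl ring | simp only: mult_1_right)+
  qed
  have "norm (g (of_real 1) - g (of_real 0)) \<le> \<phi> 1 - \<phi> 0"
  proof (rule differentiable_bound_general[OF zero_less_one])
    show "continuous_on {0..1} (\<lambda>s. g (of_real s))"
      by (intro continuous_at_imp_continuous_on ballI has_vector_derivative_continuous[OF dg])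
    show "continuous_on {0..1} \<phi>"
      by (intro continuous_at_imp_continuous_on ballI DERIV_isCont[OF d\<phi>])
    show "(\<phi> has_vector_derivative exp (N * x * (1 - s)) * (x * b n (s * x))) (at s)" for s
      using d\<phi> unfolding has_real_derivative_iff_has_vector_derivative .
    fix s :: real assume s: "0 < s" "s < 1"
    show "((\<lambda>s. g (of_real s)) has_vector_derivative
      exp (L * z * (1 - of_real s)) * (z * Phi d k n (of_real s * z))) (at s)" by (rule dg)
    have e: "norm (exp (L * z * (1 - of_real s))) \<le> exp (N * x * (1 - s))"
    proof -
      have "Re (L * z * (1 - of_real s)) \<le> norm (L * z * (1 - of_real s))"
        by (rule complex_Re_le_cmod)
      moreover have "norm (1 - complex_of_real s) = 1 - s"
        using s norm_of_real[of "1 - s", where ?'a = complex] by simp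
      then have "norm (L * z * (1 - of_real s)) = norm L * x * (1 - s)"
        unfolding x_def norm_mult by simp
      moreover have "norm L * x * (1 - s) \<le> N * x * (1 - s)"
        using L s unfolding x_def by (intro mult_right_mono) auto
      ultimately show ?thesis by simp
    qed
    have "norm (of_real s * z) = s * x"
      using s unfolding x_def norm_mult by simp
    then have "norm (z * Phi d k n (of_real s * z)) \<le> x * b n (s * x)"
      using Suc.IH[of "of_real s * z"] unfolding norm_mult x_def b_def M_def
      by (metis mult_left_mono norm_ge_zero)
    then have "norm (exp (L * z * (1 - of_real s))) * norm (z * Phi d k n (of_real s * z))
        \<le> exp (N * x * (1 - s)) * (x * b n (s * x))"
      by (rule mult_mono[OF e]) auto
    then show "norm (exp (L * z * (1 - of_real s)) * (z * Phi d k n (of_real s * z)))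
        \<le> exp (N * x * (1 - s)) * (x * b n (s * x))"
      by (simp only: norm_mult)
  qed
  moreover have "g (of_real 1) = Phi d k (Suc n) z" "g (of_real 0) = 0" "\<phi> 1 = b (Suc n) x" "\<phi> 0 = 0"
    unfolding g_def \<phi>_def b_def by (auto simp: Phi_at_0)
  ultimately show ?case unfolding b_def x_def M_def by simp
qed

section \<open>Convergence and sum of series in the fundamental functions\<close>

lemma Phi_holomorphic: "Phi d k n holomorphic_on S"
proof (rule holomorphic_on_subset)
  show "Phi d k n holomorphic_on UNIV"
    unfolding holomorphic_on_open[OF open_UNIV] using has_field_derivative_Phi by blast
qed simp

text \<open>Of the factorials only (n+1)!/n! = n + 1 remains, so the series is dominated by the
  derivative of a geometric series.\<close>

lemma norm_Phi_term_le:
  assumes "d \<ge> 1" "C \<ge> 0" "q \<ge> 0"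
    and c: "norm c \<le> C * fact (n + 1) * q ^ n" and z: "norm z \<le> \<rho>"
  shows "norm (c * Phi d k n z) \<le> C * exp (real (k + d) * \<rho>) * (real (Suc n) * (q * (exp \<rho> - 1)) ^ n)"
proof -
  have "norm (Phi d k n z) \<le> exp (real (k + d) * norm z) * (exp (norm z) - 1) ^ n / fact n"
    by (rule norm_Phi_le) fact
  also have "\<dots> \<le> exp (real (k + d) * \<rho>) * (exp \<rho> - 1) ^ n / fact n"
    using z by (intro divide_right_mono mult_mono power_mono) (auto intro: mult_left_mono order_trans[OF norm_ge_zero])
  finally have "norm c * norm (Phi d k n z) \<le>
      (C * fact (n + 1) * q ^ n) * (exp (real (k + d) * \<rho>) * (exp \<rho> - 1) ^ n / fact n)"
    using assms by (intro mult_mono c) auto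
  also have "\<dots> = C * exp (real (k + d) * \<rho>) * ((fact (n + 1) / fact n) * (q ^ n * (exp \<rho> - 1) ^ n))"
    by simp
  also have "fact (n + 1) / fact n = real (Suc n)"
    by simp
  also have "q ^ n * (exp \<rho> - 1) ^ n = (q * (exp \<rho> - 1)) ^ n"
    by (simp only: power_mult_distrib)
  finally show ?thesis unfolding norm_mult .
qed

lemma summable_Suc_power:
  fixes t :: real
  assumes "0 \<le> t" "t < 1"
  shows "summable (\<lambda>n. real (Suc n) * t ^ n)"
proof -
  have "norm t < 1" using assms by simp
  from sums_summable[OF geometric_deriv_sums[OF this]] show ?thesis .
qed

lemma uniformly_convergent_Phi_series:
  assumes "d \<ge> 1" "C \<ge> 0" "q \<ge> 0" "\<rho> \<ge> 0" "q * (exp \<rho> - 1) < 1"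
    and c: "\<And>n. norm (c n) \<le> C * fact (n + 1) * q ^ n"
  shows "uniformly_convergent_on (cball 0 \<rho>) (\<lambda>N z. \<Sum>n<N. c n * Phi d k n z)"
    and "uniformly_convergent_on (cball 0 \<rho>) (\<lambda>N z. \<Sum>n<N. norm (c n * Phi d k n z))"
proof -
  have s: "summable (\<lambda>n. C * exp (real (k + d) * \<rho>) * (real (Suc n) * (q * (exp \<rho> - 1)) ^ n))"
    using assms by (intro summable_mult summable_Suc_power) auto
  show "uniformly_convergent_on (cball 0 \<rho>) (\<lambda>N z. \<Sum>n<N. c n * Phi d k n z)"
    by (rule Weierstrass_m_test'[OF norm_Phi_term_le s]) (use assms in auto)
  show "uniformly_convergent_on (cball 0 \<rho>) (\<lambda>N z. \<Sum>n<N. norm (c n * Phi d k n z))"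
    by (rule Weierstrass_m_test'[OF _ s]) (use assms norm_Phi_term_le in \<open>auto simp del: of_nat_Suc\<close>)
qed

lemma tendsto_Suc_Suc_power:
  fixes t :: real
  assumes "0 \<le> t" "t < 1"
  shows "(\<lambda>m. real (Suc m) * real (Suc (Suc m)) * t ^ m) \<longlonglongrightarrow> 0"
proof (rule tendsto_sandwich[where f = "\<lambda>_. 0"])
  \<comment> \<open>With t = r^2 and m + 2 at most 2 (m + 1), the term is at most twice the square
    of (m + 1) r^m, which tends to 0.\<close>
  define r where "r = sqrt t"
  have r: "0 \<le> r" "r < 1" "t = r ^ 2" using assms unfolding r_def by auto
  have "(\<lambda>m. real (Suc m) * r ^ m) \<longlonglongrightarrow> 0"
    by (intro summable_LIMSEQ_zero summable_Suc_power r)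
  then have "(\<lambda>m. 2 * (real (Suc m) * r ^ m) ^ 2) \<longlonglongrightarrow> 2 * 0 ^ 2"
    by (intro tendsto_intros)
  then show "(\<lambda>m. 2 * (real (Suc m) * r ^ m) ^ 2) \<longlonglongrightarrow> 0" by simp
  have "real (Suc m) * real (Suc (Suc m)) * t ^ m \<le> 2 * (real (Suc m) * r ^ m) ^ 2" for m
  proof -
    have "real (Suc m) * real (Suc (Suc m)) * t ^ m \<le> real (Suc m) * (2 * real (Suc m)) * t ^ m"
      using assms by (intro mult_right_mono mult_left_mono) auto
    also have "\<dots> = 2 * (real (Suc m) * r ^ m) ^ 2"
      unfolding r(3) by (simp only: power_mult_distrib power2_eq_square mult_ac)
    finally show ?thesis .
  qed
  then show "\<forall>\<^sub>F m in sequentially. real (Suc m) * real (Suc (Suc m)) * t ^ m \<le> 2 * (real (Suc m) * r ^ m) ^ 2"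
    by (intro always_eventually allI)
qed (use assms in auto)

text \<open>The derivative in the base point \<open>s\<close> of a partial sum of the series telescopes to a single term.\<close>
lemma Phi_series_sums:
  fixes Q :: "nat \<Rightarrow> real \<Rightarrow> complex"
  assumes "d \<ge> 1" "C \<ge> 0" "q \<ge> 0" "q * (exp (b - a) - 1) < 1"
    and Q: "\<And>n s. s \<in> {a..b} \<Longrightarrow>
      (Q n has_vector_derivative of_int (lam d k n) * Q n s + Q (Suc n) s) (at s)"
    and bound: "\<And>n s. s \<in> {a..b} \<Longrightarrow> norm (Q n s) \<le> C * fact (n + 1) * q ^ n"
    and v: "v \<in> {a..b}" "v0 \<in> {a..b}"
  shows "(\<lambda>n. Q n v0 * Phi d k n (of_real v - of_real v0)) sums Q 0 v"
proof -
  define P where "P = (\<lambda>n s. Phi d k n (of_real v - of_real s))"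
  define S where "S = (\<lambda>N s. \<Sum>n<N. Q n s * P n s)"
  have dP: "(P n has_vector_derivative
      - (of_int (lam d k n) * P n s + (if n = 0 then 0 else P (n - 1) s))) (at s)" for n s
  proof -
    have "((\<lambda>w. Phi d k n (of_real v - w)) has_field_derivative
       (of_int (lam d k n) * Phi d k n (of_real v - w) + (if n = 0 then 0 else Phi d k (n - 1) (of_real v - w))) * (-1)) (at w)" for w
      by (rule DERIV_chain2[OF has_field_derivative_Phi]) (auto intro!: derivative_eq_intros)
    from has_vector_derivative_real_field[OF this[of "of_real s"]] show ?thesis
      unfolding P_def by simp
  qed
  \<comment> \<open>Each product Q_n P_n contributes Q_(n+1) P_n - Q_n P_(n-1), because the two
    lam_n terms have opposite signs.\<close>
  have dS: "(S (Suc m) has_vector_derivative Q (Suc m) s * P m s) (at s)" if "s \<in> {a..b}" for m s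
  proof (induction m)
    case 0
    have "S (Suc 0) = (\<lambda>s. Q 0 s * P 0 s)" unfolding S_def by simp
    then show ?case
      using has_vector_derivative_mult[OF Q[OF that, of 0] dP[of 0 s]] by (simp add: algebra_simps)
  next
    case (Suc m)
    have "S (Suc (Suc m)) = (\<lambda>s. S (Suc m) s + Q (Suc m) s * P (Suc m) s)" unfolding S_def by simp
    then show ?case
      using has_vector_derivative_add[OF Suc has_vector_derivative_mult[OF Q[OF that, of "Suc m"] dP[of "Suc m" s]]]
      by (simp add: algebra_simps)
  qed
  define t where "t = q * (exp (b - a) - 1)"
  \<comment> \<open>The bound for \<open>Q (Suc m)\<close> is rewritten as (m + 2) q times (m + 1)!
    q^m so that \<open>norm_Phi_term_le\<close> applies, and the latter adds (m + 1) t^m. This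
    explains the two polynomial factors.\<close>
  define B where "B = (\<lambda>m. C * q * exp (real (k + d) * (b - a)) * (real (Suc m) * real (Suc (Suc m)) * t ^ m))"
  have "a \<le> b" using v by auto
  then have t: "0 \<le> t" "t < 1" using assms unfolding t_def by auto
  have bd: "norm (Q (Suc m) s * P m s) \<le> B m" if "s \<in> {a..b}" for m s
  proof -
    \<comment> \<open>Both \<open>v\<close> and \<open>s\<close> range over the whole interval, so
      \<open>v\<close> may lie on either side of \<open>v0\<close>.\<close>
    have nz: "norm (complex_of_real v - of_real s) \<le> b - a"
      unfolding of_real_diff[symmetric] norm_of_real using v that by (simp only: atLeastAtMost_iff, arith)
    have "(fact (Suc m + 1) :: real) = real (Suc (Suc m)) * fact (m + 1)" by simp
    then have c: "norm (Q (Suc m) s) \<le> (C * q * real (Suc (Suc m))) * fact (m + 1) * q ^ m"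
      using bound[OF that, of "Suc m"] by (simp only: power_Suc mult_ac)
    have "norm (Q (Suc m) s * P m s) \<le> C * q * real (Suc (Suc m)) * exp (real (k + d) * (b - a)) * (real (Suc m) * (q * (exp (b - a) - 1)) ^ m)"
      unfolding P_def by (rule norm_Phi_term_le[OF _ _ _ c nz]) (use assms in auto)
    also have "\<dots> = B m"
      unfolding B_def t_def by (simp only: mult_ac)
    finally show ?thesis .
  qed
  have diff: "norm (S (Suc m) v0 - S (Suc m) v) \<le> B m * norm (v0 - v)" for m
  proof (rule differentiable_bound[of "{a..b}" "S (Suc m)" "\<lambda>s h. h *\<^sub>R (Q (Suc m) s * P m s)"])
    fix s assume s: "s \<in> {a..b}"
    show "(S (Suc m) has_derivative (\<lambda>h. h *\<^sub>R (Q (Suc m) s * P m s))) (at s within {a..b})"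
      using dS[OF s, of m] unfolding has_vector_derivative_def by (rule has_derivative_at_withinI)
    show "onorm (\<lambda>h. h *\<^sub>R (Q (Suc m) s * P m s)) \<le> B m"
    proof (rule onorm_le)
      fix h :: real
      have "norm (Q (Suc m) s * P m s) * norm h \<le> B m * norm h"
        by (rule mult_right_mono[OF bd[OF s]]) simp
      then show "norm (h *\<^sub>R (Q (Suc m) s * P m s)) \<le> B m * norm h"
        by (simp only: norm_scaleR real_norm_def mult.commute)
    qed
  qed (use v in auto)
  \<comment> \<open>With base point \<open>v\<close> itself only index 0 survives, because Phi_n(0)
    = 0 for positive n and Phi_0(0) = 1.\<close>
  have Sv: "S (Suc m) v = Q 0 v" for m
  proof -
    have "S (Suc m) v = Q 0 v * P 0 v + (\<Sum>n<m. Q (Suc n) v * P (Suc n) v)"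
      unfolding S_def by (rule sum.lessThan_Suc_shift)
    also have "\<dots> = Q 0 v" unfolding P_def by (simp add: Phi_at_0 Phi_0)
    finally show ?thesis .
  qed
  have "(\<lambda>m. B m * norm (v0 - v)) \<longlonglongrightarrow> C * q * exp (real (k + d) * (b - a)) * 0 * norm (v0 - v)"
    unfolding B_def by (intro tendsto_intros tendsto_Suc_Suc_power t)
  then have "(\<lambda>m. B m * norm (v0 - v)) \<longlonglongrightarrow> 0"
    by simp
  moreover have "\<forall>\<^sub>F m in sequentially. norm (S (Suc m) v0 - Q 0 v) \<le> B m * norm (v0 - v)"
    using diff unfolding Sv by (intro always_eventually allI)
  ultimately have "(\<lambda>m. S (Suc m) v0 - Q 0 v) \<longlonglongrightarrow> 0"
    by (rule Lim_null_comparison[rotated])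
  then have "(\<lambda>m. S (Suc m) v0) \<longlonglongrightarrow> Q 0 v"
    by (simp add: LIM_zero_iff)
  then have "(\<lambda>m. S m v0) \<longlonglongrightarrow> Q 0 v"
    by (rule LIMSEQ_imp_Suc)
  then show ?thesis
    unfolding sums_def S_def P_def .
qed

section \<open>The differential operators along a radial system\<close>

text \<open>An explicit tower of derivatives is carried along because \<open>dop\<close> is built on
  \<open>vector_derivative\<close>, whose value is meaningful only once a derivative is known to
  exist.\<close>

definition smooth_curve :: "real set \<Rightarrow> (real \<Rightarrow> complex) \<Rightarrow> bool" where
  "smooth_curve S g \<longleftrightarrow> (\<exists>h. h 0 = g \<and>
     (\<forall>i::nat. \<forall>v\<in>S. (h i has_vector_derivative h (Suc i) v) (at v)))"

lemma smooth_curve_dop: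
  assumes "smooth_curve S g" "open S"
  shows "smooth_curve S (dop c g)"
proof -
  obtain h where h: "h 0 = g" "\<And>i v. v \<in> S \<Longrightarrow> (h i has_vector_derivative h (Suc i) v) (at v)"
    using assms unfolding smooth_curve_def by blast
  define h' where "h' = (\<lambda>i v. h (Suc i) v - c * h i v)"
  have h': "(h' i has_vector_derivative h' (Suc i) v) (at v)" if "v \<in> S" for i v
    unfolding h'_def
    by (intro has_vector_derivative_diff has_vector_derivative_mult_right h(2) that)
  have eq: "h' 0 v = dop c g v" if "v \<in> S" for v
    using vector_derivative_at[OF h(2)[OF that, of 0]] unfolding h'_def dop_def h(1) by simp
  \<comment> \<open>\<open>h' 0\<close> is known to equal \<open>dop c g\<close> only on
    \<open>S\<close>, whereas \<open>smooth_curve\<close> asks for equality of functions; so level 0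
    is replaced.\<close>
  define h'' where "h'' = (\<lambda>i::nat. if i = 0 then dop c g else h' i)"
  have "(h'' i has_vector_derivative h'' (Suc i) v) (at v)" if "v \<in> S" for i v
  proof (cases "i = 0")
    case True
    have "(dop c g has_vector_derivative h' (Suc 0) v) (at v)"
      by (rule has_vector_derivative_transform_within_open[OF h'[OF that] assms(2) that]) (rule eq)
    then show ?thesis unfolding h''_def True by simp
  qed (use h'[OF that] in \<open>simp add: h''_def\<close>)
  then show ?thesis
    unfolding smooth_curve_def by (intro exI[of _ h'']) (simp add: h''_def)
qed

lemma dop_cong:
  assumes "open S" "v \<in> S" "\<And>v. v \<in> S \<Longrightarrow> f v = g v"
  shows "dop c f v = dop c g v"
proof -
  have "\<forall>\<^sub>F v in nhds v. f v = g v"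
    using assms by (intro eventually_nhds_in_open[THEN eventually_mono]) auto
  then have "vector_derivative f (at v) = vector_derivative g (at v)"
    by (intro vector_derivative_cong_eq) (auto simp: assms)
  then show ?thesis unfolding dop_def using assms by simp
qed

lemma dop_commute:
  assumes "smooth_curve S g" "open S" "v \<in> S"
  shows "dop a (dop b g) v = dop b (dop a g) v"
proof -
  obtain h where h: "h 0 = g" "\<And>i v. v \<in> S \<Longrightarrow> (h i has_vector_derivative h (Suc i) v) (at v)"
    using assms unfolding smooth_curve_def by blast
  have 1: "dop c g w = h 1 w - c * h 0 w" if "w \<in> S" for c w
    using vector_derivative_at[OF h(2)[OF that, of 0]] unfolding dop_def h(1) by simp
  have "dop c (dop e g) v = (h 2 v - e * h 1 v) - c * (h 1 v - e * h 0 v)" for c e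
  proof -
    have "((\<lambda>w. h 1 w - e * h 0 w) has_vector_derivative h 2 v - e * h 1 v) (at v)"
      using h(2)[OF assms(3), of 1] h(2)[OF assms(3), of 0]
      by (intro has_vector_derivative_diff has_vector_derivative_mult_right) (auto simp: numeral_2_eq_2)
    from vector_derivative_at[OF this]
    have "dop c (\<lambda>w. h 1 w - e * h 0 w) v = (h 2 v - e * h 1 v) - c * (h 1 v - e * h 0 v)"
      unfolding dop_def by simp
    then show ?thesis
      using dop_cong[OF assms(2,3), of "dop e g" "\<lambda>w. h 1 w - e * h 0 w" c] 1 by simp
  qed
  note * = this
  show ?thesis unfolding * by (simp add: algebra_simps)
qed

text \<open>\<open>Dfrom\<close> unfolds at its outermost factor, the one of lowest index. Passing
  from \<open>n\<close> to \<open>n + 1\<close> adds a factor at the innermost place, which this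
  form exposes.\<close>

lemma Dfrom_Suc_inner: "Dfrom d k m (Suc n) g = Dfrom d k m n (dop (of_int (lam d k (m + n))) g)"
proof (induction n arbitrary: m)
  case (Suc n)
  have "Dfrom d k m (Suc (Suc n)) g = dop (of_int (lam d k m)) (Dfrom d k (Suc m) (Suc n) g)"
    by simp
  also have "\<dots> = dop (of_int (lam d k m)) (Dfrom d k (Suc m) n (dop (of_int (lam d k (Suc m + n))) g))"
    by (simp only: Suc.IH)
  finally show ?case by simp
qed simp

text \<open>Factors with constant coefficients commute on smooth functions. This carries the
  innermost factor outside, giving D^(n+1) = (D - lam_n) D^(n).\<close>

lemma Dfrom_dop_commute:
  assumes "smooth_curve S g" "open S" "v \<in> S"
  shows "Dfrom d k m n (dop c g) v = dop c (Dfrom d k m n g) v"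
  using assms
proof (induction n arbitrary: c g v)
  case (Suc n)
  have "Dfrom d k m (Suc n) (dop c g) v = Dfrom d k m n (dop (of_int (lam d k (m + n))) (dop c g)) v"
    by (simp only: Dfrom_Suc_inner)
  also have "\<dots> = dop (of_int (lam d k (m + n))) (Dfrom d k m n (dop c g)) v"
    by (intro Suc.IH smooth_curve_dop Suc.prems)
  also have "\<dots> = dop (of_int (lam d k (m + n))) (dop c (Dfrom d k m n g)) v"
    by (rule dop_cong[OF Suc.prems(2,3)]) (intro Suc.IH Suc.prems)
  also have "\<dots> = dop c (dop (of_int (lam d k (m + n))) (Dfrom d k m n g)) v"
  proof (rule dop_commute[OF _ Suc.prems(2,3)])
    have "smooth_curve S (Dfrom d k m n g)" for m
      by (induction n arbitrary: m) (auto intro: smooth_curve_dop Suc.prems)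
    then show "smooth_curve S (Dfrom d k m n g)" .
  qed
  also have "\<dots> = dop c (Dfrom d k m (Suc n) g) v"
  proof (rule dop_cong[OF Suc.prems(2,3)])
    fix w assume w: "w \<in> S"
    have "dop (of_int (lam d k (m + n))) (Dfrom d k m n g) w = Dfrom d k m n (dop (of_int (lam d k (m + n))) g) w"
      by (rule Suc.IH[symmetric]) (use Suc.prems w in auto)
    then show "dop (of_int (lam d k (m + n))) (Dfrom d k m n g) w = Dfrom d k m (Suc n) g w"
      by (simp only: Dfrom_Suc_inner)
  qed
  finally show ?case .
qed simp

text \<open>Smoothness of \<open>Q 0\<close> comes from the system itself, since every derivative of
  a \<open>Q n\<close> is again a combination of members of the family. Then
  \<open>Q (Suc n)\<close> is (D - lam_n) applied to \<open>Q n\<close>, and commutation settles the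
  order of the factors.\<close>

lemma Dn_eqI:
  assumes "open S"
    and Q: "\<And>n v. v \<in> S \<Longrightarrow> (Q n has_vector_derivative of_int (lam d k n) * Q n v + Q (Suc n) v) (at v)"
    and "v \<in> S"
  shows "Dn d k n (Q 0) v = Q n v"
proof -
  \<comment> \<open>\<open>h i n\<close> is the i-th derivative of \<open>Q n\<close>.\<close>
  define h :: "nat \<Rightarrow> nat \<Rightarrow> real \<Rightarrow> complex" where
    "h = rec_nat Q (\<lambda>_ h n v. of_int (lam d k n) * h n v + h (Suc n) v)"
  have h0: "h 0 = Q" and hS: "h (Suc i) = (\<lambda>n v. of_int (lam d k n) * h i n v + h i (Suc n) v)" for i
    unfolding h_def by simp_all
  have "(h i n has_vector_derivative h (Suc i) n v) (at v)" if "v \<in> S" for i n v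
  proof (induction i arbitrary: n)
    case 0
    then show ?case using Q[OF that] by (simp add: h0 hS)
  next
    case (Suc i)
    show ?case
      unfolding hS[of "Suc i"]
      by (subst hS) (intro has_vector_derivative_add has_vector_derivative_mult_right Suc)
  qed
  then have smooth: "smooth_curve S (Q 0)"
    unfolding smooth_curve_def by (intro exI[of _ "\<lambda>i. h i 0"]) (simp add: h0)
  show ?thesis
    using assms(3)
  proof (induction n arbitrary: v)
    case (Suc n)
    have "Dn d k (Suc n) (Q 0) v = dop (of_int (lam d k n)) (Dn d k n (Q 0)) v"
      unfolding Dn_def Dfrom_Suc_inner add_0
      by (rule Dfrom_dop_commute[OF smooth assms(1) Suc.prems])
    also have "\<dots> = dop (of_int (lam d k n)) (Q n) v"
      by (rule dop_cong[OF assms(1) Suc.prems Suc.IH])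
    also have "\<dots> = Q (Suc n) v"
      unfolding dop_def using vector_derivative_at[OF Q[OF Suc.prems, of n]] by simp
    finally show ?case .
  qed (simp add: Dn_def)
qed

section \<open>Iterated operators along a radial system and their growth\<close>

definition radial_Dn :: "nat \<Rightarrow> (nat \<Rightarrow> real \<Rightarrow> complex) \<Rightarrow> (nat \<Rightarrow> real \<Rightarrow> complex) \<Rightarrow> nat \<Rightarrow> real \<Rightarrow> complex" where
  "radial_Dn k F E n v = of_real (exp (real (2 * (n div 2)) * v)) *
     (if even n then F (n div 2) v else E (n div 2) v - of_nat k * F (n div 2) v)"

lemma has_vector_derivative_exp_mult:
  assumes "(g has_vector_derivative g') (at v)"
  shows "((\<lambda>v. of_real (exp (c * v)) * g v :: complex) has_vector_derivative
     of_real (exp (c * v)) * (of_real c * g v + g')) (at v)"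
proof -
  have "((\<lambda>v. exp (c * v)) has_field_derivative exp (c * v) * c) (at v)"
    by (auto intro!: derivative_eq_intros)
  from has_vector_derivative_scaleR[OF this assms]
  show ?thesis by (simp add: scaleR_conv_of_real algebra_simps)
qed

text \<open>\<open>radial_Dn\<close> is D^(n) of \<open>F 0\<close> in closed form, with
  \<open>E p\<close> the derivative of \<open>F p\<close>. The weight e^(2pv) turns D - lam_(2p)
  into D - k and D - lam_(2p+1) into D + k + d - 2, and the second hypothesis is (D + k + d - 2)(D -
  k) F_p = e^(2v) F_(p+1) written out.\<close>

lemma has_vector_derivative_radial_Dn:
  assumes "d \<ge> 2"
    and F: "\<And>p. (F p has_vector_derivative E p v) (at v)"
    and E: "\<And>p. (E p has_vector_derivative
      - of_nat (d - 2) * E p v + of_nat (k * (k + d - 2)) * F p v + of_real (exp (2 * v)) * F (Suc p) v) (at v)"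
  shows "(radial_Dn k F E n has_vector_derivative
      of_int (lam d k n) * radial_Dn k F E n v + radial_Dn k F E (Suc n) v) (at v)"
proof (cases "even n")
  case True
  then obtain p where n: "n = 2 * p" by (elim evenE)
  have eq: "radial_Dn k F E n = (\<lambda>v. of_real (exp (real (2 * p) * v)) * F p v)"
    unfolding radial_Dn_def n by auto
  show ?thesis
    unfolding eq
    by (rule has_vector_derivative_eq_rhs[OF has_vector_derivative_exp_mult[OF F]])
       (simp add: radial_Dn_def n lam_def algebra_simps)
next
  case False
  then obtain p where n: "n = 2 * p + 1" by (elim oddE)
  have eq: "radial_Dn k F E n = (\<lambda>v. of_real (exp (real (2 * p) * v)) * (E p v - of_nat k * F p v))"
    unfolding radial_Dn_def n by auto
  have e2: "exp (real (2 * Suc p) * v) = exp (real (2 * p) * v) * exp (2 * v)"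
    by (simp add: algebra_simps flip: exp_add)
  have S: "radial_Dn k F E (Suc n) v = of_real (exp (real (2 * Suc p) * v)) * F (Suc p) v"
    unfolding radial_Dn_def n by simp
  have l: "(of_int (lam d k n) :: complex) = - of_nat k - of_nat (d - 2) + 2 * of_nat p"
    unfolding lam_def n using assms(1) by (simp add: of_nat_diff)
  have kd: "(of_nat (k * (k + d - 2)) :: complex) = of_nat k * (of_nat k + of_nat (d - 2))"
    using assms(1) by (metis Nat.add_diff_assoc of_nat_add of_nat_mult)
  show ?thesis
    unfolding eq S l e2
    by (rule has_vector_derivative_eq_rhs[OF has_vector_derivative_exp_mult[OF
          has_vector_derivative_diff[OF E has_vector_derivative_mult_right[OF F]]]])
       (simp only: kd, simp add: algebra_simps)
qed

text \<open>Subtracting the linear part (t - s) z(s) from \<open>W\<close> leaves a function whose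
  derivative is controlled by \<open>A\<close> and \<open>B\<close>; its increment over the interval
  isolates \<open>\<delta>\<close> z(s). The interval is one-sided, so \<open>s\<close> may be a
  left end, at the price of room to the right.\<close>

lemma landau_type_bound:
  fixes W z q :: "real \<Rightarrow> complex"
  assumes "0 < \<delta>" "0 \<le> c"
    and W: "\<And>t. t \<in> {s..s+\<delta>} \<Longrightarrow> (W has_vector_derivative z t + of_real c * W t) (at t)"
    and z: "\<And>t. t \<in> {s..s+\<delta>} \<Longrightarrow> (z has_vector_derivative q t) (at t)"
    and A: "\<And>t. t \<in> {s..s+\<delta>} \<Longrightarrow> norm (W t) \<le> A"
    and B: "\<And>t. t \<in> {s..s+\<delta>} \<Longrightarrow> norm (q t) \<le> B"
  shows "norm (z s) \<le> (2 / \<delta> + c) * A + \<delta> * B"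
proof -
  have s: "s \<in> {s..s+\<delta>}" "s + \<delta> \<in> {s..s+\<delta>}" using assms(1) by auto
  have "0 \<le> A" "0 \<le> B" using A[OF s(1)] B[OF s(1)] norm_ge_zero order_trans by blast+
  have zdiff: "norm (z t - z s) \<le> \<delta> * B" if t: "t \<in> {s..s+\<delta>}" for t
  proof -
    have "norm (z t - z s) \<le> B * norm (t - s)"
    proof (rule differentiable_bound[of "{s..s+\<delta>}" z "\<lambda>t h. h *\<^sub>R q t"])
      fix t assume t: "t \<in> {s..s+\<delta>}"
      show "(z has_derivative (\<lambda>h. h *\<^sub>R q t)) (at t within {s..s+\<delta>})"
        using z[OF t] unfolding has_vector_derivative_def by (rule has_derivative_at_withinI)
      show "onorm (\<lambda>h. h *\<^sub>R q t) \<le> B"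
      proof (rule onorm_le)
        fix h :: real
        show "norm (h *\<^sub>R q t) \<le> B * norm h"
          unfolding norm_scaleR real_norm_def mult.commute[of "\<bar>h\<bar>"] by (rule mult_right_mono[OF B[OF t]]) simp
      qed
    qed (use t s in auto)
    also have "\<dots> \<le> B * \<delta>" using t \<open>0 \<le> B\<close> by (intro mult_left_mono) auto
    finally show ?thesis by (simp add: mult.commute)
  qed
  define m where "m = (\<lambda>t. W t - (t - s) *\<^sub>R z s)"
  have dm: "(m has_vector_derivative z t - z s + of_real c * W t) (at t)" if "t \<in> {s..s+\<delta>}" for t
    unfolding m_def
    by (rule derivative_eq_intros W[OF that] refl | simp)+
  have "norm (m (s + \<delta>) - m s) \<le> (\<delta> * B + c * A) * norm (s + \<delta> - s)"
  proof (rule differentiable_bound[of "{s..s+\<delta>}" m "\<lambda>t h. h *\<^sub>R (z t - z s + of_real c * W t)"])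
    fix t assume t: "t \<in> {s..s+\<delta>}"
    show "(m has_derivative (\<lambda>h. h *\<^sub>R (z t - z s + of_real c * W t))) (at t within {s..s+\<delta>})"
      using dm[OF t] unfolding has_vector_derivative_def by (rule has_derivative_at_withinI)
    have "norm (z t - z s + of_real c * W t) \<le> norm (z t - z s) + c * norm (W t)"
      using assms(2) by (intro order_trans[OF norm_triangle_ineq]) (simp add: norm_mult)
    also have "\<dots> \<le> \<delta> * B + c * A"
      using zdiff[OF t] A[OF t] assms(2) by (intro add_mono mult_left_mono) auto
    finally have le: "norm (z t - z s + of_real c * W t) \<le> \<delta> * B + c * A" .
    show "onorm (\<lambda>h. h *\<^sub>R (z t - z s + of_real c * W t)) \<le> \<delta> * B + c * A"
    proof (rule onorm_le)
      fix h :: real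
      show "norm (h *\<^sub>R (z t - z s + of_real c * W t)) \<le> (\<delta> * B + c * A) * norm h"
        unfolding norm_scaleR real_norm_def mult.commute[of "\<bar>h\<bar>"] by (rule mult_right_mono[OF le]) simp
    qed
  qed (use s in auto)
  then have m1: "norm (m (s + \<delta>) - m s) \<le> (\<delta> * B + c * A) * \<delta>"
    using assms(1) by simp
  have "\<delta> *\<^sub>R z s = W (s + \<delta>) - W s - (m (s + \<delta>) - m s)"
    unfolding m_def by simp
  then have "\<delta> * norm (z s) = norm (W (s + \<delta>) - W s - (m (s + \<delta>) - m s))"
    using assms(1) by (metis abs_of_pos norm_scaleR)
  also have "\<dots> \<le> A + A + (\<delta> * B + c * A) * \<delta>"
    by (intro order_trans[OF norm_triangle_ineq4] add_mono A s m1)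
  also have "\<dots> = \<delta> * ((2 / \<delta> + c) * A + \<delta> * B)"
    using assms(1) by (simp add: field_simps)
  finally show ?thesis using assms(1) by simp
qed

text \<open>The weight e^(m t) with m = k + d - 2 absorbs the factor D + m: the derivative of z =
  e^(m t) (E - k F) is just e^(m t) e^(2t) G, and W = e^(m t) F satisfies W' = z + (m + k) W. So the
  two neighbouring even orders control the odd one.\<close>

lemma radial_Dn_odd_bound:
  fixes m :: real and F E G :: "real \<Rightarrow> complex"
  assumes "0 < \<delta>" "d \<ge> 2" "a \<le> s" "s \<le> b" "0 \<le> U" "0 \<le> V"
    and F: "\<And>t. t \<in> {s..s+\<delta>} \<Longrightarrow> (F has_vector_derivative E t) (at t)"
    and E: "\<And>t. t \<in> {s..s+\<delta>} \<Longrightarrow> (E has_vector_derivative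
      - of_nat (d - 2) * E t + of_nat (k * (k + d - 2)) * F t + of_real (exp (2 * t)) * G t) (at t)"
    and U: "\<And>t. t \<in> {s..s+\<delta>} \<Longrightarrow> norm (F t) \<le> U"
    and V: "\<And>t. t \<in> {s..s+\<delta>} \<Longrightarrow> norm (G t) \<le> V"
  defines "m \<equiv> real (k + d - 2)"
  shows "norm (E s - of_nat k * F s) \<le> exp (- (m * a)) *
      ((2 / \<delta> + (m + real k)) * (exp (m * (b + \<delta>)) * U) + \<delta> * (exp ((m + 2) * (b + \<delta>)) * V))"
proof -
  have m: "m \<ge> 0" unfolding m_def by simp
  have kd: "(of_nat (k * (k + d - 2)) :: complex) = of_nat k * of_real m"
    "(of_nat (d - 2) :: complex) = of_real m - of_nat k"
    using assms(2) unfolding m_def by (auto simp: of_nat_diff)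
  define W where "W = (\<lambda>t. of_real (exp (m * t)) * F t)"
  define z where "z = (\<lambda>t. of_real (exp (m * t)) * (E t - of_nat k * F t))"
  define q where "q = (\<lambda>t. of_real (exp (m * t)) * (of_real (exp (2 * t)) * G t))"
  have "norm (z s) \<le> (2 / \<delta> + (m + real k)) * (exp (m * (b + \<delta>)) * U) + \<delta> * (exp ((m + 2) * (b + \<delta>)) * V)"
  proof (rule landau_type_bound[where W = W and q = q and z = z])
    fix t assume t: "t \<in> {s..s+\<delta>}"
    show "(W has_vector_derivative z t + of_real (m + real k) * W t) (at t)"
      unfolding W_def
      by (rule has_vector_derivative_eq_rhs[OF has_vector_derivative_exp_mult[OF F[OF t]]])
         (simp add: z_def algebra_simps)
    show "(z has_vector_derivative q t) (at t)"
      unfolding z_def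
      by (rule has_vector_derivative_eq_rhs[OF has_vector_derivative_exp_mult[OF
          has_vector_derivative_diff[OF E[OF t] has_vector_derivative_mult_right[OF F[OF t]]]]])
         (simp only: kd q_def, simp add: algebra_simps)
    have le: "exp (m * t) \<le> exp (m * (b + \<delta>))" "exp (2 * t) \<le> exp (2 * (b + \<delta>))"
      using t assms m by (auto intro!: mult_left_mono)
    show "norm (W t) \<le> exp (m * (b + \<delta>)) * U"
      unfolding W_def using le U[OF t] by (auto simp: norm_mult intro!: mult_mono)
    have "norm (q t) \<le> exp (m * (b + \<delta>)) * (exp (2 * (b + \<delta>)) * V)"
      unfolding q_def using le V[OF t] by (auto simp: norm_mult intro!: mult_mono)
    also have "\<dots> = exp ((m + 2) * (b + \<delta>)) * V"
      by (simp add: distrib_right exp_add)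
    finally show "norm (q t) \<le> exp ((m + 2) * (b + \<delta>)) * V" .
  qed (use assms m in auto)
  moreover have "norm (E s - of_nat k * F s) = exp (- (m * s)) * norm (z s)"
    unfolding z_def by (simp add: norm_mult exp_minus)
  moreover have "exp (- (m * s)) \<le> exp (- (m * a))"
    using assms m by (simp add: mult_left_mono)
  ultimately show ?thesis
    by (auto intro!: mult_mono)
qed

text \<open>The margin \<open>\<delta>\<close> to the right of \<open>b\<close> is the room taken by
  the Landau-type estimate. It enters the constant but not the ratio e^b sigma, which decides the
  radius of convergence.\<close>

lemma radial_Dn_bound:
  assumes "d \<ge> 2" "0 < \<delta>" "0 < \<sigma>" "0 \<le> C"
    and F: "\<And>p t. t \<in> {a..b+\<delta>} \<Longrightarrow> (F p has_vector_derivative E p t) (at t)"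
    and E: "\<And>p t. t \<in> {a..b+\<delta>} \<Longrightarrow> (E p has_vector_derivative
      - of_nat (d - 2) * E p t + of_nat (k * (k + d - 2)) * F p t + of_real (exp (2 * t)) * F (Suc p) t) (at t)"
    and bound: "\<And>p t. t \<in> {a..b+\<delta>} \<Longrightarrow> norm (F p t) \<le> C * fact (2 * p) * \<sigma> ^ (2 * p)"
  shows "\<exists>C'\<ge>0. \<forall>n. \<forall>s\<in>{a..b}. norm (radial_Dn k F E n s) \<le> C' * fact (n + 1) * (exp b * \<sigma>) ^ n"
proof -
  define m where "m = real (k + d - 2)"
  define K1 where "K1 = exp (- (m * a)) * ((2 / \<delta> + (m + real k)) * exp (m * (b + \<delta>)))"
  define K2 where "K2 = exp (- (m * a)) * (\<delta> * exp ((m + 2) * (b + \<delta>)))"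
  define u where "u = (\<lambda>p. C * fact (2 * p) * \<sigma> ^ (2 * p))"
  have K: "0 \<le> K1" "0 \<le> K2" using assms(2) unfolding K1_def K2_def m_def by auto
  have u: "0 \<le> u p" for p using assms unfolding u_def by auto
  have odd: "norm (E p s - of_nat k * F p s) \<le> K1 * u p + K2 * u (Suc p)" if s: "s \<in> {a..b}" for p s
  proof -
    have sub: "t \<in> {a..b+\<delta>}" if "t \<in> {s..s+\<delta>}" for t using that s by auto
    have "norm (E p s - of_nat k * F p s) \<le> exp (- (m * a)) *
      ((2 / \<delta> + (m + real k)) * (exp (m * (b + \<delta>)) * u p) + \<delta> * (exp ((m + 2) * (b + \<delta>)) * u (Suc p)))"
      unfolding m_def
    proof (rule radial_Dn_odd_bound[where G = "F (Suc p)" and F = "F p" and E = "E p"])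
      fix t assume t: "t \<in> {s..s+\<delta>}"
      show "(F p has_vector_derivative E p t) (at t)" by (rule F[OF sub[OF t]])
      show "(E p has_vector_derivative - of_nat (d - 2) * E p t + of_nat (k * (k + d - 2)) * F p t
          + of_real (exp (2 * t)) * F (Suc p) t) (at t)" by (rule E[OF sub[OF t]])
      show "norm (F p t) \<le> u p" "norm (F (Suc p) t) \<le> u (Suc p)"
        unfolding u_def by (rule bound[OF sub[OF t]])+
    qed (use s assms u in auto)
    also have "\<dots> = K1 * u p + K2 * u (Suc p)"
      unfolding K1_def K2_def by (simp only: distrib_left mult.assoc)
    finally show ?thesis .
  qed
  \<comment> \<open>Even n needs only \<open>C\<close>. For n = 2p + 1 the neighbours carry (2p)!
    and (2p+2)!, both at most (n+1)!; moreover sigma^(2p) + sigma^(2p+2) = (1/sigma + sigma)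
    sigma^n, and e^(-b) corrects e^(nb) to e^(2pb).\<close>
  define C' where "C' = C + C * (K1 + K2) * (1 / \<sigma> + \<sigma>) * exp (- b)"
  have C': "C \<le> C'" "C * (K1 + K2) * (1 / \<sigma> + \<sigma>) * exp (- b) \<le> C'"
    unfolding C'_def using assms(3,4) K by (auto intro!: mult_nonneg_nonneg add_nonneg_nonneg)
  have "norm (radial_Dn k F E n s) \<le> C' * fact (n + 1) * (exp b * \<sigma>) ^ n" if s: "s \<in> {a..b}" for n s
  proof (cases "even n")
    case True
    then obtain p where n: "n = 2 * p" by (elim evenE)
    have "norm (radial_Dn k F E n s) = exp (real (2 * p) * s) * norm (F p s)"
      unfolding radial_Dn_def n by (simp add: norm_mult)
    also have "\<dots> \<le> exp (real (2 * p) * b) * (C' * fact (n + 1) * \<sigma> ^ n)"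
    proof (rule mult_mono)
      have "norm (F p s) \<le> C * fact n * \<sigma> ^ n"
        using bound[of s p] s assms(2) unfolding n by auto
      also have "\<dots> \<le> C' * fact (n + 1) * \<sigma> ^ n"
        using C' assms by (intro mult_right_mono mult_mono fact_mono) auto
      finally show "norm (F p s) \<le> C' * fact (n + 1) * \<sigma> ^ n" .
    qed (use s in \<open>auto intro: mult_left_mono\<close>)
    also have "exp (real (2 * p) * b) = exp b ^ n"
      unfolding n by (rule exp_of_nat_mult)
    also have "exp b ^ n * (C' * fact (n + 1) * \<sigma> ^ n) = C' * fact (n + 1) * (exp b * \<sigma>) ^ n"
      by (simp only: power_mult_distrib mult_ac)
    finally show ?thesis .
  next
    case False
    then obtain p where n: "n = 2 * p + 1" by (elim oddE)
    have "norm (radial_Dn k F E n s) = exp (real (2 * p) * s) * norm (E p s - of_nat k * F p s)"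
      unfolding radial_Dn_def n by (simp add: norm_mult)
    also have "\<dots> \<le> exp (real (2 * p) * b) * (C * (K1 + K2) * (1 / \<sigma> + \<sigma>) * fact (n + 1) * \<sigma> ^ n)"
    proof (rule mult_mono)
      have u1: "u p \<le> C * (fact (n + 1) * (\<sigma> ^ (2 * p) + \<sigma> ^ (2 * p + 2)))"
        unfolding u_def mult.assoc using assms n by (intro mult_left_mono mult_mono fact_mono) auto
      have u2: "u (Suc p) \<le> C * (fact (n + 1) * (\<sigma> ^ (2 * p) + \<sigma> ^ (2 * p + 2)))"
        unfolding u_def mult.assoc using assms n by (intro mult_left_mono mult_mono fact_mono) auto
      have "norm (E p s - of_nat k * F p s) \<le> K1 * u p + K2 * u (Suc p)"
        by (rule odd[OF s])
      also have "\<dots> \<le> K1 * (C * (fact (n + 1) * (\<sigma> ^ (2 * p) + \<sigma> ^ (2 * p + 2))))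
          + K2 * (C * (fact (n + 1) * (\<sigma> ^ (2 * p) + \<sigma> ^ (2 * p + 2))))"
        by (intro add_mono mult_left_mono u1 u2 K)
      also have "\<dots> = C * (K1 + K2) * (\<sigma> ^ (2 * p) + \<sigma> ^ (2 * p + 2)) * fact (n + 1)"
        by (simp only: distrib_left distrib_right mult_ac)
      also have "\<sigma> ^ (2 * p) + \<sigma> ^ (2 * p + 2) = (1 / \<sigma> + \<sigma>) * \<sigma> ^ n"
        unfolding n using assms(3) by (simp add: distrib_right)
      finally show "norm (E p s - of_nat k * F p s) \<le> C * (K1 + K2) * (1 / \<sigma> + \<sigma>) * fact (n + 1) * \<sigma> ^ n"
        by (simp only: mult_ac)
    qed (use s in \<open>auto intro: mult_left_mono\<close>)
    also have "exp (real (2 * p) * b) = exp b ^ n * exp (- b)"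
      unfolding n by (simp add: exp_of_nat_mult[symmetric] algebra_simps flip: exp_add)
    also have "exp b ^ n * exp (- b) * (C * (K1 + K2) * (1 / \<sigma> + \<sigma>) * fact (n + 1) * \<sigma> ^ n)
       = C * (K1 + K2) * (1 / \<sigma> + \<sigma>) * exp (- b) * (fact (n + 1) * (exp b * \<sigma>) ^ n)"
      by (simp only: power_mult_distrib mult_ac)
    also have "\<dots> \<le> C' * (fact (n + 1) * (exp b * \<sigma>) ^ n)"
      using C'(2) assms(3) by (intro mult_right_mono) auto
    finally show ?thesis by (simp only: mult.assoc)
  qed
  moreover have "0 \<le> C'" using C'(1) assms(4) by linarith
  ultimately show ?thesis by blast
qed

section \<open>Functions with continuous partial derivatives\<close>

text \<open>A function together with a named gradient, so that product and chain rules act on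
  families of partial derivatives instead of on \<open>pdiff\<close> of compound
  expressions.\<close>

definition C1_on :: "'a::euclidean_space set \<Rightarrow> ('a \<Rightarrow> complex) \<Rightarrow> ('a \<Rightarrow> 'a \<Rightarrow> complex) \<Rightarrow> bool" where
  "C1_on G u U \<longleftrightarrow> (\<forall>i\<in>Basis. continuous_on G (U i)) \<and>
     (\<forall>x\<in>G. (u has_derivative (\<lambda>h. \<Sum>i\<in>Basis. (h \<bullet> i) *\<^sub>R U i x)) (at x))"

lemma C1_onD:
  assumes "C1_on G u U"
  shows "i \<in> Basis \<Longrightarrow> continuous_on G (U i)"
    and "x \<in> G \<Longrightarrow> (u has_derivative (\<lambda>h. \<Sum>i\<in>Basis. (h \<bullet> i) *\<^sub>R U i x)) (at x)"
  using assms unfolding C1_on_def by auto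

lemma C1_on_continuous:
  assumes "C1_on G u U" shows "continuous_on G u"
  using C1_onD(2)[OF assms] by (intro continuous_at_imp_continuous_on ballI has_derivative_continuous)

lemma C1_on_cong:
  assumes "C1_on G u U" "open G" "\<And>x. x \<in> G \<Longrightarrow> u' x = u x"
    and "\<And>i x. i \<in> Basis \<Longrightarrow> x \<in> G \<Longrightarrow> U' i x = U i x"
  shows "C1_on G u' U'"
  unfolding C1_on_def
proof (intro conjI ballI)
  show "continuous_on G (U' i)" if "i \<in> Basis" for i
    using C1_onD(1)[OF assms(1) that] assms(4)[OF that] by (simp cong: continuous_on_cong)
  fix x assume x: "x \<in> G"
  have "(u' has_derivative (\<lambda>h. \<Sum>i\<in>Basis. (h \<bullet> i) *\<^sub>R U i x)) (at x)"
    by (rule has_derivative_transform_within_open[OF C1_onD(2)[OF assms(1) x] assms(2) x])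
       (simp add: assms(3))
  also have "(\<lambda>h. \<Sum>i\<in>Basis. (h \<bullet> i) *\<^sub>R U i x) = (\<lambda>h. \<Sum>i\<in>Basis. (h \<bullet> i) *\<^sub>R U' i x)"
    using assms(4) x by (intro ext sum.cong) auto
  finally show "(u' has_derivative (\<lambda>h. \<Sum>i\<in>Basis. (h \<bullet> i) *\<^sub>R U' i x)) (at x)" .
qed

lemma C1_on_subset: "C1_on G u U \<Longrightarrow> H \<subseteq> G \<Longrightarrow> C1_on H u U"
  unfolding C1_on_def by (auto intro: continuous_on_subset)

lemma C1_on_const: "C1_on G (\<lambda>x. c) (\<lambda>i x. 0)"
  unfolding C1_on_def by (auto intro!: derivative_eq_intros)

lemma C1_on_coord: "C1_on G (\<lambda>x. of_real (x \<bullet> b)) (\<lambda>i x. of_real (b \<bullet> i))"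
proof -
  have "(\<lambda>h. of_real (h \<bullet> b)) = (\<lambda>h::'a. \<Sum>i\<in>Basis. (h \<bullet> i) *\<^sub>R complex_of_real (b \<bullet> i))"
    by (rule ext) (subst euclidean_inner, simp add: scaleR_conv_of_real)
  moreover have "((\<lambda>x. complex_of_real (x \<bullet> b)) has_derivative (\<lambda>h. of_real (h \<bullet> b))) (at x)" for x
    by (intro derivative_intros)
  ultimately show ?thesis
    unfolding C1_on_def by (auto intro!: continuous_intros)
qed

lemma C1_on_add:
  assumes "C1_on G u U" "C1_on G w W"
  shows "C1_on G (\<lambda>x. u x + w x) (\<lambda>i x. U i x + W i x)"
  unfolding C1_on_def
proof (intro conjI ballI)
  fix x assume "x \<in> G"
  from has_derivative_add[OF C1_onD(2)[OF assms(1) this] C1_onD(2)[OF assms(2) this]]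
  show "((\<lambda>x. u x + w x) has_derivative (\<lambda>h. \<Sum>i\<in>Basis. (h \<bullet> i) *\<^sub>R (U i x + W i x))) (at x)"
    by (simp add: scaleR_add_right sum.distrib)
next
  show "continuous_on G (\<lambda>x. U i x + W i x)" if "i \<in> Basis" for i
    using C1_onD(1)[OF assms(1) that] C1_onD(1)[OF assms(2) that] by (intro continuous_intros)
qed

lemma C1_on_mult:
  assumes "C1_on G u U" "C1_on G w W"
  shows "C1_on G (\<lambda>x. u x * w x) (\<lambda>i x. U i x * w x + u x * W i x)"
  unfolding C1_on_def
proof (intro conjI ballI)
  fix x assume "x \<in> G"
  from has_derivative_mult[OF C1_onD(2)[OF assms(1) this] C1_onD(2)[OF assms(2) this]]
  show "((\<lambda>x. u x * w x) has_derivative (\<lambda>h. \<Sum>i\<in>Basis. (h \<bullet> i) *\<^sub>R (U i x * w x + u x * W i x))) (at x)"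
    by (rule has_derivative_eq_rhs)
       (simp add: scaleR_add_right sum.distrib sum_distrib_left sum_distrib_right fun_eq_iff)
next
  show "continuous_on G (\<lambda>x. U i x * w x + u x * W i x)" if "i \<in> Basis" for i
    using C1_onD(1)[OF assms(1) that] C1_onD(1)[OF assms(2) that] C1_on_continuous[OF assms(1)] C1_on_continuous[OF assms(2)]
    by (intro continuous_intros)
qed

lemma C1_on_cmult:
  assumes "C1_on G u U"
  shows "C1_on G (\<lambda>x. c * u x) (\<lambda>i x. c * U i x)"
  using C1_on_mult[OF C1_on_const assms, of c] by simp

lemma C1_on_diff:
  assumes "C1_on G u U" "C1_on G w W"
  shows "C1_on G (\<lambda>x. u x - w x) (\<lambda>i x. U i x - W i x)"
  using C1_on_add[OF assms(1) C1_on_cmult[OF assms(2), of "-1"]] by simp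

lemma C1_on_sum:
  assumes "\<And>a. a \<in> A \<Longrightarrow> C1_on G (u a) (U a)"
  shows "C1_on G (\<lambda>x. \<Sum>a\<in>A. u a x) (\<lambda>i x. \<Sum>a\<in>A. U a i x)"
  using assms
proof (induction A rule: infinite_finite_induct)
  case (insert a A)
  then show ?case
    using C1_on_add[of G "u a" "U a" "\<lambda>x. \<Sum>a\<in>A. u a x" "\<lambda>i x. \<Sum>a\<in>A. U a i x"] by simp
qed (simp_all add: C1_on_const)

lemma C1_on_cnj:
  assumes "C1_on G u U"
  shows "C1_on G (\<lambda>x. cnj (u x)) (\<lambda>i x. cnj (U i x))"
  unfolding C1_on_def
proof (intro conjI ballI)
  fix x assume "x \<in> G"
  from has_derivative_cnj[OF C1_onD(2)[OF assms this]]
  show "((\<lambda>x. cnj (u x)) has_derivative (\<lambda>h. \<Sum>i\<in>Basis. (h \<bullet> i) *\<^sub>R cnj (U i x))) (at x)"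
    by (rule has_derivative_eq_rhs) (simp add: fun_eq_iff scaleR_conv_of_real)
next
  show "continuous_on G (\<lambda>x. cnj (U i x))" if "i \<in> Basis" for i
    using C1_onD(1)[OF assms that] by (intro continuous_intros)
qed

lemma C1_on_scaleR_coord:
  assumes "C1_on G u U" "b \<in> Basis"
  shows "C1_on G (\<lambda>x. (x \<bullet> b) *\<^sub>R u x) (\<lambda>i x. (if i = b then u x else 0) + (x \<bullet> b) *\<^sub>R U i x)"
proof -
  have "C1_on G (\<lambda>x. of_real (x \<bullet> b) * u x) (\<lambda>i x. of_real (b \<bullet> i) * u x + of_real (x \<bullet> b) * U i x)"
    by (rule C1_on_mult[OF C1_on_coord assms(1)])
  moreover have "of_real (b \<bullet> i) * u x = (if i = b then u x else 0)" if "i \<in> Basis" for i x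
    using assms(2) that by (auto simp: inner_Basis)
  ultimately show ?thesis
    unfolding C1_on_def by (simp add: scaleR_conv_of_real)
qed

lemma C1_on_partial:
  assumes "C1_on G u U" "x \<in> G" "i \<in> Basis"
  shows "((\<lambda>t. u (x + t *\<^sub>R i)) has_vector_derivative U i x) (at 0)"
proof -
  have "((\<lambda>t::real. x + t *\<^sub>R i) has_derivative (\<lambda>t. t *\<^sub>R i)) (at 0)"
    by (auto intro!: derivative_eq_intros)
  moreover have "(u has_derivative (\<lambda>h. \<Sum>i\<in>Basis. (h \<bullet> i) *\<^sub>R U i x)) (at (x + 0 *\<^sub>R i))"
    using C1_onD(2)[OF assms(1,2)] by simp
  ultimately have "((\<lambda>t. u (x + t *\<^sub>R i)) has_derivative (\<lambda>t. \<Sum>j\<in>Basis. ((t *\<^sub>R i) \<bullet> j) *\<^sub>R U j x)) (at 0)"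
    by (rule has_derivative_compose)
  moreover have "(\<Sum>j\<in>Basis. ((t *\<^sub>R i) \<bullet> j) *\<^sub>R U j x) = t *\<^sub>R U i x" for t
  proof -
    have "(\<Sum>j\<in>Basis. ((t *\<^sub>R i) \<bullet> j) *\<^sub>R U j x) = (\<Sum>j\<in>Basis. if j = i then t *\<^sub>R U j x else 0)"
      using assms(3) by (intro sum.cong) (auto simp: inner_Basis)
    then show ?thesis using assms(3) by simp
  qed
  ultimately show ?thesis
    unfolding has_vector_derivative_def by simp
qed

lemma C1_on_pdiff:
  assumes "C1_on G u U" "x \<in> G" "i \<in> Basis"
  shows "pdiff i u x = U i x" and "pdiff_exists i u x"
  using C1_on_partial[OF assms] unfolding pdiff_def pdiff_exists_def
  by (auto simp: vector_derivative_at differentiableI_vector)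

lemma has_vector_derivative_line:
  fixes p j :: "'a::real_vector" and u :: "'a \<Rightarrow> 'b::real_normed_vector"
  assumes "((\<lambda>s::real. u ((p + t *\<^sub>R j) + s *\<^sub>R j)) has_vector_derivative D) (at 0)"
  shows "((\<lambda>t. u (p + t *\<^sub>R j)) has_vector_derivative D) (at t)"
proof -
  have "((\<lambda>r. r - t) has_vector_derivative 1) (at t)"
    by (auto intro!: derivative_eq_intros)
  from vector_diff_chain_at[OF this, of "\<lambda>s. u ((p + t *\<^sub>R j) + s *\<^sub>R j)" D] assms
  have "((\<lambda>r. u ((p + t *\<^sub>R j) + (r - t) *\<^sub>R j)) has_vector_derivative D) (at t)"
    by (simp add: o_def)
  moreover have "(p + t *\<^sub>R j) + (r - t) *\<^sub>R j = p + r *\<^sub>R j" for r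
    by (simp add: scaleR_left_diff_distrib)
  ultimately show ?thesis by (simp only:)
qed

text \<open>The classical passage from continuous partial derivatives, which is all that
  \<open>smooth_on\<close> speaks of, to total differentiability: the increment is split into moves
  along the coordinate axes, each estimated by the mean value inequality.\<close>

lemma C1_onI_partials:
  fixes u :: "'a::euclidean_space \<Rightarrow> complex"
  assumes "open G"
    and partial: "\<And>i x. i \<in> Basis \<Longrightarrow> x \<in> G \<Longrightarrow> ((\<lambda>t. u (x + t *\<^sub>R i)) has_vector_derivative U i x) (at 0)"
    and cont: "\<And>i. i \<in> Basis \<Longrightarrow> continuous_on G (U i)"
  shows "C1_on G u U"
  unfolding C1_on_def
proof (intro conjI ballI cont)
  fix x assume x: "x \<in> G"
  show "(u has_derivative (\<lambda>h. \<Sum>i\<in>Basis. (h \<bullet> i) *\<^sub>R U i x)) (at x)"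
    unfolding has_derivative_at_alt
  proof (intro conjI allI impI)
    show "bounded_linear (\<lambda>h. \<Sum>i\<in>Basis. (h \<bullet> i) *\<^sub>R U i x)"
      by (intro bounded_linear_intros)
    fix e :: real assume e: "e > 0"
    define n where "n = real DIM('a)"
    have n: "n > 0" unfolding n_def by simp
    have "\<forall>i\<in>Basis. \<forall>\<^sub>F y in nhds x. dist (U i y) (U i x) < e / n"
    proof
      fix i :: 'a assume "i \<in> Basis"
      then have "isCont (U i) x"
        using cont assms(1) x by (simp add: continuous_on_eq_continuous_at)
      then have "(U i \<longlongrightarrow> U i x) (nhds x)"
        by (simp add: continuous_at tendsto_at_iff_tendsto_nhds)
      then show "\<forall>\<^sub>F y in nhds x. dist (U i y) (U i x) < e / n"
        using e n by (intro tendstoD) auto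
    qed
    then have "\<forall>\<^sub>F y in nhds x. (\<forall>i\<in>Basis. dist (U i y) (U i x) < e / n) \<and> y \<in> G"
      using assms(1) x by (intro eventually_conj eventually_ball_finite eventually_nhds_in_open) auto
    then obtain \<delta> where \<delta>: "\<delta> > 0"
      "\<And>y. dist y x < \<delta> \<Longrightarrow> (\<forall>i\<in>Basis. dist (U i y) (U i x) < e / n) \<and> y \<in> G"
      unfolding eventually_nhds_metric by blast
    show "\<exists>d>0. \<forall>y. norm (y - x) < d \<longrightarrow>
        norm (u y - u x - (\<Sum>i\<in>Basis. ((y - x) \<bullet> i) *\<^sub>R U i x)) \<le> e * norm (y - x)"
    proof (intro exI[of _ "\<delta> / n"] conjI allI impI)
      show "\<delta> / n > 0" using \<delta> n by simp
      fix y assume y: "norm (y - x) < \<delta> / n"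
      define h where "h = y - x"
      \<comment> \<open>\<open>s S\<close> is the displacement along the axes in \<open>S\<close>
        and \<open>a S\<close> its l1 length. The latter is at most \<open>n\<close> times the
        Euclidean norm, hence the radius \<open>\<delta> / n\<close>: all intermediate points stay
        within \<open>\<delta>\<close> of \<open>x\<close>.\<close>
      define s where "s = (\<lambda>S. \<Sum>i\<in>S. (h \<bullet> i) *\<^sub>R i)"
      define a where "a = (\<lambda>S. \<Sum>i\<in>S. \<bar>h \<bullet> i\<bar>)"
      have a: "a S \<le> n * norm h" if "S \<subseteq> Basis" for S
      proof -
        have "a S \<le> a Basis" unfolding a_def by (rule sum_mono2) (use that in auto)
        also have "\<dots> \<le> n * norm h" unfolding a_def n_def
          by (rule sum_bounded_above) (auto simp: Basis_le_norm)
        finally show ?thesis .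
      qed
      have nh: "n * norm h < \<delta>" using y n unfolding h_def by (simp add: field_simps)
      have ns: "norm (s S) \<le> a S" if "S \<subseteq> Basis" for S
        unfolding s_def a_def using that by (intro sum_norm_le) (auto simp: subset_iff)
      have "norm (u (x + s S) - u x - (\<Sum>i\<in>S. (h \<bullet> i) *\<^sub>R U i x)) \<le> e / n * a S"
        if "finite S" "S \<subseteq> Basis" for S
        using that
      proof (induction S)
        case empty
        then show ?case by (simp add: s_def a_def)
      next
        case (insert j S)
        then have j: "j \<in> Basis" and S: "S \<subseteq> Basis" by auto
        have sj: "s (insert j S) = s S + (h \<bullet> j) *\<^sub>R j" and aj: "a (insert j S) = a S + \<bar>h \<bullet> j\<bar>"
          using insert unfolding s_def a_def by (auto simp: add.commute)
        define \<phi> where "\<phi> = (\<lambda>t. u ((x + s S) + t *\<^sub>R j) - t *\<^sub>R U j x)"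
        have near: "dist ((x + s S) + t *\<^sub>R j) x < \<delta>" if "t \<in> closed_segment 0 (h \<bullet> j)" for t
        proof -
          have "dist ((x + s S) + t *\<^sub>R j) x = norm (s S + t *\<^sub>R j)"
            by (simp add: dist_norm algebra_simps)
          also have "\<dots> \<le> norm (s S) + \<bar>t\<bar>"
            using j by (intro order_trans[OF norm_triangle_ineq]) simp
          also have "\<dots> \<le> a S + \<bar>h \<bullet> j\<bar>"
            using ns[OF S] that by (intro add_mono) (auto simp: closed_segment_eq_real_ivl split: if_splits)
          also have "\<dots> < \<delta>" using a[OF insert.prems] aj nh by simp
          finally show ?thesis .
        qed
        have "norm (\<phi> (h \<bullet> j) - \<phi> 0) \<le> e / n * norm (h \<bullet> j - 0)"
        proof (rule differentiable_bound[of "closed_segment 0 (h \<bullet> j)" \<phi>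
              "\<lambda>t k. k *\<^sub>R (U j ((x + s S) + t *\<^sub>R j) - U j x)"])
          fix t assume t: "t \<in> closed_segment 0 (h \<bullet> j)"
          have tG: "(x + s S) + t *\<^sub>R j \<in> G" and tU: "dist (U j ((x + s S) + t *\<^sub>R j)) (U j x) < e / n"
            using \<delta>(2)[OF near[OF t]] j by auto
          have "((\<lambda>t. u ((x + s S) + t *\<^sub>R j)) has_vector_derivative U j ((x + s S) + t *\<^sub>R j)) (at t)"
            by (rule has_vector_derivative_line[OF partial[OF j tG]])
          then have "(\<phi> has_vector_derivative U j ((x + s S) + t *\<^sub>R j) - U j x) (at t)"
            unfolding \<phi>_def by (auto intro!: derivative_eq_intros)
          then show "(\<phi> has_derivative (\<lambda>k. k *\<^sub>R (U j ((x + s S) + t *\<^sub>R j) - U j x))) (at t within closed_segment 0 (h \<bullet> j))"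
            unfolding has_vector_derivative_def by (rule has_derivative_at_withinI)
          show "onorm (\<lambda>k. k *\<^sub>R (U j ((x + s S) + t *\<^sub>R j) - U j x)) \<le> e / n"
          proof (rule onorm_le)
            fix k :: real
            show "norm (k *\<^sub>R (U j ((x + s S) + t *\<^sub>R j) - U j x)) \<le> e / n * norm k"
              unfolding norm_scaleR real_norm_def mult.commute[of "\<bar>k\<bar>"]
              by (rule mult_right_mono) (use tU in \<open>auto simp: dist_norm\<close>)
          qed
        qed auto
        then have 1: "norm (u (x + s (insert j S)) - u (x + s S) - (h \<bullet> j) *\<^sub>R U j x) \<le> e / n * \<bar>h \<bullet> j\<bar>"
          unfolding \<phi>_def sj by (simp add: algebra_simps)
        have 2: "norm (u (x + s S) - u x - (\<Sum>i\<in>S. (h \<bullet> i) *\<^sub>R U i x)) \<le> e / n * a S"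
          by (rule insert.IH[OF S])
        have "u (x + s (insert j S)) - u x - (\<Sum>i\<in>insert j S. (h \<bullet> i) *\<^sub>R U i x)
            = (u (x + s (insert j S)) - u (x + s S) - (h \<bullet> j) *\<^sub>R U j x)
              + (u (x + s S) - u x - (\<Sum>i\<in>S. (h \<bullet> i) *\<^sub>R U i x))"
          using insert by simp
        then have "norm (u (x + s (insert j S)) - u x - (\<Sum>i\<in>insert j S. (h \<bullet> i) *\<^sub>R U i x))
            \<le> e / n * \<bar>h \<bullet> j\<bar> + e / n * a S"
          using norm_triangle_mono[OF 1 2] by (simp only:)
        then show ?case unfolding aj by (simp add: algebra_simps)
      qed
      from this[of Basis]
      have "norm (u (x + s Basis) - u x - (\<Sum>i\<in>Basis. (h \<bullet> i) *\<^sub>R U i x)) \<le> e / n * a Basis"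
        by simp
      also have "\<dots> \<le> e / n * (n * norm h)"
        using a[of Basis] e n by (intro mult_left_mono) auto
      also have "x + s Basis = y" unfolding s_def euclidean_representation h_def by simp
      finally show "norm (u y - u x - (\<Sum>i\<in>Basis. ((y - x) \<bullet> i) *\<^sub>R U i x)) \<le> e * norm (y - x)"
        using n unfolding h_def by simp
    qed
  qed
qed

lemma smooth_on_C1:
  assumes "open G" "smooth_on G g" "set is \<subseteq> Basis"
  shows "C1_on G (iter_pdiff is g) (\<lambda>i. iter_pdiff (i # is) g)"
proof (rule C1_onI_partials[OF assms(1)])
  fix i :: 'a assume i: "i \<in> Basis"
  then show "continuous_on G (iter_pdiff (i # is) g)"
    using assms(2,3) unfolding smooth_on_def by (metis insert_subset list.simps(15))
  fix x assume "x \<in> G"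
  then have "pdiff_exists i (iter_pdiff is g) x"
    using assms i unfolding smooth_on_def by blast
  then show "((\<lambda>t. iter_pdiff is g (x + t *\<^sub>R i)) has_vector_derivative iter_pdiff (i # is) g x) (at 0)"
    unfolding pdiff_exists_def by (simp add: pdiff_def vector_derivative_works)
qed

text \<open>In \<open>iter_pdiff\<close> the head of the list acts last, so the Laplacian, which
  acts first, appends \<open>[i, i]\<close> at the end. The equality holds on \<open>G\<close>, and
  openness allows it to be differentiated there.\<close>

lemma iter_pdiff_laplacian:
  assumes "open G" "smooth_on G g" "set is \<subseteq> Basis"
  shows "\<forall>x\<in>G. iter_pdiff is (laplacian g) x = (\<Sum>i\<in>Basis. iter_pdiff (is @ [i, i]) g x)"
    and "C1_on G (iter_pdiff is (laplacian g)) (\<lambda>j. iter_pdiff (j # is) (laplacian g))"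
proof -
  have *: "C1_on G (\<lambda>x. \<Sum>i\<in>Basis. iter_pdiff (js @ [i, i]) g x)
      (\<lambda>j x. \<Sum>i\<in>Basis. iter_pdiff (j # js @ [i, i]) g x)" if "set js \<subseteq> Basis" for js
    by (rule C1_on_sum, rule smooth_on_C1) (use assms that in auto)
  have eq: "\<forall>x\<in>G. iter_pdiff js (laplacian g) x = (\<Sum>i\<in>Basis. iter_pdiff (js @ [i, i]) g x)"
    if "set js \<subseteq> Basis" for js
    using that
  proof (induction js)
    case Nil
    then show ?case by (simp add: laplacian_def)
  next
    case (Cons j js)
    then have "C1_on G (iter_pdiff js (laplacian g)) (\<lambda>j x. \<Sum>i\<in>Basis. iter_pdiff (j # js @ [i, i]) g x)"
      using C1_on_cong[OF *[of js] assms(1)] by auto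
    then show ?case
      using C1_on_pdiff(1) Cons.prems by fastforce
  qed
  then show "\<forall>x\<in>G. iter_pdiff is (laplacian g) x = (\<Sum>i\<in>Basis. iter_pdiff (is @ [i, i]) g x)"
    using assms(3) by blast
  show "C1_on G (iter_pdiff is (laplacian g)) (\<lambda>j. iter_pdiff (j # is) (laplacian g))"
  proof (rule C1_on_cong[OF *[OF assms(3)] assms(1)])
    fix x assume x: "x \<in> G"
    then show "iter_pdiff is (laplacian g) x = (\<Sum>i\<in>Basis. iter_pdiff (is @ [i, i]) g x)"
      using eq[OF assms(3)] by blast
    fix j :: 'a assume "j \<in> Basis"
    then show "iter_pdiff (j # is) (laplacian g) x = (\<Sum>i\<in>Basis. iter_pdiff (j # is @ [i, i]) g x)"
      using eq[of "j # is"] assms(3) x by simp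
  qed
qed

lemma smooth_on_laplacian:
  assumes "open G" "smooth_on G g"
  shows "smooth_on G (laplacian g)"
  unfolding smooth_on_def
proof (intro allI impI conjI ballI)
  fix js :: "'a list" assume "set js \<subseteq> Basis"
  note C1 = iter_pdiff_laplacian(2)[OF assms this]
  show "continuous_on G (iter_pdiff js (laplacian g))"
    by (rule C1_on_continuous[OF C1])
  show "pdiff_exists i (iter_pdiff js (laplacian g)) x" if "i \<in> Basis" "x \<in> G" for i x
    by (rule C1_on_pdiff(2)[OF C1 that(2,1)])
qed

lemma smooth_on_laplacian_power:
  assumes "open G" "smooth_on G g"
  shows "smooth_on G ((laplacian ^^ p) g)"
  by (induction p) (auto intro: smooth_on_laplacian assms)

section \<open>The Euler field, polynomials and homogeneity\<close>

definition euler :: "('a::euclidean_space \<Rightarrow> 'a \<Rightarrow> complex) \<Rightarrow> 'a \<Rightarrow> complex" where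
  "euler U x = (\<Sum>i\<in>Basis. (x \<bullet> i) *\<^sub>R U i x)"

lemma C1_on_euler:
  assumes "\<And>i. i \<in> Basis \<Longrightarrow> C1_on G (U i) (V i)"
  shows "C1_on G (euler U) (\<lambda>j x. U j x + (\<Sum>i\<in>Basis. (x \<bullet> i) *\<^sub>R V i j x))"
proof -
  have "C1_on G (\<lambda>x. \<Sum>i\<in>Basis. (x \<bullet> i) *\<^sub>R U i x)
     (\<lambda>j x. \<Sum>i\<in>Basis. (if j = i then U i x else 0) + (x \<bullet> i) *\<^sub>R V i j x)"
    by (intro C1_on_sum C1_on_scaleR_coord assms)
  then show ?thesis
    unfolding C1_on_def euler_def[abs_def] by (simp add: sum.distrib)
qed

text \<open>In the variable v = log r the operator r d/dr becomes d/dv along a ray; this is why the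
  Euler field replaces d/dr throughout.\<close>

lemma has_vector_derivative_ray:
  assumes "C1_on G u U" "exp v *\<^sub>R x \<in> G"
  shows "((\<lambda>v. u (exp v *\<^sub>R x)) has_vector_derivative euler U (exp v *\<^sub>R x)) (at v)"
proof -
  have "((\<lambda>v. exp v *\<^sub>R x) has_derivative (\<lambda>t. t *\<^sub>R (exp v *\<^sub>R x))) (at v)"
    by (auto intro!: derivative_eq_intros simp: mult.commute)
  from has_derivative_compose[OF this C1_onD(2)[OF assms]]
  show ?thesis
    unfolding has_vector_derivative_def euler_def by (simp add: scaleR_sum_right mult.assoc)
qed

text \<open>This class is closed under partial differentiation (\<open>cpoly_C1\<close>), which
  supplies second derivatives of homogeneous polynomials without computing on multi-indices.\<close>

inductive cpoly :: "('a::euclidean_space \<Rightarrow> complex) \<Rightarrow> bool" where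
  const: "cpoly (\<lambda>x. c)"
| coord: "cpoly (\<lambda>x. of_real (x \<bullet> b))"
| add: "cpoly P \<Longrightarrow> cpoly Q \<Longrightarrow> cpoly (\<lambda>x. P x + Q x)"
| mult: "cpoly P \<Longrightarrow> cpoly Q \<Longrightarrow> cpoly (\<lambda>x. P x * Q x)"

lemma cpoly_C1:
  assumes "cpoly P"
  shows "\<exists>U. (\<forall>i. cpoly (U i)) \<and> C1_on UNIV P U"
  using assms
proof induction
  case (const c)
  show ?case
    by (intro exI[of _ "\<lambda>i x. 0"]) (simp add: cpoly.const C1_on_const)
next
  case (coord b)
  show ?case
    by (intro exI[of _ "\<lambda>i x. of_real (b \<bullet> i)"]) (simp add: cpoly.const C1_on_coord)
next
  case (add P Q)
  then obtain U W where "\<forall>i. cpoly (U i)" "C1_on UNIV P U" "\<forall>i. cpoly (W i)" "C1_on UNIV Q W"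
    by blast
  then show ?case
    by (intro exI[of _ "\<lambda>i x. U i x + W i x"]) (simp add: cpoly.add C1_on_add)
next
  case (mult P Q)
  then obtain U W where "\<forall>i. cpoly (U i)" "C1_on UNIV P U" "\<forall>i. cpoly (W i)" "C1_on UNIV Q W"
    by blast
  then show ?case
    using mult.hyps
    by (intro exI[of _ "\<lambda>i x. U i x * Q x + P x * W i x"]) (simp add: cpoly.add cpoly.mult C1_on_mult)
qed

lemma cpoly_sum:
  assumes "\<And>a. a \<in> A \<Longrightarrow> cpoly (P a)"
  shows "cpoly (\<lambda>x. \<Sum>a\<in>A. P a x)"
  using assms by (induction A rule: infinite_finite_induct) (simp_all add: cpoly.const cpoly.add)

lemma cpoly_prod:
  assumes "\<And>a. a \<in> A \<Longrightarrow> cpoly (P a)"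
  shows "cpoly (\<lambda>x. \<Prod>a\<in>A. P a x)"
  using assms by (induction A rule: infinite_finite_induct) (simp_all add: cpoly.const cpoly.mult)

lemma cpoly_power:
  assumes "cpoly P" shows "cpoly (\<lambda>x. P x ^ n)"
  by (induction n) (simp_all add: cpoly.const cpoly.mult assms)

lemma hom_poly_imp_cpoly:
  assumes "hom_poly k P" shows "cpoly P"
proof -
  obtain c where "P = (\<lambda>x. \<Sum>\<alpha>\<in>multi_indices k. c \<alpha> * (\<Prod>i\<in>Basis. complex_of_real (x \<bullet> i) ^ \<alpha> i))"
    using assms unfolding hom_poly_def by blast
  then show ?thesis
    by (simp only:) (intro cpoly_sum cpoly.mult cpoly.const cpoly_prod cpoly_power cpoly.coord)
qed

lemma hom_poly_scaleR:
  assumes "hom_poly k P"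
  shows "P (t *\<^sub>R x) = of_real t ^ k * P x"
proof -
  obtain c where c: "P = (\<lambda>x. \<Sum>\<alpha>\<in>multi_indices k. c \<alpha> * (\<Prod>i\<in>Basis. complex_of_real (x \<bullet> i) ^ \<alpha> i))"
    using assms unfolding hom_poly_def by blast
  have "(\<Prod>i\<in>Basis. complex_of_real ((t *\<^sub>R x) \<bullet> i) ^ \<alpha> i) = of_real t ^ k * (\<Prod>i\<in>Basis. complex_of_real (x \<bullet> i) ^ \<alpha> i)"
    if "\<alpha> \<in> multi_indices k" for \<alpha>
    using that unfolding multi_indices_def
    by (auto simp: power_mult_distrib prod.distrib power_sum)
  then show ?thesis
    unfolding c by (simp add: sum_distrib_left mult_ac)
qed

text \<open>Euler's theorem, by differentiating P(e^v x) = e^(kv) P(x) at v = 0.\<close>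

lemma euler_homogeneous:
  assumes "C1_on UNIV P U" "\<And>t. P (t *\<^sub>R x) = of_real t ^ k * P x"
  shows "euler U x = of_nat k * P x"
proof -
  have "((\<lambda>v. P (exp v *\<^sub>R x)) has_vector_derivative euler U (exp 0 *\<^sub>R x)) (at 0)"
    by (rule has_vector_derivative_ray[OF assms(1)]) simp
  moreover have "((\<lambda>v. of_real (exp v) ^ k * P x) has_vector_derivative of_nat k * P x) (at 0)"
  proof -
    have "((\<lambda>w. exp w ^ k * P x) has_field_derivative of_nat k * P x) (at (of_real 0))"
      by (auto intro!: derivative_eq_intros)
    from has_vector_derivative_real_field[OF this] show ?thesis by (simp flip: exp_of_real)
  qed
  ultimately show ?thesis
    unfolding assms(2) using vector_derivative_unique_at by fastforce
qed

section \<open>Integration over the sphere\<close>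

lemma continuous_on_sphere_measurable:
  assumes "continuous_on (sphere 0 1) h"
  shows "h \<in> borel_measurable (restrict_space borel (sphere 0 1))"
  by (rule borel_measurable_continuous_on_restrict[OF assms])

lemma normalize_measurable:
  "(\<lambda>x::'a::euclidean_space. x /\<^sub>R norm x) \<in>
     restrict_space lborel (ball 0 1 - {0}) \<rightarrow>\<^sub>M restrict_space borel (sphere 0 1)"
proof (rule measurable_restrict_space2)
  show "(\<lambda>x. x /\<^sub>R norm x) \<in> space (restrict_space lborel (ball 0 1 - {0})) \<rightarrow> sphere (0::'a) 1"
    by (auto simp: space_restrict_space)
  show "(\<lambda>x::'a. x /\<^sub>R norm x) \<in> borel_measurable (restrict_space lborel (ball 0 1 - {0}))"
    by (rule measurable_restrict_space1) simp
qed

lemma space_sphere_measure [simp]: "space (sphere_measure :: 'a::euclidean_space measure) = sphere 0 1"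
  unfolding sphere_measure_def by (simp add: space_restrict_space)

lemma sets_sphere_measure:
  "sets (sphere_measure :: 'a::euclidean_space measure) = sets (restrict_space borel (sphere 0 1))"
  unfolding sphere_measure_def by simp

lemma finite_measure_sphere_measure: "finite_measure (sphere_measure :: 'a::euclidean_space measure)"
proof (rule finite_measureI)
  let ?B = "restrict_space lborel (ball 0 1 - {0}) :: 'a measure"
  let ?D = "distr ?B (restrict_space borel (sphere 0 1)) (\<lambda>x::'a. x /\<^sub>R norm x)"
  have "emeasure ?B (space ?B) = emeasure lborel (ball 0 1 - {0} :: 'a set)"
    by (subst emeasure_restrict_space) (auto simp: space_restrict_space)
  also have "\<dots> \<le> emeasure lborel (ball 0 1 :: 'a set)"
    by (rule emeasure_mono) auto
  also have "\<dots> < \<infinity>" by (rule emeasure_lborel_ball_finite)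
  finally have "finite_measure ?B"
    by (intro finite_measureI) auto
  then have "finite_measure ?D"
    by (rule finite_measure.finite_measure_distr[OF _ normalize_measurable])
  then have "emeasure ?D (space ?D) < \<infinity>"
    using finite_measure.emeasure_finite top.not_eq_extremum by fastforce
  then show "emeasure (sphere_measure :: 'a measure) (space sphere_measure) \<noteq> \<infinity>"
    unfolding sphere_measure_def space_density emeasure_density_const[OF sets.top]
    by (simp add: ennreal_mult_eq_top_iff)
qed

lemma integrable_sphere_continuous:
  fixes h :: "'a::euclidean_space \<Rightarrow> complex"
  assumes "continuous_on (sphere 0 1) h"
  shows "integrable sphere_measure h"
proof -
  interpret finite_measure "sphere_measure :: 'a measure" by (rule finite_measure_sphere_measure)
  have "bounded (h ` sphere 0 1)"
    by (intro compact_imp_bounded compact_continuous_image assms compact_sphere)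
  then obtain B where "\<forall>y\<in>h ` sphere 0 1. norm y \<le> B"
    unfolding bounded_iff by blast
  then have "\<And>x. x \<in> sphere 0 1 \<Longrightarrow> norm (h x) \<le> B"
    by simp
  moreover have "h \<in> borel_measurable sphere_measure"
    using continuous_on_sphere_measurable[OF assms] by (simp cong: measurable_cong_sets add: sets_sphere_measure)
  ultimately show ?thesis
    by (intro integrable_const_bound[of _ B]) auto
qed

lemma integral_sphere_measure:
  fixes h :: "'a::euclidean_space \<Rightarrow> complex"
  assumes "continuous_on (sphere 0 1) h"
  shows "(LINT \<theta>|sphere_measure. h \<theta>) =
    real DIM('a) *\<^sub>R (LINT x|lborel. indicator (ball 0 1 - {0}) x *\<^sub>R h (x /\<^sub>R norm x))"
proof -
  let ?B = "restrict_space lborel (ball 0 1 - {0}) :: 'a measure"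
  let ?N = "restrict_space borel (sphere 0 1) :: 'a measure"
  have m: "h \<in> borel_measurable ?N" by (rule continuous_on_sphere_measurable[OF assms])
  then have "(LINT \<theta>|sphere_measure. h \<theta>) =
      (LINT \<theta>|distr ?B ?N (\<lambda>x. x /\<^sub>R norm x). real DIM('a) *\<^sub>R h \<theta>)"
    unfolding sphere_measure_def by (subst integral_density) auto
  also have "\<dots> = real DIM('a) *\<^sub>R (LINT \<theta>|distr ?B ?N (\<lambda>x. x /\<^sub>R norm x). h \<theta>)"
    by (rule integral_scaleR_right)
  also have "(LINT \<theta>|distr ?B ?N (\<lambda>x. x /\<^sub>R norm x). h \<theta>) = (LINT x|?B. h (x /\<^sub>R norm x))"
    by (rule integral_distr[OF normalize_measurable m])
  also have "\<dots> = (LINT x|lborel. indicator (ball 0 1 - {0}) x *\<^sub>R h (x /\<^sub>R norm x))"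
    by (rule integral_restrict_space) auto
  finally show ?thesis .
qed

text \<open>Uniform continuity of \<open>g'\<close> on the compact strip makes the linearization
  error uniform in theta, and the finite total mass turns it into an error of the integral.\<close>

lemma has_vector_derivative_integral_sphere:
  fixes g g' :: "real \<Rightarrow> 'a::euclidean_space \<Rightarrow> complex"
  assumes "0 < e"
    and deriv: "\<And>v \<theta>. v \<in> {v0-e..v0+e} \<Longrightarrow> \<theta> \<in> sphere 0 1 \<Longrightarrow>
      ((\<lambda>v. g v \<theta>) has_vector_derivative g' v \<theta>) (at v)"
    and cont: "\<And>v. v \<in> {v0-e..v0+e} \<Longrightarrow> continuous_on (sphere 0 1) (g v)"
    and cont': "continuous_on ({v0-e..v0+e} \<times> sphere 0 1) (\<lambda>(v, \<theta>). g' v \<theta>)"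
  shows "((\<lambda>v. LINT \<theta>|sphere_measure. g v \<theta>) has_vector_derivative (LINT \<theta>|sphere_measure. g' v0 \<theta>)) (at v0)"
proof -
  interpret finite_measure "sphere_measure :: 'a measure" by (rule finite_measure_sphere_measure)
  define m where "m = measure (sphere_measure :: 'a measure) (sphere 0 1)"
  have m: "m \<ge> 0" unfolding m_def by simp
  have "continuous_on (sphere 0 1) ((\<lambda>(v, \<theta>). g' v \<theta>) \<circ> Pair v0)"
    by (rule continuous_on_compose[OF _ continuous_on_subset[OF cont']])
       (use assms(1) in \<open>auto intro!: continuous_intros\<close>)
  then have cg': "continuous_on (sphere 0 1) (g' v0)" by (simp add: o_def)
  have "((\<lambda>v. LINT \<theta>|sphere_measure. g v \<theta>) has_derivative (\<lambda>h. h *\<^sub>R (LINT \<theta>|sphere_measure. g' v0 \<theta>))) (at v0)"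
    unfolding has_derivative_at_alt
  proof (intro conjI allI impI bounded_linear_scaleR_left)
    fix \<epsilon> :: real assume \<epsilon>: "\<epsilon> > 0"
    define \<eta> where "\<eta> = \<epsilon> / (m + 1)"
    have \<eta>: "\<eta> > 0" "m * \<eta> \<le> \<epsilon>"
      using \<epsilon> m unfolding \<eta>_def by (auto simp: field_simps)
    have "uniformly_continuous_on ({v0-e..v0+e} \<times> sphere 0 1) (\<lambda>(v, \<theta>). g' v \<theta>)"
      by (intro compact_uniformly_continuous cont' compact_Times compact_sphere compact_Icc)
    then obtain d where d: "d > 0" "\<And>p p'. p \<in> {v0-e..v0+e} \<times> sphere 0 1 \<Longrightarrow> p' \<in> {v0-e..v0+e} \<times> sphere 0 1 \<Longrightarrow>
        dist p' p < d \<Longrightarrow> dist ((\<lambda>(v, \<theta>). g' v \<theta>) p') ((\<lambda>(v, \<theta>). g' v \<theta>) p) < \<eta>"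
      unfolding uniformly_continuous_on_def using \<eta>(1) by meson
    define \<delta> where "\<delta> = min d e"
    have near: "norm (g' v \<theta> - g' v0 \<theta>) \<le> \<eta>" if "\<bar>v - v0\<bar> < \<delta>" "\<theta> \<in> sphere 0 1" for v \<theta>
      using d(2)[of "(v0, \<theta>)" "(v, \<theta>)"] that assms(1)
      by (auto simp: \<delta>_def dist_Pair_Pair dist_norm abs_if split: if_splits)
    show "\<exists>d>0. \<forall>y. norm (y - v0) < d \<longrightarrow> norm ((LINT \<theta>|sphere_measure. g y \<theta>) - (LINT \<theta>|sphere_measure. g v0 \<theta>)
        - (y - v0) *\<^sub>R (LINT \<theta>|sphere_measure. g' v0 \<theta>)) \<le> \<epsilon> * norm (y - v0)"
    proof (intro exI[of _ \<delta>] conjI allI impI)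
      show "\<delta> > 0" using d assms(1) unfolding \<delta>_def by simp
      fix y assume "norm (y - v0) < \<delta>"
      then have y: "\<bar>y - v0\<bar> < \<delta>" by simp
      then have yI: "y \<in> {v0-e..v0+e}" "v0 \<in> {v0-e..v0+e}" unfolding \<delta>_def by auto
      have seg: "\<bar>t - v0\<bar> < \<delta>" if "t \<in> closed_segment v0 y" for t
        using that y by (auto simp: closed_segment_eq_real_ivl split: if_splits)
      have pt: "norm (g y \<theta> - g v0 \<theta> - (y - v0) *\<^sub>R g' v0 \<theta>) \<le> \<bar>y - v0\<bar> * \<eta>"
        if \<theta>: "\<theta> \<in> sphere 0 1" for \<theta>
      proof -
        have "norm (g y \<theta> - g v0 \<theta> - (y - v0) *\<^sub>R g' v0 \<theta>) \<le> norm (y - v0) * \<eta>"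
        proof (rule vector_differentiable_bound_linearization[where S = "closed_segment v0 y" and f' = "\<lambda>v. g' v \<theta>"])
          fix t assume t: "t \<in> closed_segment v0 y"
          then have "t \<in> {v0-e..v0+e}" using seg[OF t] unfolding \<delta>_def by auto
          then show "((\<lambda>v. g v \<theta>) has_vector_derivative g' t \<theta>) (at t within closed_segment v0 y)"
            using deriv[OF _ \<theta>] has_vector_derivative_at_within by blast
          show "norm (g' t \<theta> - g' v0 \<theta>) \<le> \<eta>" by (rule near[OF seg[OF t] \<theta>])
        qed auto
        then show ?thesis by simp
      qed
      have i: "integrable sphere_measure (g y)" "integrable sphere_measure (g v0)" "integrable sphere_measure (g' v0)"
        by (intro integrable_sphere_continuous cont yI cg')+
      have "(LINT \<theta>|sphere_measure. g y \<theta>) - (LINT \<theta>|sphere_measure. g v0 \<theta>) - (y - v0) *\<^sub>R (LINT \<theta>|sphere_measure. g' v0 \<theta>)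
         = (LINT \<theta>|sphere_measure. g y \<theta> - g v0 \<theta> - (y - v0) *\<^sub>R g' v0 \<theta>)"
        using i by simp
      also have "norm \<dots> \<le> (LINT \<theta>|(sphere_measure :: 'a measure). \<bar>y - v0\<bar> * \<eta>)"
        by (rule Bochner_Integration.integral_norm_bound_integral) (use i pt in auto)
      also have "\<dots> = \<bar>y - v0\<bar> * (m * \<eta>)" unfolding m_def by simp
      also have "\<dots> \<le> \<bar>y - v0\<bar> * \<epsilon>" using \<eta> by (intro mult_left_mono) auto
      finally show "norm ((LINT \<theta>|sphere_measure. g y \<theta>) - (LINT \<theta>|sphere_measure. g v0 \<theta>)
        - (y - v0) *\<^sub>R (LINT \<theta>|sphere_measure. g' v0 \<theta>)) \<le> \<epsilon> * norm (y - v0)"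
        by (simp add: mult.commute)
    qed
  qed
  then show ?thesis unfolding has_vector_derivative_def .
qed

section \<open>Vanishing integrals of rotation fields\<close>

lemma integral_translation_lborel:
  fixes \<phi> :: "'a::euclidean_space \<Rightarrow> complex"
  assumes "\<phi> \<in> borel_measurable borel"
  shows "(LINT x|lborel. \<phi> (a + x)) = (LINT x|lborel. \<phi> x)"
proof -
  have "(LINT x|lborel. \<phi> x) = (LINT x|distr lborel borel ((+) a). \<phi> x)"
    by (simp add: lborel_distr_plus)
  also have "\<dots> = (LINT x|lborel. \<phi> (a + x))"
    by (rule integral_distr) (use assms in auto)
  finally show ?thesis by simp
qed

text \<open>Difference quotients of \<open>\<phi>\<close> integrate to 0 by translation invariance,
  and they converge to \<open>\<psi>\<close> under a fixed integrable bound.\<close>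

lemma integral_partial_derivative_eq_0:
  fixes \<phi> \<psi> :: "'a::euclidean_space \<Rightarrow> complex"
  assumes i: "i \<in> Basis"
    and deriv: "\<And>x. ((\<lambda>t. \<phi> (x + t *\<^sub>R i)) has_vector_derivative \<psi> x) (at 0)"
    and c\<phi>: "continuous_on UNIV \<phi>" and c\<psi>: "continuous_on UNIV \<psi>"
    and supp: "\<And>x. 1 \<le> norm x \<Longrightarrow> \<phi> x = 0"
  shows "integrable lborel \<psi>" and "(LINT x|lborel. \<psi> x) = 0"
proof -
  have "bounded (\<psi> ` cball 0 3)"
    by (intro compact_imp_bounded compact_continuous_image continuous_on_subset[OF c\<psi>]) auto
  then obtain B where "\<forall>y\<in>\<psi> ` cball 0 3. norm y \<le> B"
    unfolding bounded_iff by blast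
  then have B: "\<And>x. norm x \<le> 3 \<Longrightarrow> norm (\<psi> x) \<le> B"
    by simp
  have m\<phi>: "\<phi> \<in> borel_measurable borel" and m\<psi>: "\<psi> \<in> borel_measurable borel"
    using c\<phi> c\<psi> by (auto intro: borel_measurable_continuous_onI)
  have i\<phi>: "integrable lborel \<phi>"
  proof -
    have "integrable lborel (\<lambda>x. indicator (cball 0 1) x *\<^sub>R \<phi> x)"
      by (intro borel_integrable_compact continuous_on_subset[OF c\<phi>]) auto
    also have "(\<lambda>x. indicator (cball 0 1) x *\<^sub>R \<phi> x) = \<phi>"
      using supp by (force simp: indicator_def)
    finally show ?thesis .
  qed
  define s where "s = (\<lambda>n x. real (Suc n) *\<^sub>R (\<phi> (x + (1 / real (Suc n)) *\<^sub>R i) - \<phi> x))"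
  \<comment> \<open>The increments have length at most 1 and \<open>\<phi>\<close> vanishes off the
    unit ball, so the quotients live in the ball of radius 2. The mean value inequality there uses
    \<open>\<psi>\<close> up to radius 3, where \<open>B\<close> was taken.\<close>
  define w where "w = (\<lambda>x::'a. B * indicator (cball 0 2) x)"
  have iw: "integrable lborel w"
    unfolding w_def by (intro integrable_mult_right integrable_real_indicator emeasure_lborel_cball_finite) simp
  have ms: "s n \<in> borel_measurable lborel" for n
    unfolding s_def by (intro borel_measurable_scaleR borel_measurable_diff borel_measurable_const)
      (use m\<phi> in measurable)
  have lim: "(\<lambda>n. s n x) \<longlonglongrightarrow> \<psi> x" for x
  proof -
    have "(\<lambda>h. norm (\<phi> (x + h *\<^sub>R i) - \<phi> x - h *\<^sub>R \<psi> x) / norm h) \<midarrow>0\<rightarrow> 0"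
      using deriv[of x] unfolding has_vector_derivative_def has_derivative_at by simp
    moreover have "norm (\<phi> (x + h *\<^sub>R i) - \<phi> x - h *\<^sub>R \<psi> x) / norm h
        = norm ((\<phi> (x + h *\<^sub>R i) - \<phi> x) /\<^sub>R h - \<psi> x)" if "h \<noteq> 0" for h
    proof -
      have "(\<phi> (x + h *\<^sub>R i) - \<phi> x) /\<^sub>R h - \<psi> x = (\<phi> (x + h *\<^sub>R i) - \<phi> x - h *\<^sub>R \<psi> x) /\<^sub>R h"
        using that by (simp add: scaleR_right_diff_distrib)
      then show ?thesis by (simp add: divide_inverse mult.commute)
    qed
    ultimately have "(\<lambda>h. norm ((\<phi> (x + h *\<^sub>R i) - \<phi> x) /\<^sub>R h - \<psi> x)) \<midarrow>0\<rightarrow> 0"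
      by (simp cong: LIM_cong)
    then have "((\<lambda>h. (\<phi> (x + h *\<^sub>R i) - \<phi> x) /\<^sub>R h) \<longlongrightarrow> \<psi> x) (at 0)"
      by (rule LIM_zero_cancel[OF tendsto_norm_zero_cancel])
    moreover have "filterlim (\<lambda>n. 1 / real (Suc n)) (at 0) sequentially"
      unfolding filterlim_at using LIMSEQ_inverse_real_of_nat by (simp add: field_simps)
    ultimately have "(\<lambda>n. (\<phi> (x + (1 / real (Suc n)) *\<^sub>R i) - \<phi> x) /\<^sub>R (1 / real (Suc n))) \<longlonglongrightarrow> \<psi> x"
      by (rule filterlim_compose)
    then show ?thesis unfolding s_def by simp
  qed
  have bound: "norm (s n x) \<le> w x" for n x
  proof (cases "norm x \<le> 2")
    case True
    define h where "h = 1 / real (Suc n)"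
    have h: "0 < h" "h \<le> 1" unfolding h_def by auto
    have "norm (\<phi> (x + h *\<^sub>R i) - \<phi> (x + 0 *\<^sub>R i)) \<le> B * norm (h - 0)"
    proof (rule differentiable_bound[of "{0..h}" "\<lambda>t. \<phi> (x + t *\<^sub>R i)" "\<lambda>t k. k *\<^sub>R \<psi> (x + t *\<^sub>R i)"])
      fix t assume t: "t \<in> {0..h}"
      have "norm (x + t *\<^sub>R i) \<le> 2 + 1"
        using True t h i by (intro order_trans[OF norm_triangle_ineq] add_mono) auto
      then have le: "norm (\<psi> (x + t *\<^sub>R i)) \<le> B" by (intro B) simp
      show "((\<lambda>t. \<phi> (x + t *\<^sub>R i)) has_derivative (\<lambda>k. k *\<^sub>R \<psi> (x + t *\<^sub>R i))) (at t within {0..h})"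
        using has_vector_derivative_line[OF deriv[of "x + t *\<^sub>R i"]] unfolding has_vector_derivative_def
        by (rule has_derivative_at_withinI)
      show "onorm (\<lambda>k. k *\<^sub>R \<psi> (x + t *\<^sub>R i)) \<le> B"
      proof (rule onorm_le)
        fix k :: real
        show "norm (k *\<^sub>R \<psi> (x + t *\<^sub>R i)) \<le> B * norm k"
          unfolding norm_scaleR real_norm_def mult.commute[of "\<bar>k\<bar>"] by (rule mult_right_mono[OF le]) simp
      qed
    qed (use h in auto)
    then have "norm (\<phi> (x + h *\<^sub>R i) - \<phi> x) \<le> B * h" using h by simp
    then have "real (Suc n) * norm (\<phi> (x + h *\<^sub>R i) - \<phi> x) \<le> real (Suc n) * (B * h)"
      by (intro mult_left_mono) auto
    also have "\<dots> = B" unfolding h_def by simp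
    finally have "real (Suc n) * norm (\<phi> (x + h *\<^sub>R i) - \<phi> x) \<le> B" .
    then show ?thesis
      using True unfolding s_def w_def h_def[symmetric] by simp
  next
    case False
    have "norm x \<le> norm (x + (1 / real (Suc n)) *\<^sub>R i) + norm ((1 / real (Suc n)) *\<^sub>R i)"
      by (metis add_diff_cancel norm_triangle_ineq4)
    also have "norm ((1 / real (Suc n)) *\<^sub>R i) \<le> 1" using i by simp
    finally have "1 \<le> norm (x + (1 / real (Suc n)) *\<^sub>R i)" using False by simp
    then show ?thesis using False supp[of x] supp[of "x + (1 / real (Suc n)) *\<^sub>R i"]
      unfolding s_def w_def by simp
  qed
  show "integrable lborel \<psi>"
    by (rule integrable_dominated_convergence[where s = s and w = w])
       (use m\<psi> ms iw lim bound in auto)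
  have "(\<lambda>n. LINT x|lborel. s n x) \<longlonglongrightarrow> (LINT x|lborel. \<psi> x)"
    by (rule integral_dominated_convergence[where w = w])
       (use m\<psi> ms iw lim bound in auto)
  moreover have "(LINT x|lborel. s n x) = 0" for n
  proof -
    define a where "a = (1 / real (Suc n)) *\<^sub>R i"
    have "integrable lborel (\<lambda>x. \<phi> (a + x))"
    proof -
      have "integrable (distr lborel borel ((+) a)) \<phi>" using i\<phi> by (simp add: lborel_distr_plus)
      then show ?thesis by (subst (asm) integrable_distr_eq) (use m\<phi> in auto)
    qed
    then have "(LINT x|lborel. \<phi> (a + x) - \<phi> x) = (LINT x|lborel. \<phi> (a + x)) - (LINT x|lborel. \<phi> x)"
      by (rule Bochner_Integration.integral_diff[OF _ i\<phi>])
    also have "\<dots> = 0" unfolding integral_translation_lborel[OF m\<phi>] by simp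
    finally show ?thesis unfolding s_def a_def[symmetric] by (simp add: add.commute)
  qed
  ultimately show "(LINT x|lborel. \<psi> x) = 0"
    by (simp add: LIMSEQ_const_iff)
qed

text \<open>Takes care of the origin, where x / |x| is singular: a radial cutoff vanishing near 0
  makes the product extend across it.\<close>

lemma C1_on_extend_zero:
  assumes "C1_on (- {0}) \<phi> \<Phi>" "0 < r"
    and "\<And>x. x \<in> ball 0 r \<Longrightarrow> \<phi> x = 0"
    and "\<And>i x. i \<in> Basis \<Longrightarrow> x \<in> ball 0 r \<Longrightarrow> \<Phi> i x = 0"
  shows "C1_on UNIV \<phi> \<Phi>"
proof -
  have 0: "C1_on (ball 0 r) \<phi> \<Phi>"
    by (rule C1_on_cong[OF C1_on_const[of _ 0]]) (use assms in auto)
  have UN: "- {0} \<union> ball 0 r = (UNIV :: 'a set)" using assms(2) by auto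
  show ?thesis
    unfolding C1_on_def
  proof (intro conjI ballI)
    fix i :: 'a assume i: "i \<in> Basis"
    have "continuous_on (- {0} \<union> ball 0 r) (\<Phi> i)"
      by (rule continuous_on_open_Un) (use C1_onD(1)[OF assms(1) i] C1_onD(1)[OF 0 i] in auto)
    then show "continuous_on UNIV (\<Phi> i)" unfolding UN .
  next
    fix x :: 'a
    show "(\<phi> has_derivative (\<lambda>h. \<Sum>i\<in>Basis. (h \<bullet> i) *\<^sub>R \<Phi> i x)) (at x)"
      using C1_onD(2)[OF assms(1), of x] C1_onD(2)[OF 0, of x] assms(2) by (cases "x = 0") auto
  qed
qed

lemma has_derivative_normalize:
  fixes x :: "'a::euclidean_space"
  assumes "x \<noteq> 0"
  shows "((\<lambda>x. (\<rho> / norm x) *\<^sub>R x) has_derivative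
      (\<lambda>h. (\<rho> / norm x) *\<^sub>R h - (\<rho> * (x \<bullet> h) / norm x ^ 3) *\<^sub>R x)) (at x)"
proof -
  have "((\<lambda>x. (\<rho> / norm x) *\<^sub>R x) has_derivative
      (\<lambda>h. (\<rho> / norm x) *\<^sub>R h + (- (\<rho> * (h \<bullet> sgn x)) / (norm x * norm x)) *\<^sub>R x)) (at x)"
  proof -
    have "((\<lambda>x. \<rho> / norm x) has_derivative (\<lambda>h. (0 * norm x - \<rho> * (h \<bullet> sgn x)) / (norm x * norm x))) (at x)"
      by (rule has_derivative_divide'[OF has_derivative_const has_derivative_norm[OF assms]]) (use assms in simp)
    from has_derivative_scaleR[OF this has_derivative_ident] show ?thesis by simp
  qed
  moreover have "- (\<rho> * (h \<bullet> sgn x)) / (norm x * norm x) = - (\<rho> * (x \<bullet> h) / norm x ^ 3)" for h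
    by (simp add: sgn_div_norm power3_eq_cube divide_inverse inner_commute)
  ultimately show ?thesis by simp
qed

text \<open>Extends the values of \<open>u\<close> on the sphere of radius \<open>\<rho>\<close> to
  a function constant along rays, as a cone measure sees them. The derivative of the normalization
  is the projection onto the tangent space of the sphere, scaled by rho / |x|.\<close>

lemma C1_on_compose_normalize:
  fixes u :: "'a::euclidean_space \<Rightarrow> complex"
  assumes u: "C1_on G u U" and \<rho>: "0 < \<rho>" and sub: "sphere 0 \<rho> \<subseteq> G"
  defines "N \<equiv> (\<lambda>x. (\<rho> / norm x) *\<^sub>R x)"
  shows "C1_on (- {0}) (\<lambda>x. u (N x))
     (\<lambda>l x. \<Sum>b\<in>Basis. (((\<rho> / norm x) *\<^sub>R l - (\<rho> * (x \<bullet> l) / norm x ^ 3) *\<^sub>R x) \<bullet> b) *\<^sub>R U b (N x))"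
  unfolding C1_on_def
proof (intro conjI ballI)
  have NG: "N x \<in> G" if "x \<noteq> 0" for x
    using sub \<rho> that unfolding N_def by (auto simp: subset_iff)
  have cN: "continuous_on (- {0}) N"
    unfolding N_def by (intro continuous_intros) auto
  {
    fix l :: 'a assume l: "l \<in> Basis"
    have "continuous_on (- {0}) (\<lambda>x. U b (N x))" if "b \<in> Basis" for b
      by (rule continuous_on_compose2[OF C1_onD(1)[OF u that] cN]) (use NG in auto)
    then show "continuous_on (- {0}) (\<lambda>x. \<Sum>b\<in>Basis. (((\<rho> / norm x) *\<^sub>R l - (\<rho> * (x \<bullet> l) / norm x ^ 3) *\<^sub>R x) \<bullet> b) *\<^sub>R U b (N x))"
      by (intro continuous_intros) auto
  }
  fix x :: 'a assume "x \<in> - {0}"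
  then have x: "x \<noteq> 0" by simp
  define L where "L = (\<lambda>h. (\<rho> / norm x) *\<^sub>R h - (\<rho> * (x \<bullet> h) / norm x ^ 3) *\<^sub>R x)"
  have "bounded_linear L"
    using has_derivative_bounded_linear[OF has_derivative_normalize[OF x]] unfolding L_def .
  then have lin: "linear L" by (rule bounded_linear.linear)
  have A: "((\<lambda>x. u (N x)) has_derivative (\<lambda>h. \<Sum>b\<in>Basis. (L h \<bullet> b) *\<^sub>R U b (N x))) (at x)"
    unfolding L_def N_def
    by (rule has_derivative_compose[OF has_derivative_normalize[OF x] C1_onD(2)[OF u NG[OF x, unfolded N_def]]])
  have B: "(\<Sum>b\<in>Basis. (L h \<bullet> b) *\<^sub>R U b (N x)) = (\<Sum>l\<in>Basis. (h \<bullet> l) *\<^sub>R (\<Sum>b\<in>Basis. (L l \<bullet> b) *\<^sub>R U b (N x)))" for h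
  proof -
    have "L h = (\<Sum>l\<in>Basis. (h \<bullet> l) *\<^sub>R L l)"
      by (subst euclidean_representation[symmetric, of h]) (simp only: linear_sum[OF lin] linear_scale[OF lin])
    then have "(\<Sum>b\<in>Basis. (L h \<bullet> b) *\<^sub>R U b (N x)) = (\<Sum>b\<in>Basis. \<Sum>l\<in>Basis. ((h \<bullet> l) * (L l \<bullet> b)) *\<^sub>R U b (N x))"
      by (simp add: inner_sum_left scaleR_sum_left)
    also have "\<dots> = (\<Sum>l\<in>Basis. (h \<bullet> l) *\<^sub>R (\<Sum>b\<in>Basis. (L l \<bullet> b) *\<^sub>R U b (N x)))"
      by (subst sum.swap) (simp add: scaleR_sum_right)
    finally show ?thesis .
  qed
  have "((\<lambda>x. u (N x)) has_derivative (\<lambda>h. \<Sum>l\<in>Basis. (h \<bullet> l) *\<^sub>R (\<Sum>b\<in>Basis. (L l \<bullet> b) *\<^sub>R U b (N x)))) (at x)"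
    by (rule has_derivative_eq_rhs[OF A]) (rule ext, rule B)
  then show "((\<lambda>x. u (N x)) has_derivative (\<lambda>h. \<Sum>l\<in>Basis. (h \<bullet> l) *\<^sub>R
      (\<Sum>b\<in>Basis. (((\<rho> / norm x) *\<^sub>R l - (\<rho> * (x \<bullet> l) / norm x ^ 3) *\<^sub>R x) \<bullet> b) *\<^sub>R U b (N x)))) (at x)"
    unfolding L_def .
qed

lemma C1_on_radial:
  fixes G :: "'a::euclidean_space set"
  assumes d: "\<And>s. (\<kappa> has_real_derivative \<kappa>' s) (at s)" and c: "continuous_on UNIV \<kappa>'"
  shows "C1_on G (\<lambda>x. of_real (\<kappa> (x \<bullet> x))) (\<lambda>l x. of_real (2 * (x \<bullet> l) * \<kappa>' (x \<bullet> x)))"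
  unfolding C1_on_def
proof (intro conjI ballI)
  show "continuous_on G (\<lambda>x. complex_of_real (2 * (x \<bullet> l) * \<kappa>' (x \<bullet> x)))" for l
    by (intro continuous_intros continuous_on_compose2[OF c]) auto
  fix x :: 'a
  have "((\<lambda>x. x \<bullet> x) has_derivative (\<lambda>h. 2 * (x \<bullet> h))) (at x)"
    by (auto intro!: derivative_eq_intros simp: inner_commute)
  moreover have "(\<kappa> has_derivative (*) (\<kappa>' (x \<bullet> x))) (at (x \<bullet> x))"
    using d unfolding has_field_derivative_def .
  ultimately have "((\<lambda>x. \<kappa> (x \<bullet> x)) has_derivative (\<lambda>h. \<kappa>' (x \<bullet> x) * (2 * (x \<bullet> h)))) (at x)"
    by (rule has_derivative_compose)
  from has_derivative_of_real[OF this]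
  have "((\<lambda>x. complex_of_real (\<kappa> (x \<bullet> x))) has_derivative (\<lambda>h. of_real (\<kappa>' (x \<bullet> x) * (2 * (x \<bullet> h))))) (at x)" .
  moreover have "complex_of_real (\<kappa>' (x \<bullet> x) * (2 * (x \<bullet> h))) = (\<Sum>l\<in>Basis. (h \<bullet> l) *\<^sub>R of_real (2 * (x \<bullet> l) * \<kappa>' (x \<bullet> x)))" for h
    unfolding euclidean_inner[of x h]
    by (simp add: scaleR_conv_of_real sum_distrib_left mult_ac)
  ultimately show "((\<lambda>x. complex_of_real (\<kappa> (x \<bullet> x))) has_derivative
      (\<lambda>h. \<Sum>l\<in>Basis. (h \<bullet> l) *\<^sub>R of_real (2 * (x \<bullet> l) * \<kappa>' (x \<bullet> x)))) (at x)"
    by simp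
qed

text \<open>The field \<open>x\<^sub>i \<partial>\<^sub>j - x\<^sub>j \<partial>\<^sub>i\<close> annihilates radial functions, so a radial cutoff \<open>\<kappa>\<close> passes through it.\<close>
lemma integral_rotation_field_cutoff:
  fixes u :: "'a::euclidean_space \<Rightarrow> complex" and \<kappa> \<kappa>' :: "real \<Rightarrow> real"
  assumes u: "C1_on G u U" and \<rho>: "0 < \<rho>" and sub: "sphere 0 \<rho> \<subseteq> G"
    and ij: "i \<in> Basis" "j \<in> Basis" "i \<noteq> j"
    and d: "\<And>s. (\<kappa> has_real_derivative \<kappa>' s) (at s)" and c: "continuous_on UNIV \<kappa>'"
    and a: "0 < a" and z0: "\<And>s. s \<le> a \<Longrightarrow> \<kappa> s = 0" "\<And>s. s \<le> a \<Longrightarrow> \<kappa>' s = 0"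
    and z1: "\<And>s. 1 \<le> s \<Longrightarrow> \<kappa> s = 0"
  defines "h \<equiv> (\<lambda>\<theta>. (\<theta> \<bullet> i) *\<^sub>R U j (\<rho> *\<^sub>R \<theta>) - (\<theta> \<bullet> j) *\<^sub>R U i (\<rho> *\<^sub>R \<theta>))"
  shows "(LINT x|lborel. \<kappa> (x \<bullet> x) *\<^sub>R h (x /\<^sub>R norm x)) = 0"
proof -
  define N where "N = (\<lambda>x::'a. (\<rho> / norm x) *\<^sub>R x)"
  define W where "W = (\<lambda>x::'a. complex_of_real (\<kappa> (x \<bullet> x)))"
  define W' where "W' = (\<lambda>l x::'a. complex_of_real (2 * (x \<bullet> l) * \<kappa>' (x \<bullet> x)))"
  define D where "D = (\<lambda>l x. \<Sum>b\<in>Basis. (((\<rho> / norm x) *\<^sub>R l - (\<rho> * (x \<bullet> l) / norm x ^ 3) *\<^sub>R x) \<bullet> b) *\<^sub>R U b (N x))"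
  have cW: "C1_on (- {0}) W W'"
    unfolding W_def W'_def by (rule C1_on_radial[OF d c])
  have cD: "C1_on (- {0}) (\<lambda>x. u (N x)) D"
    unfolding D_def N_def by (rule C1_on_compose_normalize[OF u \<rho> sub])
  \<comment> \<open>Divergence form: as \<open>i\<close> and \<open>j\<close> differ, x_i d_j g -
    x_j d_i g = d_j(x_i g) - d_i(x_j g), so two integrals of pure partial derivatives suffice.
    \<open>\<Phi> b l\<close> is the l-th partial derivative of \<open>\<phi> b\<close>.\<close>
  define \<phi> where "\<phi> = (\<lambda>b x. (x \<bullet> b) *\<^sub>R (W x * u (N x)))"
  define \<Phi> where "\<Phi> = (\<lambda>b l x. (if l = b then W x * u (N x) else 0) + (x \<bullet> b) *\<^sub>R (W' l x * u (N x) + W x * D l x))"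
  have small: "x \<bullet> x \<le> a" if "x \<in> ball 0 (sqrt a)" for x :: 'a
  proof -
    have "norm x ^ 2 \<le> sqrt a ^ 2" using that by (intro power_mono) auto
    then show ?thesis using a by (simp add: dot_square_norm)
  qed
  have C1: "C1_on UNIV (\<phi> b) (\<Phi> b)" if "b \<in> Basis" for b
  proof (rule C1_on_extend_zero)
    show "C1_on (- {0}) (\<phi> b) (\<Phi> b)"
      unfolding \<phi>_def \<Phi>_def by (intro C1_on_scaleR_coord C1_on_mult cW cD that)
    show "\<phi> b x = 0" "\<Phi> b l x = 0" if "x \<in> ball 0 (sqrt a)" for l x
      using z0[OF small[OF that]] unfolding \<phi>_def \<Phi>_def W_def W'_def by auto
  qed (use a in auto)
  have supp: "\<phi> b x = 0" if "1 \<le> norm x" for b x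
    using z1[of "x \<bullet> x"] that one_le_power[OF that, of 2] unfolding \<phi>_def W_def by (simp add: dot_square_norm)
  have I: "integrable lborel (\<Phi> b l)" "(LINT x|lborel. \<Phi> b l x) = 0" if "b \<in> Basis" "l \<in> Basis" for b l
    using integral_partial_derivative_eq_0[OF that(2) C1_on_partial[OF C1[OF that(1)] UNIV_I that(2)]
        C1_on_continuous[OF C1[OF that(1)]] C1_onD(1)[OF C1[OF that(1)] that(2)] supp] by auto
  have eq: "\<Phi> i j x - \<Phi> j i x = \<rho> *\<^sub>R (\<kappa> (x \<bullet> x) *\<^sub>R h (x /\<^sub>R norm x))" for x
  proof (cases "x = 0")
    case True
    have "\<kappa> 0 = 0" "\<kappa>' 0 = 0" using z0 a by auto
    then show ?thesis using ij by (simp add: True \<Phi>_def W_def W'_def)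
  next
    case False
    have Dl: "D l x = (\<rho> / norm x) *\<^sub>R U l (N x) - (x \<bullet> l) *\<^sub>R (\<Sum>b\<in>Basis. (\<rho> * (x \<bullet> b) / norm x ^ 3) *\<^sub>R U b (N x))"
      if "l \<in> Basis" for l
    proof -
      have "D l x = (\<Sum>b\<in>Basis. ((\<rho> / norm x) * (l \<bullet> b)) *\<^sub>R U b (N x)) -
          (\<Sum>b\<in>Basis. ((x \<bullet> l) * (\<rho> * (x \<bullet> b) / norm x ^ 3)) *\<^sub>R U b (N x))"
        unfolding D_def by (simp add: inner_diff_left scaleR_diff_left sum_subtractf mult_ac)
      also have "(\<Sum>b\<in>Basis. ((\<rho> / norm x) * (l \<bullet> b)) *\<^sub>R U b (N x)) = (\<Sum>b\<in>Basis. if b = l then (\<rho> / norm x) *\<^sub>R U b (N x) else 0)"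
        using that by (intro sum.cong) (auto simp: inner_Basis)
      also have "\<dots> = (\<rho> / norm x) *\<^sub>R U l (N x)" using that by simp
      finally show ?thesis by (simp add: scaleR_sum_right)
    qed
    \<comment> \<open>The radial correction \<open>S\<close> enters \<open>D j\<close> with the
      factor x_j and \<open>D i\<close> with x_i, so it drops out of x_i D_j - x_j D_i.\<close>
    define S where "S = (\<Sum>b\<in>Basis. (\<rho> * (x \<bullet> b) / norm x ^ 3) *\<^sub>R U b (N x))"
    have Nx: "N x = \<rho> *\<^sub>R (x /\<^sub>R norm x)" unfolding N_def by (simp add: divide_inverse)
    have "\<Phi> i j x - \<Phi> j i x = (x \<bullet> i) *\<^sub>R (W x * D j x) - (x \<bullet> j) *\<^sub>R (W x * D i x)"
      using ij unfolding \<Phi>_def W'_def by (simp add: scaleR_conv_of_real algebra_simps)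
    also have "\<dots> = \<kappa> (x \<bullet> x) *\<^sub>R ((x \<bullet> i) *\<^sub>R (\<rho> / norm x) *\<^sub>R U j (N x) - (x \<bullet> j) *\<^sub>R (\<rho> / norm x) *\<^sub>R U i (N x))"
      unfolding Dl[OF ij(1)] Dl[OF ij(2)] S_def[symmetric] W_def by (simp add: scaleR_conv_of_real algebra_simps)
    also have "\<dots> = \<rho> *\<^sub>R (\<kappa> (x \<bullet> x) *\<^sub>R h (x /\<^sub>R norm x))"
      unfolding h_def Nx by (simp add: scaleR_conv_of_real divide_inverse algebra_simps)
    finally show ?thesis .
  qed
  have "(LINT x|lborel. \<Phi> i j x - \<Phi> j i x) = 0"
    using I ij by simp
  then have "\<rho> *\<^sub>R (LINT x|lborel. \<kappa> (x \<bullet> x) *\<^sub>R h (x /\<^sub>R norm x)) = 0"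
    unfolding eq integral_scaleR_right .
  then show ?thesis using \<rho> by simp
qed

text \<open>A step with one continuous derivative, rational for t > 0. It approaches 1 only in the
  limit, which suffices because its argument is scaled by a parameter tending to infinity.\<close>

definition smooth_step :: "real \<Rightarrow> real" where
  "smooth_step t = (max 0 t)\<^sup>2 / (1 + (max 0 t)\<^sup>2)"

lemma DERIV_max_0_square: "((\<lambda>t. (max 0 t)\<^sup>2) has_real_derivative 2 * max 0 t) (at t)"
proof -
  consider "t < 0" | "t = 0" | "t > 0" by linarith
  then show ?thesis
  proof cases
    case 1
    have "((\<lambda>t. 0) has_real_derivative 2 * max 0 t) (at t)" using 1 by simp
    then show ?thesis
      by (rule has_field_derivative_transform_within_open[of _ _ _ "{..<0}"]) (use 1 in auto)
  next
    case 2
    have "\<forall>\<^sub>F h in at 0. norm ((max 0 h)\<^sup>2 / h) \<le> \<bar>h\<bar>"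
      by (intro always_eventually allI) (auto simp: max_def power2_eq_square)
    moreover have "((\<lambda>h::real. \<bar>h\<bar>) \<longlongrightarrow> 0) (at 0)"
      by (intro tendsto_eq_intros) auto
    ultimately have "((\<lambda>h::real. (max 0 h)\<^sup>2 / h) \<longlongrightarrow> 0) (at 0)"
      by (rule Lim_null_comparison)
    then show ?thesis unfolding DERIV_def 2 by simp
  next
    case 3
    have "((\<lambda>t. t\<^sup>2) has_real_derivative 2 * max 0 t) (at t)"
      using 3 by (auto intro!: derivative_eq_intros)
    then show ?thesis
      by (rule has_field_derivative_transform_within_open[of _ _ _ "{0<..}"]) (use 3 in auto)
  qed
qed

lemma smooth_step_simps:
  "t \<le> 0 \<Longrightarrow> smooth_step t = 0" "0 \<le> smooth_step t" "smooth_step t \<le> 1"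
proof -
  have pos: "0 < 1 + (max 0 t)\<^sup>2"
    by (rule add_pos_nonneg) auto
  show "t \<le> 0 \<Longrightarrow> smooth_step t = 0"
    unfolding smooth_step_def by simp
  show "0 \<le> smooth_step t"
    unfolding smooth_step_def using pos by (intro divide_nonneg_pos) auto
  show "smooth_step t \<le> 1"
    unfolding smooth_step_def divide_le_eq_1_pos[OF pos] by simp
qed

lemma one_plus_max_0_square_neq_0: "1 + (max 0 t)\<^sup>2 \<noteq> (0::real)"
proof -
  have "0 \<le> (max 0 t)\<^sup>2" by simp
  then show ?thesis by linarith
qed

lemma DERIV_smooth_step:
  "(smooth_step has_real_derivative 2 * max 0 t / (1 + (max 0 t)\<^sup>2)\<^sup>2) (at t)"
proof -
  have "((\<lambda>t. (max 0 t)\<^sup>2 / (1 + (max 0 t)\<^sup>2)) has_real_derivative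
     ((2 * max 0 t) * (1 + (max 0 t)\<^sup>2) - (max 0 t)\<^sup>2 * (0 + 2 * max 0 t)) / ((1 + (max 0 t)\<^sup>2) * (1 + (max 0 t)\<^sup>2))) (at t)"
    by (intro DERIV_divide DERIV_add DERIV_const DERIV_max_0_square one_plus_max_0_square_neq_0)
  then show ?thesis
    unfolding smooth_step_def[abs_def] by (simp add: power2_eq_square algebra_simps)
qed

lemma smooth_step_tendsto_1: "(smooth_step \<longlongrightarrow> 1) at_top"
proof -
  have "((\<lambda>t::real. t\<^sup>2 / (1 + t\<^sup>2)) \<longlongrightarrow> 1) at_top" by real_asymp
  moreover have "\<forall>\<^sub>F t in at_top. t\<^sup>2 / (1 + t\<^sup>2) = smooth_step t"
    using eventually_ge_at_top[of 0] by eventually_elim (simp add: smooth_step_def)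
  ultimately show ?thesis by (rule Lim_transform_eventually)
qed

text \<open>With s = |x|^2 and n > 0 this vanishes unless 1/n < s < 1, so it avoids the origin and
  the outside of the unit ball; as n grows it tends to the indicator of 0 < s < 1.\<close>

definition cutoff :: "real \<Rightarrow> real \<Rightarrow> real" where
  "cutoff n s = smooth_step (n * s - 1) * smooth_step (n * (1 - s))"

lemma cutoff_tendsto:
  "(\<lambda>m. cutoff (real (Suc m)) s) \<longlonglongrightarrow> (if 0 < s \<and> s < 1 then 1 else 0)"
proof (cases "0 < s \<and> s < 1")
  case True
  have f: "filterlim (\<lambda>m. real (Suc m) * c + b) at_top sequentially" if "0 < c" for b c :: real
    using that by real_asymp
  have "(\<lambda>m. smooth_step (real (Suc m) * s + (- 1)) * smooth_step (real (Suc m) * (1 - s) + 0)) \<longlonglongrightarrow> 1 * 1"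
    by (intro tendsto_mult filterlim_compose[OF smooth_step_tendsto_1] f) (use True in auto)
  then show ?thesis using True unfolding cutoff_def by simp
next
  case False
  have "cutoff (real (Suc m)) s = 0" for m
  proof (cases "0 < s")
    case True
    then have "real (Suc m) * (1 - s) \<le> 0"
      using False by (intro mult_nonneg_nonpos) auto
    then show ?thesis unfolding cutoff_def by (simp add: smooth_step_simps)
  next
    case False
    then have "real (Suc m) * s \<le> 0"
      by (intro mult_nonneg_nonpos) auto
    then have "real (Suc m) * s - 1 \<le> 0" by linarith
    then show ?thesis unfolding cutoff_def by (simp add: smooth_step_simps)
  qed
  then show ?thesis using False by auto
qed

text \<open>The cone measure integrates over the punctured unit ball, whose indicator is the
  pointwise limit of the radial cutoffs. Every cutoff gives integral 0, and dominated convergence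
  passes to the limit.\<close>

lemma integral_rotation_field_sphere:
  fixes u :: "'a::euclidean_space \<Rightarrow> complex"
  assumes u: "C1_on G u U" and \<rho>: "0 < \<rho>" and sub: "sphere 0 \<rho> \<subseteq> G"
    and ij: "i \<in> Basis" "j \<in> Basis" "i \<noteq> j"
  shows "(LINT \<theta>|sphere_measure. (\<theta> \<bullet> i) *\<^sub>R U j (\<rho> *\<^sub>R \<theta>) - (\<theta> \<bullet> j) *\<^sub>R U i (\<rho> *\<^sub>R \<theta>)) = 0"
proof -
  define h where "h = (\<lambda>\<theta>. (\<theta> \<bullet> i) *\<^sub>R U j (\<rho> *\<^sub>R \<theta>) - (\<theta> \<bullet> j) *\<^sub>R U i (\<rho> *\<^sub>R \<theta>))"
  have cU: "continuous_on (sphere 0 1) (\<lambda>\<theta>. U b (\<rho> *\<^sub>R \<theta>))" if "b \<in> Basis" for b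
    by (rule continuous_on_compose2[OF C1_onD(1)[OF u that]]) (use sub \<rho> in \<open>auto intro!: continuous_intros\<close>)
  have ch: "continuous_on (sphere 0 1) h"
    unfolding h_def by (intro continuous_intros cU ij)
  have "bounded (h ` sphere 0 1)"
    by (intro compact_imp_bounded compact_continuous_image ch compact_sphere)
  then obtain B where "\<forall>y\<in>h ` sphere 0 1. norm y \<le> B"
    unfolding bounded_iff by blast
  then have B: "\<And>\<theta>. norm \<theta> = 1 \<Longrightarrow> norm (h \<theta>) \<le> B" by simp
  define H where "H = (\<lambda>x::'a. h (x /\<^sub>R norm x))"
  have mH: "(\<lambda>x. indicator (- {0}) x *\<^sub>R H x) \<in> borel_measurable borel"
  proof -
    have "continuous_on (- {0}) H"
      unfolding H_def by (rule continuous_on_compose2[OF ch]) (auto intro!: continuous_intros left_inverse)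
    then show ?thesis
      by (intro borel_measurable_continuous_on_indicator) auto
  qed
  define s where "s = (\<lambda>m x::'a. cutoff (real (Suc m)) (x \<bullet> x) *\<^sub>R H x)"
  \<comment> \<open>The cutoff vanishes at the origin, so the value of \<open>H\<close> there, an
    artefact of division by 0, can be suppressed; measurability of \<open>s m\<close>
    follows.\<close>
  have s_eq: "s m x = cutoff (real (Suc m)) (x \<bullet> x) *\<^sub>R (indicator (- {0}) x *\<^sub>R H x)" for m x
    unfolding s_def cutoff_def by (auto simp: indicator_def smooth_step_simps)
  have c_smooth: "continuous_on UNIV smooth_step"
    by (intro continuous_at_imp_continuous_on ballI DERIV_isCont[OF DERIV_smooth_step])
  have I0: "(LINT x|lborel. s m x) = 0" for m
  proof -
    define n where "n = real (Suc m)"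
    have n: "n > 0" unfolding n_def by simp
    define \<sigma> where "\<sigma> = (\<lambda>t::real. 2 * max 0 t / (1 + (max 0 t)\<^sup>2)\<^sup>2)"
    have c\<sigma>: "continuous_on UNIV \<sigma>"
      unfolding \<sigma>_def using one_plus_max_0_square_neq_0 by (intro continuous_intros) auto
    have \<sigma>0: "\<sigma> t = 0" if "t \<le> 0" for t
      using that unfolding \<sigma>_def by (simp add: max_def)
    show ?thesis
      unfolding s_def H_def h_def n_def[symmetric]
    proof (rule integral_rotation_field_cutoff[OF u \<rho> sub ij,
        where \<kappa>' = "\<lambda>s. \<sigma> (n * s - 1) * n * smooth_step (n * (1 - s)) + \<sigma> (n * (1 - s)) * (- n) * smooth_step (n * s - 1)"
          and a = "1 / n"])
      fix s :: real
      have "((\<lambda>s. smooth_step (n * s - 1)) has_real_derivative \<sigma> (n * s - 1) * n) (at s)"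
        unfolding \<sigma>_def by (rule DERIV_chain2[OF DERIV_smooth_step]) (auto intro!: derivative_eq_intros)
      moreover have "((\<lambda>s. smooth_step (n * (1 - s))) has_real_derivative \<sigma> (n * (1 - s)) * (- n)) (at s)"
        unfolding \<sigma>_def by (rule DERIV_chain2[OF DERIV_smooth_step]) (auto intro!: derivative_eq_intros)
      ultimately show "(cutoff n has_real_derivative \<sigma> (n * s - 1) * n * smooth_step (n * (1 - s)) + \<sigma> (n * (1 - s)) * (- n) * smooth_step (n * s - 1)) (at s)"
        unfolding cutoff_def[abs_def] by (rule DERIV_mult)
    next
      show "continuous_on UNIV (\<lambda>s. \<sigma> (n * s - 1) * n * smooth_step (n * (1 - s)) + \<sigma> (n * (1 - s)) * (- n) * smooth_step (n * s - 1))"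
        by (intro continuous_intros continuous_on_compose2[OF c\<sigma>] continuous_on_compose2[OF c_smooth]) auto
    next
      fix s assume "s \<le> 1 / n"
      then have le: "n * s - 1 \<le> 0" using n by (simp add: field_simps)
      show "cutoff n s = 0" "\<sigma> (n * s - 1) * n * smooth_step (n * (1 - s)) + \<sigma> (n * (1 - s)) * (- n) * smooth_step (n * s - 1) = 0"
        unfolding cutoff_def by (simp_all add: \<sigma>0[OF le] smooth_step_simps(1)[OF le])
    next
      fix s :: real assume "1 \<le> s"
      then have "n * (1 - s) \<le> 0" using n by (simp add: mult_nonneg_nonpos)
      then show "cutoff n s = 0" unfolding cutoff_def by (simp add: smooth_step_simps)
    qed (use n in auto)
  qed
  have ms: "s m \<in> borel_measurable lborel" for m
  proof -
    have "continuous_on UNIV (\<lambda>x::'a. cutoff (real (Suc m)) (x \<bullet> x))"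
      unfolding cutoff_def by (intro continuous_intros continuous_on_compose2[OF c_smooth]) auto
    then have "(\<lambda>x::'a. cutoff (real (Suc m)) (x \<bullet> x)) \<in> borel_measurable borel"
      by (rule borel_measurable_continuous_onI)
    then show ?thesis
      using mH unfolding s_eq[abs_def] by (simp del: scaleR_scaleR)
  qed
  define w where "w = (\<lambda>x::'a. B * indicator (cball 0 1) x)"
  define F where "F = (\<lambda>x::'a. indicator (ball 0 1 - {0}) x *\<^sub>R H x)"
  have bound: "norm (s m x) \<le> w x" for m x
  proof (cases "x = 0 \<or> 1 < norm x")
    case True
    have "0 \<le> B" using B[of i] ij order_trans[OF norm_ge_zero] by simp
    moreover have "1 \<le> x \<bullet> x" if "1 < norm x"
      using that one_le_power[of "norm x" 2] by (simp add: dot_square_norm)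
    then have "s m x = 0"
      using True unfolding s_def cutoff_def
      by (auto simp: smooth_step_simps mult_nonneg_nonpos)
    ultimately show ?thesis unfolding w_def by simp
  next
    case False
    have "norm (s m x) = cutoff (real (Suc m)) (x \<bullet> x) * norm (H x)"
      unfolding s_def cutoff_def by (simp add: smooth_step_simps)
    also have "\<dots> \<le> 1 * B"
      unfolding H_def cutoff_def using False
      by (intro mult_mono B mult_le_one smooth_step_simps mult_nonneg_nonneg) auto
    finally show ?thesis using False unfolding w_def by simp
  qed
  have "(\<lambda>m. LINT x|lborel. s m x) \<longlonglongrightarrow> (LINT x|lborel. F x)"
  proof (rule integral_dominated_convergence[where w = w])
    show "F \<in> borel_measurable lborel"
    proof -
      have "F = (\<lambda>x. indicator (ball 0 1) x *\<^sub>R (indicator (- {0}) x *\<^sub>R H x))"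
        unfolding F_def by (auto simp: indicator_def)
      moreover have "(\<lambda>x. indicator (ball 0 1) x *\<^sub>R (indicator (- {0}) x *\<^sub>R H x)) \<in> borel_measurable borel"
        by (intro borel_measurable_scaleR borel_measurable_indicator mH) simp
      ultimately show ?thesis by simp
    qed
    show "integrable lborel w"
      unfolding w_def by (intro integrable_mult_right integrable_real_indicator emeasure_lborel_cball_finite) simp
    have "(\<lambda>m. s m x) \<longlonglongrightarrow> F x" for x
    proof -
      have lim: "(\<lambda>m. s m x) \<longlonglongrightarrow> (if 0 < x \<bullet> x \<and> x \<bullet> x < 1 then 1 else 0) *\<^sub>R H x"
        unfolding s_def by (intro tendsto_scaleR cutoff_tendsto tendsto_const)
      have "x \<bullet> x < 1 \<longleftrightarrow> norm x < 1"
        by (simp add: norm_lt_square)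
      then have "(if 0 < x \<bullet> x \<and> x \<bullet> x < 1 then 1 else 0) *\<^sub>R H x = F x"
        unfolding F_def by (simp add: indicator_def)
      with lim show ?thesis by (simp only:)
    qed
    then show "AE x in lborel. (\<lambda>m. s m x) \<longlonglongrightarrow> F x" by simp
  qed (use ms bound in auto)
  then have "(LINT x|lborel. F x) = 0"
    unfolding I0 by (simp add: LIMSEQ_const_iff)
  then show ?thesis
    unfolding h_def[symmetric] integral_sphere_measure[OF ch] F_def H_def by simp
qed

section \<open>The differential equation for spherical coefficients\<close>

text \<open>With \<open>V i j\<close> the j-th partial derivative of the i-th one, this is r^2
  d^2/dr^2, the second order part of the squared Euler field.\<close>

definition hess_form :: "('a::euclidean_space \<Rightarrow> 'a \<Rightarrow> 'a \<Rightarrow> complex) \<Rightarrow> 'a \<Rightarrow> complex" where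
  "hess_form V x = (\<Sum>i\<in>Basis. \<Sum>j\<in>Basis. ((x \<bullet> i) * (x \<bullet> j)) *\<^sub>R V i j x)"

text \<open>The square of the field x_i d_j - x_j d_i, expanded for distinct \<open>i\<close> and
  \<open>j\<close>.\<close>

definition rot_square :: "('a::euclidean_space \<Rightarrow> 'a \<Rightarrow> complex) \<Rightarrow> ('a \<Rightarrow> 'a \<Rightarrow> 'a \<Rightarrow> complex) \<Rightarrow> 'a \<Rightarrow> 'a \<Rightarrow> 'a \<Rightarrow> complex" where
  "rot_square U V i j x = (x \<bullet> i)\<^sup>2 *\<^sub>R V j j x + (x \<bullet> j)\<^sup>2 *\<^sub>R V i i x
     - (x \<bullet> i) *\<^sub>R U i x - (x \<bullet> j) *\<^sub>R U j x - ((x \<bullet> i) * (x \<bullet> j)) *\<^sub>R (V i j x + V j i x)"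

text \<open>The squared rotation fields add up to the spherical Laplacian, that is |x|^2 times the
  Laplacian minus its radial part. Each coordinate plane is counted twice, once for each order of
  the indices.\<close>

lemma sum_rot_square:
  fixes x :: "'a::euclidean_space"
  shows "(\<Sum>i\<in>Basis. \<Sum>j\<in>Basis - {i}. rot_square U V i j x) =
    2 *\<^sub>R ((x \<bullet> x) *\<^sub>R (\<Sum>i\<in>Basis. V i i x) - hess_form V x - (real DIM('a) - 1) *\<^sub>R euler U x)"
proof -
  \<comment> \<open>On the diagonal the field is 0 but the expanded expression is not. Removing
    these terms from the full double sum adds twice the Euler term and turns the factor d into d -
    1.\<close>
  have diag: "rot_square U V i i x = - 2 *\<^sub>R ((x \<bullet> i) *\<^sub>R U i x)" for i
    unfolding rot_square_def by (simp add: power2_eq_square scaleR_conv_of_real algebra_simps)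
  have sq: "(\<Sum>i\<in>Basis. (x \<bullet> i)\<^sup>2) = x \<bullet> x"
    by (subst (2) euclidean_inner) (simp add: power2_eq_square)
  have a: "(\<Sum>i\<in>Basis. \<Sum>j\<in>Basis. (x \<bullet> i)\<^sup>2 *\<^sub>R V j j x) = (x \<bullet> x) *\<^sub>R (\<Sum>i\<in>Basis. V i i x)"
    unfolding sq[symmetric] scaleR_sum_left by (simp add: scaleR_sum_right)
  have b: "(\<Sum>i\<in>Basis. \<Sum>j\<in>Basis. (x \<bullet> j)\<^sup>2 *\<^sub>R V i i x) = (x \<bullet> x) *\<^sub>R (\<Sum>i\<in>Basis. V i i x)"
    by (subst sum.swap) (rule a)
  have c: "(\<Sum>i\<in>Basis. \<Sum>j\<in>(Basis::'a set). (x \<bullet> i) *\<^sub>R U i x) = real DIM('a) *\<^sub>R euler U x"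
    unfolding euler_def by (simp add: scaleR_conv_of_real sum_distrib_left)
  have d: "(\<Sum>i\<in>(Basis::'a set). \<Sum>j\<in>Basis. (x \<bullet> j) *\<^sub>R U j x) = real DIM('a) *\<^sub>R euler U x"
    by (subst sum.swap) (rule c)
  have e: "(\<Sum>i\<in>Basis. \<Sum>j\<in>Basis. ((x \<bullet> i) * (x \<bullet> j)) *\<^sub>R V j i x) = hess_form V x"
    unfolding hess_form_def by (subst sum.swap) (simp add: mult.commute)
  have "(\<Sum>i\<in>Basis. \<Sum>j\<in>Basis - {i}. rot_square U V i j x)
      = (\<Sum>i\<in>Basis. (\<Sum>j\<in>Basis. rot_square U V i j x) - rot_square U V i i x)"
    by (intro sum.cong refl) (simp add: sum_diff1)
  also have "\<dots> = (\<Sum>i\<in>Basis. \<Sum>j\<in>Basis. rot_square U V i j x) + 2 *\<^sub>R euler U x"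
    unfolding diag sum_subtractf euler_def scaleR_sum_right by (simp add: sum_negf)
  also have "(\<Sum>i\<in>Basis. \<Sum>j\<in>Basis. rot_square U V i j x) =
      2 *\<^sub>R ((x \<bullet> x) *\<^sub>R (\<Sum>i\<in>Basis. V i i x)) - 2 *\<^sub>R (real DIM('a) *\<^sub>R euler U x) - 2 *\<^sub>R hess_form V x"
    unfolding rot_square_def scaleR_add_right sum_subtractf sum.distrib a b c d e
      hess_form_def[symmetric] by (simp only: scaleR_2) simp
  finally show ?thesis
    by (simp add: scaleR_conv_of_real algebra_simps)
qed

lemma continuous_on_euler:
  assumes "\<And>i. i \<in> Basis \<Longrightarrow> continuous_on G (U i)"
  shows "continuous_on G (euler U)"
  unfolding euler_def[abs_def] using assms by (intro continuous_intros) auto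

text \<open>With L the rotation field, (L L u) w - u (L L w) = L((L u) w - u (L w)), and L of
  anything has integral 0 over the sphere. In the proof \<open>z\<close> is this bracket, and
  \<open>M U V l\<close> is the l-th partial derivative of \<open>L U\<close>.\<close>

lemma rot_square_pair_identity:
  fixes u w :: "'a::euclidean_space \<Rightarrow> complex"
  assumes u: "C1_on G u U" "\<And>i. i \<in> Basis \<Longrightarrow> C1_on G (U i) (V i)"
    and w: "C1_on G w W" "\<And>i. i \<in> Basis \<Longrightarrow> C1_on G (W i) (X i)"
    and \<rho>: "0 < \<rho>" "sphere 0 \<rho> \<subseteq> G"
    and ij: "i \<in> Basis" "j \<in> Basis" "i \<noteq> j"
  shows "(LINT \<theta>|sphere_measure. rot_square U V i j (\<rho> *\<^sub>R \<theta>) * w (\<rho> *\<^sub>R \<theta>)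
      - u (\<rho> *\<^sub>R \<theta>) * rot_square W X i j (\<rho> *\<^sub>R \<theta>)) = 0"
proof -
  define L where "L = (\<lambda>(U :: 'a \<Rightarrow> 'a \<Rightarrow> complex) x. (x \<bullet> i) *\<^sub>R U j x - (x \<bullet> j) *\<^sub>R U i x)"
  define M where "M = (\<lambda>(U :: 'a \<Rightarrow> 'a \<Rightarrow> complex) (V :: 'a \<Rightarrow> 'a \<Rightarrow> 'a \<Rightarrow> complex) l x.
      ((if l = i then U j x else 0) + (x \<bullet> i) *\<^sub>R V j l x) - ((if l = j then U i x else 0) + (x \<bullet> j) *\<^sub>R V i l x))"
  have LM: "C1_on G (L U) (M U V)" "C1_on G (L W) (M W X)"
    unfolding L_def M_def by (intro C1_on_diff C1_on_scaleR_coord u(2) w(2) ij)+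
  define z where "z = (\<lambda>x. L U x * w x - u x * L W x)"
  define Z where "Z = (\<lambda>l x. (M U V l x * w x + L U x * W l x) - (U l x * L W x + u x * M W X l x))"
  have z: "C1_on G z Z"
    unfolding z_def Z_def by (intro C1_on_diff C1_on_mult LM u(1) w(1))
  have rot: "(x \<bullet> i) *\<^sub>R M U V j x - (x \<bullet> j) *\<^sub>R M U V i x = rot_square U V i j x" for U V x
    using ij unfolding M_def rot_square_def
    by (simp add: power2_eq_square scaleR_conv_of_real algebra_simps)
  have ZZ: "(x \<bullet> i) *\<^sub>R Z j x - (x \<bullet> j) *\<^sub>R Z i x = rot_square U V i j x * w x - u x * rot_square W X i j x" for x
  proof -
    have "(x \<bullet> i) *\<^sub>R Z j x - (x \<bullet> j) *\<^sub>R Z i x =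
        ((x \<bullet> i) *\<^sub>R M U V j x - (x \<bullet> j) *\<^sub>R M U V i x) * w x + L U x * L W x
        - (L U x * L W x + u x * ((x \<bullet> i) *\<^sub>R M W X j x - (x \<bullet> j) *\<^sub>R M W X i x))"
      unfolding Z_def L_def by (simp add: scaleR_conv_of_real algebra_simps)
    then show ?thesis unfolding rot by simp
  qed
  have "\<rho> *\<^sub>R (LINT \<theta>|sphere_measure. (\<theta> \<bullet> i) *\<^sub>R Z j (\<rho> *\<^sub>R \<theta>) - (\<theta> \<bullet> j) *\<^sub>R Z i (\<rho> *\<^sub>R \<theta>)) = 0"
    using integral_rotation_field_sphere[OF z \<rho> ij] by simp
  then show ?thesis
    unfolding integral_scaleR_right[symmetric] ZZ[symmetric] by (simp add: scaleR_diff_right)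
qed

text \<open>Symmetry of the spherical Laplacian in terms of ambient derivatives, obtained by summing
  the identity for one rotation field over all ordered pairs of axes.\<close>

lemma sphere_laplacian_identity:
  fixes u w :: "'a::euclidean_space \<Rightarrow> complex"
  assumes u: "C1_on G u U" "\<And>i. i \<in> Basis \<Longrightarrow> C1_on G (U i) (V i)"
    and w: "C1_on G w W" "\<And>i. i \<in> Basis \<Longrightarrow> C1_on G (W i) (X i)"
    and \<rho>: "0 < \<rho>" "sphere 0 \<rho> \<subseteq> G"
  defines "A \<equiv> (\<lambda>U V (x::'a). (x \<bullet> x) *\<^sub>R (\<Sum>i\<in>Basis. V i i x) - hess_form V x - (real DIM('a) - 1) *\<^sub>R euler U x)"
  shows "(LINT \<theta>|sphere_measure. A U V (\<rho> *\<^sub>R \<theta>) * w (\<rho> *\<^sub>R \<theta>) - u (\<rho> *\<^sub>R \<theta>) * A W X (\<rho> *\<^sub>R \<theta>)) = 0"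
proof -
  define T where "T = (\<lambda>i j x. rot_square U V i j x * w x - u x * rot_square W X i j x)"
  have cV: "continuous_on G (V i j)" "continuous_on G (X i j)" "continuous_on G (U i)" "continuous_on G (W i)"
    if "i \<in> Basis" "j \<in> Basis" for i j
    using C1_onD(1)[OF u(2)] C1_onD(1)[OF w(2)] C1_onD(1)[OF u(1)] C1_onD(1)[OF w(1)] that by auto
  have cT: "continuous_on G (T i j)" if "i \<in> Basis" "j \<in> Basis" for i j
    unfolding T_def rot_square_def
    using cV[OF that] cV[OF that(2,1)] cV[OF that(1,1)] cV[OF that(2,2)] C1_on_continuous[OF u(1)] C1_on_continuous[OF w(1)]
    by (intro continuous_intros)
  have iT: "integrable sphere_measure (\<lambda>\<theta>. T i j (\<rho> *\<^sub>R \<theta>))" if "i \<in> Basis" "j \<in> Basis" for i j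
    by (intro integrable_sphere_continuous continuous_on_compose2[OF cT[OF that]])
       (use \<rho> in \<open>auto intro!: continuous_intros\<close>)
  have sumT: "(\<Sum>i\<in>Basis. \<Sum>j\<in>Basis - {i}. T i j x) = 2 *\<^sub>R (A U V x * w x - u x * A W X x)" for x
  proof -
    have "(\<Sum>i\<in>Basis. \<Sum>j\<in>Basis - {i}. T i j x) =
       (\<Sum>i\<in>Basis. \<Sum>j\<in>Basis - {i}. rot_square U V i j x) * w x - u x * (\<Sum>i\<in>Basis. \<Sum>j\<in>Basis - {i}. rot_square W X i j x)"
      unfolding T_def sum_subtractf sum_distrib_left sum_distrib_right ..
    then show ?thesis
      unfolding sum_rot_square A_def by (simp add: scaleR_conv_of_real algebra_simps)
  qed
  have "(LINT \<theta>|sphere_measure. (\<Sum>i\<in>Basis. \<Sum>j\<in>Basis - {i}. T i j (\<rho> *\<^sub>R \<theta>)))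
      = (\<Sum>i\<in>Basis. (LINT \<theta>|sphere_measure. (\<Sum>j\<in>Basis - {i}. T i j (\<rho> *\<^sub>R \<theta>))))"
    by (intro Bochner_Integration.integral_sum Bochner_Integration.integrable_sum iT) auto
  also have "\<dots> = (\<Sum>i\<in>Basis. \<Sum>j\<in>Basis - {i}. (LINT \<theta>|sphere_measure. T i j (\<rho> *\<^sub>R \<theta>)))"
    by (intro sum.cong refl Bochner_Integration.integral_sum iT) auto
  also have "\<dots> = 0"
    by (intro sum.neutral ballI)
       (use rot_square_pair_identity[OF u w \<rho>] in \<open>auto simp: T_def\<close>)
  finally have "2 *\<^sub>R (LINT \<theta>|sphere_measure. A U V (\<rho> *\<^sub>R \<theta>) * w (\<rho> *\<^sub>R \<theta>) - u (\<rho> *\<^sub>R \<theta>) * A W X (\<rho> *\<^sub>R \<theta>)) = 0"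
    unfolding sumT integral_scaleR_right .
  then show ?thesis by simp
qed

text \<open>Differentiating \<open>euler W\<close> = k w in direction j and comparing the two
  gradients gives sum_i x_i X_ij = (k - 1) W_j; contracting with x_j applies Euler's identity a
  second time.\<close>

lemma hess_form_homogeneous:
  assumes w: "C1_on UNIV w W" "\<And>i. i \<in> Basis \<Longrightarrow> C1_on UNIV (W i) (X i)"
    and euler: "\<And>x. euler W x = of_nat k * w x"
  shows "hess_form X x = (of_nat k - 1) * of_nat k * w x"
proof -
  have 1: "C1_on UNIV (euler W) (\<lambda>j x. W j x + (\<Sum>i\<in>Basis. (x \<bullet> i) *\<^sub>R X i j x))"
    by (rule C1_on_euler) (rule w(2))
  have 2: "C1_on UNIV (euler W) (\<lambda>j x. of_nat k * W j x)"
    unfolding euler by (rule C1_on_cmult[OF w(1)])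
  have eq: "(\<Sum>i\<in>Basis. (x \<bullet> i) *\<^sub>R X i j x) = (of_nat k - 1) * W j x" if "j \<in> Basis" for j
    using C1_on_pdiff(1)[OF 1 UNIV_I that, of x] C1_on_pdiff(1)[OF 2 UNIV_I that, of x]
    by (simp add: algebra_simps)
  have "hess_form X x = (\<Sum>j\<in>Basis. (x \<bullet> j) *\<^sub>R (\<Sum>i\<in>Basis. (x \<bullet> i) *\<^sub>R X i j x))"
    unfolding hess_form_def by (subst sum.swap) (simp add: scaleR_sum_right mult.commute)
  also have "\<dots> = (of_nat k - 1) * euler W x"
    unfolding euler_def sum_distrib_left using eq by (intro sum.cong refl) simp
  finally show ?thesis unfolding euler by simp
qed

lemma harmonic_hom_poly_cnj:
  assumes "harmonic_hom_poly k Y"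
  obtains W X where "C1_on UNIV (\<lambda>x. cnj (Y x)) W" "\<And>i. i \<in> Basis \<Longrightarrow> C1_on UNIV (W i) (X i)"
    "\<And>x. (\<Sum>i\<in>Basis. X i i x) = 0" "\<And>x. euler W x = of_nat k * cnj (Y x)"
proof -
  have hom: "hom_poly k Y" and lap: "\<And>x. laplacian Y x = 0"
    using assms unfolding harmonic_hom_poly_def by auto
  obtain U where U: "\<And>i. cpoly (U i)" "C1_on UNIV Y U"
    using cpoly_C1[OF hom_poly_imp_cpoly[OF hom]] by blast
  have "\<forall>i. \<exists>V. C1_on UNIV (U i) V"
    using cpoly_C1[OF U(1)] by blast
  then obtain V where V: "\<And>i. C1_on UNIV (U i) (V i)" by metis
  have pd: "pdiff i Y = U i" if "i \<in> Basis" for i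
    by (rule ext) (rule C1_on_pdiff(1)[OF U(2) UNIV_I that])
  have "(\<Sum>i\<in>Basis. V i i x) = laplacian Y x" for x
    unfolding laplacian_def by (intro sum.cong refl) (simp add: pd C1_on_pdiff(1)[OF V UNIV_I])
  then have V0: "(\<Sum>i\<in>Basis. V i i x) = 0" for x using lap by simp
  show ?thesis
  proof
    show C: "C1_on UNIV (\<lambda>x. cnj (Y x)) (\<lambda>i x. cnj (U i x))" by (rule C1_on_cnj[OF U(2)])
    show "C1_on UNIV (\<lambda>x. cnj (U i x)) (\<lambda>j x. cnj (V i j x))" for i by (rule C1_on_cnj[OF V])
    show "(\<Sum>i\<in>Basis. cnj (V i i x)) = 0" for x
      using V0[of x] by (metis cnj_sum complex_cnj_zero)
    show "euler (\<lambda>i x. cnj (U i x)) x = of_nat k * cnj (Y x)" for x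
      by (rule euler_homogeneous[OF C]) (simp add: hom_poly_scaleR[OF hom])
  qed
qed

lemma has_vector_derivative_radial:
  fixes u :: "'a::euclidean_space \<Rightarrow> complex"
  assumes u: "C1_on G u U" and S: "open S" "v0 \<in> S" and sub: "\<And>v. v \<in> S \<Longrightarrow> sphere 0 (exp v) \<subseteq> G"
    and w: "continuous_on (sphere 0 1) w"
  shows "((\<lambda>v. LINT \<theta>|sphere_measure. u (exp v *\<^sub>R \<theta>) * w \<theta>) has_vector_derivative
      (LINT \<theta>|sphere_measure. euler U (exp v0 *\<^sub>R \<theta>) * w \<theta>)) (at v0)"
proof -
  obtain e where e: "e > 0" "cball v0 e \<subseteq> S"
    using S open_contains_cball by blast
  have inG: "exp v *\<^sub>R \<theta> \<in> G" if "v \<in> {v0-e..v0+e}" "\<theta> \<in> sphere 0 1" for v \<theta>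
  proof -
    have "v \<in> S" using that e by (auto simp: cball_eq_atLeastAtMost subset_iff)
    then show ?thesis using sub[of v] that by (auto simp: subset_iff)
  qed
  show ?thesis
  proof (rule has_vector_derivative_integral_sphere[OF e(1),
      where g = "\<lambda>v \<theta>. u (exp v *\<^sub>R \<theta>) * w \<theta>" and g' = "\<lambda>v \<theta>. euler U (exp v *\<^sub>R \<theta>) * w \<theta>"])
    fix v \<theta> assume v: "v \<in> {v0-e..v0+e}"
    show "continuous_on (sphere 0 1) (\<lambda>\<theta>. u (exp v *\<^sub>R \<theta>) * w \<theta>)"
      by (intro continuous_intros w continuous_on_compose2[OF C1_on_continuous[OF u]]) (use inG v in auto)
    assume \<theta>: "\<theta> \<in> sphere (0::'a) 1"
    show "((\<lambda>v. u (exp v *\<^sub>R \<theta>) * w \<theta>) has_vector_derivative euler U (exp v *\<^sub>R \<theta>) * w \<theta>) (at v)"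
      by (rule has_vector_derivative_mult_left[OF has_vector_derivative_ray[OF u inG[OF v \<theta>]]])
  next
    have ce: "continuous_on G (euler U)"
      by (rule continuous_on_euler) (rule C1_onD(1)[OF u])
    have "continuous_on ({v0-e..v0+e} \<times> sphere 0 1) (\<lambda>p. euler U (exp (fst p) *\<^sub>R snd p) * w (snd p))"
    proof (intro continuous_on_mult)
      show "continuous_on ({v0-e..v0+e} \<times> sphere 0 1) (\<lambda>p. euler U (exp (fst p) *\<^sub>R snd p))"
        by (rule continuous_on_compose2[OF ce]) (use inG in \<open>auto intro!: continuous_intros\<close>)
      show "continuous_on ({v0-e..v0+e} \<times> sphere 0 1) (\<lambda>p. w (snd p))"
        by (rule continuous_on_compose2[OF w]) (auto intro!: continuous_intros)
    qed
    then show "continuous_on ({v0-e..v0+e} \<times> sphere 0 1) (\<lambda>(v, \<theta>). euler U (exp v *\<^sub>R \<theta>) * w \<theta>)"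
      by (simp add: case_prod_unfold)
  qed
qed

text \<open>The symmetry is tested against the conjugate of \<open>Y\<close>, on which the spherical
  Laplacian acts as -k(k + d - 2). The second claim is the resulting equation solved for the second
  v-derivative of the coefficient.\<close>

lemma radial_coeff_ode:
  fixes u :: "'a::euclidean_space \<Rightarrow> complex"
  assumes d2: "DIM('a) \<ge> 2" and Y: "harmonic_hom_poly k Y"
    and u: "C1_on G u U" "\<And>i. i \<in> Basis \<Longrightarrow> C1_on G (U i) (V i)"
    and lap: "\<And>x. x \<in> G \<Longrightarrow> (\<Sum>i\<in>Basis. V i i x) = Lu x"
    and S: "open S" "v \<in> S" and sub: "\<And>v. v \<in> S \<Longrightarrow> sphere 0 (exp v) \<subseteq> G"
  defines "F \<equiv> (\<lambda>u v. radial_coeff u Y (exp v))"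
  shows "(F u has_vector_derivative F (euler U) v) (at v)"
    and "(F (euler U) has_vector_derivative - of_nat (DIM('a) - 2) * F (euler U) v
      + of_nat (k * (k + DIM('a) - 2)) * F u v + of_real (exp (2 * v)) * F Lu v) (at v)"
proof -
  define d where "d = DIM('a)"
  have d: "d \<ge> 2" using d2 unfolding d_def .
  obtain W X where W: "C1_on UNIV (\<lambda>x. cnj (Y x)) W" "\<And>i. i \<in> Basis \<Longrightarrow> C1_on UNIV (W i) (X i)"
    "\<And>x. (\<Sum>i\<in>Basis. X i i x) = 0" "\<And>x. euler W x = of_nat k * cnj (Y x)"
    by (rule harmonic_hom_poly_cnj[OF Y]) blast
  have cw: "continuous_on (sphere 0 1) (\<lambda>x. cnj (Y x))"
    by (rule continuous_on_subset[OF C1_on_continuous[OF W(1)]]) simp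
  note rad = has_vector_derivative_radial[OF _ S sub cw]
  show "(F u has_vector_derivative F (euler U) v) (at v)"
    unfolding F_def radial_coeff_def by (rule rad[OF u(1)])
  define E2 where "E2 = (\<lambda>j x. U j x + (\<Sum>i\<in>Basis. (x \<bullet> i) *\<^sub>R V i j x))"
  have C1E: "C1_on G (euler U) E2"
    unfolding E2_def by (rule C1_on_euler) (rule u(2))
  have dE: "(F (euler U) has_vector_derivative F (euler E2) v) (at v)"
    unfolding F_def radial_coeff_def by (rule rad[OF C1E])
  \<comment> \<open>The squared Euler field is the Hessian form plus the Euler field. Trading the
    Hessian form for it lowers the coefficient d - 1 of the Euler term to d - 2.\<close>
  have E2: "euler E2 x = euler U x + hess_form V x" for x
  proof -
    have "hess_form V x = (\<Sum>j\<in>Basis. (x \<bullet> j) *\<^sub>R (\<Sum>i\<in>Basis. (x \<bullet> i) *\<^sub>R V i j x))"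
      unfolding hess_form_def by (subst sum.swap) (simp add: scaleR_sum_right mult.commute)
    then show ?thesis
      unfolding euler_def E2_def by (simp add: scaleR_add_right sum.distrib)
  qed
  have hom: "cnj (Y (exp v *\<^sub>R \<theta>)) = of_real (exp v) ^ k * cnj (Y \<theta>)" for \<theta>
    using Y hom_poly_scaleR[of k Y "exp v" \<theta>] unfolding harmonic_hom_poly_def by simp
  have subv: "sphere 0 (exp v) \<subseteq> G" by (rule sub[OF S(2)])
  have iF: "integrable sphere_measure (\<lambda>\<theta>. g (exp v *\<^sub>R \<theta>) * cnj (Y \<theta>))" if "continuous_on G g" for g
    by (intro integrable_sphere_continuous continuous_intros cw continuous_on_compose2[OF that])
       (use subv in auto)
  have cU: "continuous_on G (U i)" if "i \<in> Basis" for i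
    by (rule C1_onD(1)[OF u(1) that])
  have cLu: "continuous_on G Lu"
  proof -
    have "continuous_on G (\<lambda>x. \<Sum>i\<in>Basis. V i i x)"
      by (intro continuous_intros C1_onD(1)[OF u(2)])
    then show ?thesis using lap by (simp cong: continuous_on_cong)
  qed
  define c :: complex where "c = of_nat (k * (k + d - 2))"
  \<comment> \<open>Harmonicity removes the trace and homogeneity evaluates the rest, with (k - 1) k
    + (d - 1) k = k (k + d - 2).\<close>
  have Wc: "(exp v *\<^sub>R \<theta> \<bullet> exp v *\<^sub>R \<theta>) *\<^sub>R (\<Sum>i\<in>Basis. X i i (exp v *\<^sub>R \<theta>)) - hess_form X (exp v *\<^sub>R \<theta>)
      - (real d - 1) *\<^sub>R euler W (exp v *\<^sub>R \<theta>) = - c * (of_real (exp v) ^ k * cnj (Y \<theta>))" for \<theta>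
  proof -
    have "(of_nat k - 1) * of_nat k + (of_nat d - 1) * of_nat k = c"
    proof -
      have "(of_nat (k + d - 2) :: complex) = of_nat k + of_nat d - 2"
        using d by (simp add: of_nat_diff)
      then show ?thesis unfolding c_def of_nat_mult by (simp only:) (simp add: algebra_simps)
    qed
    then have "0 - (of_nat k - 1) * of_nat k * z - (of_nat d - 1) * (of_nat k * z) = - c * z" for z
      by (simp only: minus_mult_left[symmetric] flip: \<open>_ = c\<close>) (simp add: algebra_simps)
    moreover have "hess_form X x = (of_nat k - 1) * of_nat k * cnj (Y x)" for x
      by (rule hess_form_homogeneous[OF W(1) W(2) W(4)])
    ultimately show ?thesis
      unfolding W(3) W(4) hom
      by (simp only: hom scaleR_conv_of_real of_real_diff of_real_of_nat_eq of_real_1 mult_zero_right)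
  qed
  have "0 = (LINT \<theta>|sphere_measure. ((exp v *\<^sub>R \<theta> \<bullet> exp v *\<^sub>R \<theta>) *\<^sub>R (\<Sum>i\<in>Basis. V i i (exp v *\<^sub>R \<theta>)) - hess_form V (exp v *\<^sub>R \<theta>)
      - (real d - 1) *\<^sub>R euler U (exp v *\<^sub>R \<theta>)) * cnj (Y (exp v *\<^sub>R \<theta>)) - u (exp v *\<^sub>R \<theta>) * (- c * (of_real (exp v) ^ k * cnj (Y \<theta>))))"
    using sphere_laplacian_identity[OF u C1_on_subset[OF W(1)] C1_on_subset[OF W(2)] exp_gt_zero subv]
    unfolding d_def[symmetric] Wc by simp
  also have "\<dots> = (LINT \<theta>|sphere_measure. of_real (exp v) ^ k * (of_real (exp (2 * v)) * (Lu (exp v *\<^sub>R \<theta>) * cnj (Y \<theta>))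
      - euler E2 (exp v *\<^sub>R \<theta>) * cnj (Y \<theta>) - of_nat (d - 2) * (euler U (exp v *\<^sub>R \<theta>) * cnj (Y \<theta>)) + c * (u (exp v *\<^sub>R \<theta>) * cnj (Y \<theta>))))"
  proof (intro Bochner_Integration.integral_cong refl)
    fix \<theta> :: 'a assume "\<theta> \<in> space sphere_measure"
    then have \<theta>: "norm \<theta> = 1" by simp
    have "exp v *\<^sub>R \<theta> \<in> G" using subv \<theta> by (auto simp: subset_iff)
    then have L: "(\<Sum>i\<in>Basis. V i i (exp v *\<^sub>R \<theta>)) = Lu (exp v *\<^sub>R \<theta>)" by (rule lap)
    have n: "exp v *\<^sub>R \<theta> \<bullet> exp v *\<^sub>R \<theta> = exp (2 * v)"
      using \<theta> by (simp add: dot_square_norm power2_eq_square flip: exp_add)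
    have dd: "(of_nat (d - 2) :: complex) = of_nat d - 2" using d by (simp add: of_nat_diff)
    show "((exp v *\<^sub>R \<theta> \<bullet> exp v *\<^sub>R \<theta>) *\<^sub>R (\<Sum>i\<in>Basis. V i i (exp v *\<^sub>R \<theta>)) - hess_form V (exp v *\<^sub>R \<theta>)
      - (real d - 1) *\<^sub>R euler U (exp v *\<^sub>R \<theta>)) * cnj (Y (exp v *\<^sub>R \<theta>)) - u (exp v *\<^sub>R \<theta>) * (- c * (of_real (exp v) ^ k * cnj (Y \<theta>)))
      = of_real (exp v) ^ k * (of_real (exp (2 * v)) * (Lu (exp v *\<^sub>R \<theta>) * cnj (Y \<theta>))
      - euler E2 (exp v *\<^sub>R \<theta>) * cnj (Y \<theta>) - of_nat (d - 2) * (euler U (exp v *\<^sub>R \<theta>) * cnj (Y \<theta>)) + c * (u (exp v *\<^sub>R \<theta>) * cnj (Y \<theta>)))"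
      unfolding L n hom E2 dd by (simp only: scaleR_conv_of_real) (simp add: algebra_simps)
  qed
  also have "\<dots> = of_real (exp v) ^ k * (of_real (exp (2 * v)) * F Lu v
      - F (euler E2) v - of_nat (d - 2) * F (euler U) v + c * F u v)"
  proof -
    have i: "integrable sphere_measure (\<lambda>\<theta>. Lu (exp v *\<^sub>R \<theta>) * cnj (Y \<theta>))"
      "integrable sphere_measure (\<lambda>\<theta>. euler E2 (exp v *\<^sub>R \<theta>) * cnj (Y \<theta>))"
      "integrable sphere_measure (\<lambda>\<theta>. euler U (exp v *\<^sub>R \<theta>) * cnj (Y \<theta>))"
      "integrable sphere_measure (\<lambda>\<theta>. u (exp v *\<^sub>R \<theta>) * cnj (Y \<theta>))"
      by (intro iF cLu continuous_on_euler C1_onD(1)[OF C1E] cU C1_on_continuous[OF u(1)]; assumption)+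
    show ?thesis
      unfolding F_def radial_coeff_def
      by (subst integral_mult_right_zero)
         (simp only: integral_mult_right_zero Bochner_Integration.integral_add Bochner_Integration.integral_diff
            i integrable_mult_right Bochner_Integration.integrable_add Bochner_Integration.integrable_diff)
  qed
  finally have "of_real (exp (2 * v)) * F Lu v - F (euler E2) v - of_nat (d - 2) * F (euler U) v + c * F u v = 0"
    by simp
  then have "F (euler E2) v = - of_nat (d - 2) * F (euler U) v + c * F u v + of_real (exp (2 * v)) * F Lu v"
    by (simp add: algebra_simps)
  with dE show "(F (euler U) has_vector_derivative - of_nat (DIM('a) - 2) * F (euler U) v
      + of_nat (k * (k + DIM('a) - 2)) * F u v + of_real (exp (2 * v)) * F Lu v) (at v)"
    unfolding c_def d_def by (simp only:)
qed

section \<open>Annuli in logarithmic coordinates and the radial data of a polyharmonic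
  function\<close>

lemma open_annulus: "open (annulus r0 r1 :: 'a::euclidean_space set)"
  unfolding annulus_def
  by (intro open_Collect_conj open_Collect_less continuous_intros)

text \<open>Phrased through \<open>exp\<close>, so that the cases of inner radius 0 and infinite
  outer radius require no convention for the logarithm.\<close>

definition log_interval :: "real \<Rightarrow> ereal \<Rightarrow> real set" where
  "log_interval r0 r1 = {v. r0 < exp v \<and> ereal (exp v) < r1}"

lemma open_log_interval: "open (log_interval r0 r1)"
  unfolding log_interval_def
  by (intro open_Collect_conj open_Collect_less continuous_intros)

lemma log_interval_atLeastAtMost_subset:
  assumes "a \<in> log_interval r0 r1" "b \<in> log_interval r0 r1"
  shows "{a..b} \<subseteq> log_interval r0 r1"
proof
  fix v assume v: "v \<in> {a..b}"
  have "r0 < exp a" "ereal (exp b) < r1"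
    using assms unfolding log_interval_def by auto
  moreover have "exp a \<le> exp v" "ereal (exp v) \<le> ereal (exp b)" using v by auto
  ultimately have "r0 < exp v" "ereal (exp v) < r1"
    by (metis less_le_trans, metis le_less_trans)
  then show "v \<in> log_interval r0 r1"
    unfolding log_interval_def by simp
qed

lemma sphere_subset_annulus:
  assumes "v \<in> log_interval r0 r1"
  shows "sphere 0 (exp v) \<subseteq> annulus r0 r1"
  using assms unfolding log_interval_def annulus_def by auto

lemma norm_radial_coeff_le:
  fixes g Y :: "'a::euclidean_space \<Rightarrow> complex"
  assumes g: "continuous_on (sphere 0 r) g" and Y: "continuous_on (sphere 0 1) Y" and r: "0 < r"
    and M: "\<And>x. norm x = r \<Longrightarrow> norm (g x) \<le> M"
  shows "norm (radial_coeff g Y r) \<le> M * (LINT \<theta>|sphere_measure. norm (Y \<theta>))"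
proof -
  have "integrable sphere_measure (\<lambda>\<theta>. g (r *\<^sub>R \<theta>) * cnj (Y \<theta>))"
    by (intro integrable_sphere_continuous continuous_intros Y continuous_on_compose2[OF g])
       (use r in auto)
  moreover have "integrable sphere_measure (\<lambda>\<theta>. M * norm (Y \<theta>))"
    by (intro integrable_mult_right integrable_norm integrable_sphere_continuous Y)
  ultimately have "norm (radial_coeff g Y r) \<le> (LINT \<theta>|sphere_measure. M * norm (Y \<theta>))"
    unfolding radial_coeff_def
    by (rule Bochner_Integration.integral_norm_bound_integral)
       (use M r in \<open>auto simp: norm_mult intro!: mult_right_mono\<close>)
  then show ?thesis by simp
qed

text \<open>Collects what the final argument takes from \<open>f\<close>: the first order recursion,
  the identification with D^(n), and the growth. The bound on [a, b] presupposes room up to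
  \<open>c\<close>; the ratio has to involve e^b itself, and only the constant may depend on
  \<open>c\<close>.\<close>

lemma polyharmonic_radial_data:
  fixes f Y :: "'a::euclidean_space \<Rightarrow> complex"
  assumes d2: "DIM('a) \<ge> 2" and tau: "\<tau> \<ge> 0"
    and poly: "polyharmonic_inf_order_type (annulus r0 r1) \<tau> f"
    and Y: "harmonic_hom_poly k Y"
  defines "S \<equiv> log_interval r0 r1" and "ft \<equiv> (\<lambda>v. radial_coeff f Y (exp v))"
  obtains Q where "Q 0 = ft"
    and "\<And>n v. v \<in> S \<Longrightarrow> (Q n has_vector_derivative of_int (lam DIM('a) k n) * Q n v + Q (Suc n) v) (at v)"
    and "\<And>n v. v \<in> S \<Longrightarrow> Dn DIM('a) k n ft v = Q n v"
    and "\<And>a b c \<epsilon>. a \<le> b \<Longrightarrow> b < c \<Longrightarrow> {a..c} \<subseteq> S \<Longrightarrow> 0 < \<epsilon> \<Longrightarrow>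
      \<exists>C\<ge>0. \<forall>n. \<forall>s\<in>{a..b}. norm (Q n s) \<le> C * fact (n + 1) * (exp b * (\<tau> + \<epsilon>)) ^ n"
proof -
  let ?G = "annulus r0 r1 :: 'a set"
  have sm: "smooth_on ?G f"
    using poly unfolding polyharmonic_inf_order_type_def by blast
  define L where "L = (\<lambda>p. (laplacian ^^ p) f)"
  have smL: "smooth_on ?G (L p)" for p
    unfolding L_def by (rule smooth_on_laplacian_power[OF open_annulus sm])
  define U where "U = (\<lambda>p i. iter_pdiff [i] (L p))"
  define F where "F = (\<lambda>p v. radial_coeff (L p) Y (exp v))"
  define E where "E = (\<lambda>p v. radial_coeff (euler (U p)) Y (exp v))"
  have subS: "sphere 0 (exp v) \<subseteq> ?G" if "v \<in> S" for v
    using sphere_subset_annulus that unfolding S_def by blast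
  have oS: "open S" unfolding S_def by (rule open_log_interval)
  have cY: "continuous_on (sphere 0 1) Y"
  proof -
    obtain P where "C1_on UNIV Y P"
      using cpoly_C1[OF hom_poly_imp_cpoly] Y unfolding harmonic_hom_poly_def by blast
    then show ?thesis
      using C1_on_continuous continuous_on_subset by blast
  qed
  have C1L: "C1_on ?G (L p) (U p)" for p
    using smooth_on_C1[OF open_annulus smL, of "[]"] unfolding U_def by simp
  have C1U: "C1_on ?G (U p i) (\<lambda>j. iter_pdiff [j, i] (L p))" if "i \<in> Basis" for p i
    using smooth_on_C1[OF open_annulus smL, of "[i]"] that unfolding U_def by simp
  have lapL: "(\<Sum>i\<in>Basis. iter_pdiff [i, i] (L p) x) = L (Suc p) x" for p x
    unfolding L_def by (simp add: laplacian_def)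
  have dF: "(F p has_vector_derivative E p v) (at v)"
    and dE: "(E p has_vector_derivative - of_nat (DIM('a) - 2) * E p v
      + of_nat (k * (k + DIM('a) - 2)) * F p v + of_real (exp (2 * v)) * F (Suc p) v) (at v)"
    if v: "v \<in> S" for p v
    using radial_coeff_ode[OF d2 Y C1L C1U lapL oS v subS, of p] unfolding F_def E_def by auto
  define Q where "Q = radial_Dn k F E"
  have Q0: "Q 0 = ft"
    unfolding Q_def radial_Dn_def ft_def F_def L_def by simp
  have dQ: "(Q n has_vector_derivative of_int (lam DIM('a) k n) * Q n v + Q (Suc n) v) (at v)" if "v \<in> S" for n v
    unfolding Q_def
    by (rule has_vector_derivative_radial_Dn[where F = F and E = E, OF d2 dF[OF that] dE[OF that]])
  have DnQ: "Dn DIM('a) k n ft v = Q n v" if "v \<in> S" for n v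
    using Dn_eqI[of S Q "DIM('a)" k v n, OF oS dQ that] unfolding Q0 .
  have bound: "\<exists>C\<ge>0. \<forall>n. \<forall>s\<in>{a..b}. norm (Q n s) \<le> C * fact (n + 1) * (exp b * (\<tau> + \<epsilon>)) ^ n"
    if ab: "a \<le> b" "b < c" "{a..c} \<subseteq> S" "0 < \<epsilon>" for a b c \<epsilon>
  proof -
    \<comment> \<open>The growth condition is applied on a closed shell reaching to e^c, so that it
      also covers the room needed for the odd orders.\<close>
    define K where "K = {x :: 'a. exp a \<le> norm x \<and> norm x \<le> exp c}"
    have "K = cball 0 (exp c) - ball 0 (exp a)"
      unfolding K_def by auto
    then have "compact K"
      by (simp add: compact_diff)
    moreover have "K \<subseteq> ?G"
    proof
      fix x assume x: "x \<in> K"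
      have "norm x > 0" using x exp_gt_zero[of a] unfolding K_def by auto
      then have "exp (ln (norm x)) = norm x" by simp
      moreover have "ln (norm x) \<in> {a..c}"
        using x \<open>exp (ln (norm x)) = norm x\<close> unfolding K_def by (metis (mono_tags) atLeastAtMost_iff exp_le_cancel_iff mem_Collect_eq)
      ultimately show "x \<in> ?G"
        using subS[of "ln (norm x)"] ab(3) by (auto simp: subset_iff)
    qed
    ultimately obtain C where C: "C > 0"
      "\<And>p x. x \<in> K \<Longrightarrow> norm (L p x) \<le> C * fact (2 * p) * (\<tau> + \<epsilon>) ^ (2 * p)"
      using poly ab(4) unfolding polyharmonic_inf_order_type_def L_def by meson
    define A where "A = (LINT \<theta>|sphere_measure. norm (Y \<theta>))"
    have A: "A \<ge> 0" unfolding A_def by simp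
    have "norm (F p t) \<le> (C * A) * fact (2 * p) * (\<tau> + \<epsilon>) ^ (2 * p)" if t: "t \<in> {a..b + (c - b)}" for p t
    proof -
      have "t \<in> S" using t ab by auto
      have "norm (F p t) \<le> (C * fact (2 * p) * (\<tau> + \<epsilon>) ^ (2 * p)) * A"
        unfolding F_def A_def
      proof (rule norm_radial_coeff_le)
        show "continuous_on (sphere 0 (exp t)) (L p)"
          by (rule continuous_on_subset[OF C1_on_continuous[OF C1L] subS[OF \<open>t \<in> S\<close>]])
        show "norm (L p x) \<le> C * fact (2 * p) * (\<tau> + \<epsilon>) ^ (2 * p)" if "norm x = exp t" for x
          by (rule C(2)) (use that t in \<open>auto simp: K_def\<close>)
      qed (use cY in auto)
      then show ?thesis by (simp only: mult_ac)
    qed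
    then show ?thesis
      unfolding Q_def
      by (intro radial_Dn_bound[where \<delta> = "c - b" and C = "C * A" and d = "DIM('a)"])
         (use d2 tau ab A C(1) dF dE in \<open>auto simp del: of_nat_mult of_nat_diff\<close>)
  qed
  show ?thesis by (rule that[OF Q0 dQ DnQ bound])
qed

section \<open>Convergence on the disc, the sum of the series and its analytic extension\<close>

lemma uniform_limit_shift:
  assumes "uniform_limit A f l F" "\<And>z. z \<in> K \<Longrightarrow> z - c \<in> A"
  shows "uniform_limit K (\<lambda>n z. f n (z - c)) (\<lambda>z. l (z - c)) F"
  unfolding uniform_limit_iff
proof (intro allI impI)
  fix e :: real assume "e > 0"
  with assms(1) have "\<forall>\<^sub>F n in F. \<forall>x\<in>A. dist (f n x) (l x) < e"
    unfolding uniform_limit_iff by blast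
  then show "\<forall>\<^sub>F n in F. \<forall>z\<in>K. dist (f n (z - c)) (l (z - c)) < e"
    by eventually_elim (use assms(2) in blast)
qed

text \<open>The growth condition provides only tau + eps in place of tau, and a strict inequality
  survives a small increase. The 1 added in the denominator of the witness covers the case A B =
  0.\<close>

lemma exists_pos_add_mult_less_1:
  fixes A B \<tau> :: real
  assumes "0 \<le> A" "0 \<le> B" "A * \<tau> * B < 1"
  shows "\<exists>\<epsilon>>0. A * (\<tau> + \<epsilon>) * B < 1"
proof (intro exI conjI)
  have "0 < (1 - A * \<tau> * B) / (A * B + 1)" using assms by (intro divide_pos_pos add_nonneg_pos mult_nonneg_nonneg) auto
  moreover have "(1 - A * \<tau> * B) * (A * B / (A * B + 1)) < 1 - A * \<tau> * B"
    using assms by (intro mult_less_cancel_left2[THEN iffD2]) (auto simp: add_nonneg_pos mult_nonneg_nonneg)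
  ultimately show "0 < (1 - A * \<tau> * B) / (A * B + 1)"
    and "A * (\<tau> + (1 - A * \<tau> * B) / (A * B + 1)) * B < 1"
    by (auto simp: algebra_simps)
qed

theorem mainTheorem12:
  fixes f :: "'a::euclidean_space \<Rightarrow> complex"
    and r0 :: real and r1 :: ereal and \<tau> :: real
    and k a l :: nat and Y :: "nat \<Rightarrow> 'a \<Rightarrow> complex" and v0 :: real
  assumes d2: "DIM('a) \<ge> 2"
    and r0: "0 \<le> r0" and r01: "ereal r0 < r1"
    and tau: "\<tau> \<ge> 0"
    and poly: "polyharmonic_inf_order_type (annulus r0 r1) \<tau> f"
    and Y: "sph_harm_onb k a Y" and l: "l \<in> {1..a}"
    and v0: "r0 < exp v0" "ereal (exp v0) < r1"
  defines "ft \<equiv> (\<lambda>v::real. radial_coeff f (Y l) (exp v))"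
    and "Disc \<equiv> (if \<tau> = 0 then (UNIV :: complex set)
                 else ball (of_real v0) (ln (1 + 1 / (exp v0 * \<tau>))))"
  shows "(\<forall>K. compact K \<and> K \<subseteq> Disc \<longrightarrow>
            uniformly_convergent_on K
              (\<lambda>N z. \<Sum>n<N. Dn DIM('a) k n ft v0 * Phi DIM('a) k n (z - of_real v0)) \<and>
            uniformly_convergent_on K
              (\<lambda>N z. \<Sum>n<N. norm (Dn DIM('a) k n ft v0 * Phi DIM('a) k n (z - of_real v0)))) \<and>
         (\<lambda>z. \<Sum>n. Dn DIM('a) k n ft v0 * Phi DIM('a) k n (z - of_real v0)) holomorphic_on Disc \<and>
         (\<exists>\<delta>>0. (\<forall>v\<in>{v0..v0+\<delta>}. r0 < exp v \<and> ereal (exp v) < r1 \<and>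
                   (\<Sum>n. Dn DIM('a) k n ft v0 * Phi DIM('a) k n (of_real v - of_real v0)) = ft v)) \<and>
         (\<tau> = 0 \<longrightarrow>
            (\<exists>F. F holomorphic_on UNIV \<and>
                 (\<forall>v. r0 < exp v \<and> ereal (exp v) < r1 \<longrightarrow> F (of_real v) = ft v)) \<and>
            (\<exists>G. G holomorphic_on (- {z. Im z = 0 \<and> Re z \<le> 0}) \<and>
                 (\<forall>r. r0 < r \<and> ereal r < r1 \<longrightarrow> G (of_real r) = radial_coeff f (Y l) r)))"
proof -
  define d where "d = DIM('a)"
  have d1: "d \<ge> 1" using d2 unfolding d_def by simp
  define S where "S = log_interval r0 r1"
  have v0S: "v0 \<in> S" using v0 unfolding S_def log_interval_def by simp
  have oS: "open S" unfolding S_def by (rule open_log_interval)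
  have "harmonic_hom_poly k (Y l)"
    using Y l unfolding sph_harm_onb_def by blast
  from polyharmonic_radial_data[OF d2 tau poly this]
  obtain Q where Q0: "Q 0 = ft"
    and dQ: "\<And>n v. v \<in> S \<Longrightarrow> (Q n has_vector_derivative of_int (lam d k n) * Q n v + Q (Suc n) v) (at v)"
    and DnQ: "\<And>n v. v \<in> S \<Longrightarrow> Dn d k n ft v = Q n v"
    and bound: "\<And>a b c \<epsilon>. a \<le> b \<Longrightarrow> b < c \<Longrightarrow> {a..c} \<subseteq> S \<Longrightarrow> 0 < \<epsilon> \<Longrightarrow>
      \<exists>C\<ge>0. \<forall>n. \<forall>s\<in>{a..b}. norm (Q n s) \<le> C * fact (n + 1) * (exp b * (\<tau> + \<epsilon>)) ^ n"
    unfolding S_def[symmetric] ft_def[symmetric] d_def[symmetric] by blast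
  \<comment> \<open>Room to the right, as the growth bound requires; it exists because
    \<open>S\<close> is open.\<close>
  have right: "\<exists>c>b. {a..c} \<subseteq> S" if ab: "a \<in> S" "b \<in> S" for a b
  proof -
    obtain e where e: "e > 0" "cball b e \<subseteq> S"
      using oS ab(2) open_contains_cball by blast
    have "b + e \<in> S" using e by (auto simp: cball_eq_atLeastAtMost subset_iff)
    then show ?thesis
      using log_interval_atLeastAtMost_subset[of a r0 r1 "b + e"] ab e unfolding S_def
      by (intro exI[of _ "b + e"]) auto
  qed
  define c where "c = (\<lambda>n. Q n v0)"
  define P where "P = (\<lambda>N z. \<Sum>n<N. c n * Phi d k n (z - of_real v0))"
  define PN where "PN = (\<lambda>N z. \<Sum>n<N. norm (c n * Phi d k n (z - of_real v0)))"
  define \<Sigma> where "\<Sigma> = (\<lambda>z. \<Sum>n. c n * Phi d k n (z - of_real v0))"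
  \<comment> \<open>Only the coefficients at \<open>v0\<close> matter here, so the growth bound is
    used on the degenerate interval [v0, v0]; this produces e^v0, and no larger exponential, in the
    radius.\<close>
  have unif: "uniformly_convergent_on (cball (of_real v0) \<rho>) P \<and> uniformly_convergent_on (cball (of_real v0) \<rho>) PN"
    if \<rho>: "0 \<le> \<rho>" "exp v0 * \<tau> * (exp \<rho> - 1) < 1" for \<rho>
  proof -
    obtain \<epsilon> where \<epsilon>: "\<epsilon> > 0" "exp v0 * (\<tau> + \<epsilon>) * (exp \<rho> - 1) < 1"
      using exists_pos_add_mult_less_1[of "exp v0" "exp \<rho> - 1" \<tau>] \<rho> by auto
    obtain b where "b > v0" "{v0..b} \<subseteq> S" using right[OF v0S v0S] by blast
    then obtain C where C: "C \<ge> 0" "\<And>n. norm (c n) \<le> C * fact (n + 1) * (exp v0 * (\<tau> + \<epsilon>)) ^ n"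
      using bound[of v0 v0 b \<epsilon>] \<epsilon> unfolding c_def by auto
    have q: "0 \<le> exp v0 * (\<tau> + \<epsilon>)" using tau \<epsilon> by simp
    have shift: "z - of_real v0 \<in> cball 0 \<rho>" if "z \<in> cball (of_real v0) \<rho>" for z :: complex
      using that by (simp add: dist_norm norm_minus_commute)
    note u = uniformly_convergent_Phi_series[OF d1 C(1) q \<rho>(1) \<epsilon>(2) C(2), of k]
    obtain l1 where l1: "uniform_limit (cball 0 \<rho>) (\<lambda>N z. \<Sum>n<N. c n * Phi d k n z) l1 sequentially"
      using u(1) unfolding uniformly_convergent_on_def by blast
    obtain l2 where l2: "uniform_limit (cball 0 \<rho>) (\<lambda>N z. \<Sum>n<N. norm (c n * Phi d k n z)) l2 sequentially"
      using u(2) unfolding uniformly_convergent_on_def by blast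
    show ?thesis
      unfolding uniformly_convergent_on_def P_def PN_def
      by (intro conjI exI, rule uniform_limit_shift[OF l1 shift], assumption, rule uniform_limit_shift[OF l2 shift], assumption)
  qed
  have radius: "exp v0 * \<tau> * (exp \<rho> - 1) < 1" if "\<tau> = 0 \<or> \<rho> < ln (1 + 1 / (exp v0 * \<tau>))" for \<rho>
  proof (cases "\<tau> = 0")
    case False
    then have t: "exp v0 * \<tau> > 0" using tau by simp
    then have "1 + 1 / (exp v0 * \<tau>) > 0" by (simp add: add_pos_pos)
    then have "exp \<rho> < 1 + 1 / (exp v0 * \<tau>)"
      using that False by (metis exp_less_mono exp_ln)
    then have "exp \<rho> - 1 < 1 / (exp v0 * \<tau>)" by simp
    then show ?thesis using t by (simp add: pos_less_divide_eq mult.commute)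
  qed simp
  have conv: "uniformly_convergent_on K P \<and> uniformly_convergent_on K PN" if K: "compact K" "K \<subseteq> Disc" for K
  proof -
    \<comment> \<open>A nonempty compact subset of the disc has a point farthest from the centre, at
      a distance still below the radius; the empty set is assigned radius 0.\<close>
    have "\<exists>\<rho>\<ge>0. K \<subseteq> cball (of_real v0) \<rho> \<and> (\<tau> = 0 \<or> \<rho> < ln (1 + 1 / (exp v0 * \<tau>)))"
    proof (cases "K = {}")
      case True
      have "0 < ln (1 + 1 / (exp v0 * \<tau>))" if "\<tau> \<noteq> 0" using that tau by (intro ln_gt_zero) simp
      then show ?thesis using True by (intro exI[of _ 0]) auto
    next
      case False
      obtain x where x: "x \<in> K" "\<And>y. y \<in> K \<Longrightarrow> dist (of_real v0) y \<le> dist (of_real v0) x"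
        using distance_attains_sup[OF K(1) False] by blast
      then show ?thesis
        using K(2) unfolding Disc_def by (intro exI[of _ "dist (of_real v0) x"]) (auto split: if_splits)
    qed
    then obtain \<rho> where \<rho>: "0 \<le> \<rho>" "K \<subseteq> cball (of_real v0) \<rho>" "exp v0 * \<tau> * (exp \<rho> - 1) < 1"
      using radius by blast
    note u = unif[OF \<rho>(1,3)]
    show ?thesis
      by (intro conjI uniformly_convergent_on_subset[OF conjunct1[OF u] \<rho>(2)]
          uniformly_convergent_on_subset[OF conjunct2[OF u] \<rho>(2)])
  qed
  have hol: "\<Sigma> holomorphic_on Disc"
  proof (rule holomorphic_uniform_sequence)
    show oD: "open Disc" unfolding Disc_def by simp
    have "(\<lambda>z. z - of_real v0) holomorphic_on Disc" by (intro holomorphic_intros)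
    from holomorphic_on_compose_gen[OF this Phi_holomorphic[of d k _ UNIV]]
    have "(\<lambda>z. Phi d k m (z - of_real v0)) holomorphic_on Disc" for m
      by (simp add: o_def)
    then show "P n holomorphic_on Disc" for n
      unfolding P_def by (intro holomorphic_on_sum holomorphic_on_mult holomorphic_on_const)
    fix x assume "x \<in> Disc"
    then obtain e where e: "e > 0" "cball x e \<subseteq> Disc" using oD open_contains_cball by blast
    have "uniform_limit (cball x e) P \<Sigma> sequentially"
      using conv[of "cball x e"] e
      unfolding uniformly_convergent_uniform_limit_iff P_def \<Sigma>_def suminf_eq_lim by simp
    then show "\<exists>d>0. cball x d \<subseteq> Disc \<and> uniform_limit (cball x d) P \<Sigma> sequentially"
      using e by blast
  qed
  \<comment> \<open>Identification uses the growth bound along all of [alpha, beta], which brings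
    e^beta and the length of the interval into the condition.\<close>
  have sums: "\<Sigma> (of_real v) = ft v"
    if v: "v \<in> {\<alpha>..\<beta>}" "v0 \<in> {\<alpha>..\<beta>}" "\<alpha> \<in> S" "\<beta> \<in> S" and \<epsilon>: "\<epsilon> > 0" "exp \<beta> * (\<tau> + \<epsilon>) * (exp (\<beta> - \<alpha>) - 1) < 1"
    for v \<alpha> \<beta> \<epsilon>
  proof -
    obtain b where b: "b > \<beta>" "{\<alpha>..b} \<subseteq> S" using right[OF v(3,4)] by blast
    have \<alpha>\<beta>: "\<alpha> \<le> \<beta>" using v by simp
    obtain C where C: "C \<ge> 0" "\<And>n s. s \<in> {\<alpha>..\<beta>} \<Longrightarrow> norm (Q n s) \<le> C * fact (n + 1) * (exp \<beta> * (\<tau> + \<epsilon>)) ^ n"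
      using bound[OF \<alpha>\<beta> b \<epsilon>(1)] by blast
    have q: "0 \<le> exp \<beta> * (\<tau> + \<epsilon>)" using tau \<epsilon> by simp
    have "(\<lambda>n. Q n v0 * Phi d k n (of_real v - of_real v0)) sums Q 0 v"
      by (rule Phi_series_sums[OF d1 C(1) q \<epsilon>(2) dQ C(2) v(1,2)]) (use b in auto)
    then show ?thesis unfolding \<Sigma>_def c_def Q0 by (simp add: sums_iff)
  qed
  have near: "\<exists>\<delta>>0. \<forall>v\<in>{v0..v0+\<delta>}. r0 < exp v \<and> ereal (exp v) < r1 \<and> \<Sigma> (of_real v) = ft v"
  proof -
    obtain b where b: "b > v0" "{v0..b} \<subseteq> S" using right[OF v0S v0S] by blast
    \<comment> \<open>The choice is eps = 1. As \<open>M\<close> bounds e^v (tau + 1) up to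
      \<open>b\<close>, and \<open>\<delta>\<close> makes e^delta - 1 at most 1/(2M), the product
      required by \<open>sums\<close> is at most 1/2.\<close>
    define M where "M = exp b * (\<tau> + 1)"
    have M: "M > 0" unfolding M_def using tau by simp
    define \<delta> where "\<delta> = min (b - v0) (ln (1 + 1 / (2 * M)))"
    have "ln (1 + 1 / (2 * M)) > 0" using M by (intro ln_gt_zero) simp
    then have \<delta>: "\<delta> > 0" unfolding \<delta>_def using b by simp
    have vb: "v0 + \<delta> \<le> b" unfolding \<delta>_def by simp
    have "exp \<delta> \<le> exp (ln (1 + 1 / (2 * M)))" unfolding \<delta>_def by simp
    also have "\<dots> = 1 + 1 / (2 * M)" using M by (intro exp_ln add_pos_pos) auto
    finally have e\<delta>: "exp \<delta> - 1 \<le> 1 / (2 * M)" by simp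
    have "exp (v0 + \<delta>) * (\<tau> + 1) * (exp (v0 + \<delta> - v0) - 1) \<le> M * (1 / (2 * M))"
    proof (rule mult_mono)
      show "exp (v0 + \<delta>) * (\<tau> + 1) \<le> M"
        unfolding M_def using vb tau by (intro mult_right_mono) auto
    qed (use e\<delta> \<delta> M in auto)
    also have "\<dots> < 1" using M by simp
    finally have lt: "exp (v0 + \<delta>) * (\<tau> + 1) * (exp (v0 + \<delta> - v0) - 1) < 1" .
    have \<delta>S: "v0 + \<delta> \<in> S" using b(2) \<delta> vb by (auto simp: subset_iff)
    have "\<Sigma> (of_real v) = ft v" if "v \<in> {v0..v0+\<delta>}" for v
      by (rule sums[OF that _ v0S \<delta>S _ lt]) (use \<delta> in auto)
    moreover have "v \<in> S" if "v \<in> {v0..v0+\<delta>}" for v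
      using that b(2) vb by (auto simp: subset_iff)
    ultimately show ?thesis
      using \<delta> unfolding S_def log_interval_def by auto
  qed
  \<comment> \<open>For tau = 0 the condition in \<open>sums\<close> reads e^beta eps (e^(beta -
    alpha) - 1) < 1, which a small eps achieves on any interval, on both sides of
    \<open>v0\<close>.\<close>
  have entire: "\<Sigma> (of_real v) = ft v" if t0: "\<tau> = 0" "v \<in> S" for v
  proof -
    define \<alpha> \<beta> where "\<alpha> = min v v0" and "\<beta> = max v v0"
    have \<alpha>\<beta>: "\<alpha> \<in> S" "\<beta> \<in> S" "\<alpha> \<le> \<beta>" using t0 v0S unfolding \<alpha>_def \<beta>_def by (auto simp: min_def max_def)
    obtain \<epsilon> where "\<epsilon> > 0" "exp \<beta> * (\<tau> + \<epsilon>) * (exp (\<beta> - \<alpha>) - 1) < 1"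
      using exists_pos_add_mult_less_1[of "exp \<beta>" "exp (\<beta> - \<alpha>) - 1" \<tau>] \<alpha>\<beta> t0 by auto
    then show ?thesis
      by (intro sums[OF _ _ \<alpha>\<beta>(1,2)]) (auto simp: \<alpha>_def \<beta>_def)
  qed
  \<comment> \<open>The substitution v = log r is undone by the principal logarithm, which is
    holomorphic on exactly this slit plane.\<close>
  have slit: "(\<lambda>z. \<Sigma> (Ln z)) holomorphic_on (- {z. Im z = 0 \<and> Re z \<le> 0})" if "\<tau> = 0"
  proof -
    have "\<Sigma> holomorphic_on UNIV" using hol that unfolding Disc_def by simp
    moreover have "Ln holomorphic_on (- {z. Im z = 0 \<and> Re z \<le> 0})"
      by (intro holomorphic_intros) (auto simp: complex_nonpos_Reals_iff)
    ultimately show ?thesis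
      using holomorphic_on_compose_gen[of Ln _ \<Sigma> UNIV] by (simp add: o_def)
  qed
  have slit_eq: "\<Sigma> (Ln (of_real r)) = radial_coeff f (Y l) r" if "\<tau> = 0" "r0 < r" "ereal r < r1" for r
  proof -
    have "r > 0" using that r0 by simp
    then have "\<Sigma> (Ln (of_real r)) = \<Sigma> (of_real (ln r))" by (simp add: Ln_of_real)
    also have "\<dots> = ft (ln r)"
      by (rule entire) (use that \<open>r > 0\<close> in \<open>auto simp: S_def log_interval_def\<close>)
    finally show ?thesis unfolding ft_def using \<open>r > 0\<close> by simp
  qed
  have cQ: "Dn d k n ft v0 = c n" for n
    using DnQ[OF v0S] unfolding c_def .
  show ?thesis
    unfolding d_def[symmetric] cQ P_def[symmetric] PN_def[symmetric]
  proof (intro conjI impI allI)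
    show "uniformly_convergent_on K P" "uniformly_convergent_on K PN" if "compact K \<and> K \<subseteq> Disc" for K
      using conv that by blast+
    show "(\<lambda>z. \<Sum>n. c n * Phi d k n (z - of_real v0)) holomorphic_on Disc"
      using hol unfolding \<Sigma>_def .
    show "\<exists>\<delta>>0. \<forall>v\<in>{v0..v0+\<delta>}. r0 < exp v \<and> ereal (exp v) < r1 \<and>
        (\<Sum>n. c n * Phi d k n (of_real v - of_real v0)) = ft v"
      using near unfolding \<Sigma>_def .
    assume "\<tau> = 0"
    then show "\<exists>F. F holomorphic_on UNIV \<and> (\<forall>v. r0 < exp v \<and> ereal (exp v) < r1 \<longrightarrow> F (of_real v) = ft v)"
      using hol entire unfolding Disc_def S_def log_interval_def by (intro exI[of _ \<Sigma>]) auto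
    show "\<exists>G. G holomorphic_on (- {z. Im z = 0 \<and> Re z \<le> 0}) \<and>
        (\<forall>r. r0 < r \<and> ereal r < r1 \<longrightarrow> G (of_real r) = radial_coeff f (Y l) r)"
      using slit slit_eq \<open>\<tau> = 0\<close> by (intro exI[of _ "\<lambda>z. \<Sigma> (Ln z)"]) auto
  qed
qed

end
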